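(* Let $K$ be a field of characteristic $0$. For every $n\ge 1$, the space $L_n$ of symbols of multilinear Lie elements of degree $n$ satisfies $$\dim_K L_n=[z^{n-1}]\prod_{j=1}^{n}(1+z+\cdots+z^{j-1}),$$ where $[z^{r}]F(z)$ denotes the coefficient of $z^r$ in $F(z)$. Equivalently, $\dim_K L_n$ is the number of permutations of $n$ letters having exactly $n-1$ inversions.
   Context: A Novikov algebra over $K$ is a (nonassociative) algebra $(N,\circ)$ satisfying $(a\circ b)\circ c-a\circ(b\circ c)=(b\circ a)\circ c-b\circ(a\circ c)$ and $(a\circ b)\circ c=(a\circ c)\circ b$. Its commutator $[a,b]=a\circ b-b\circ a$ satisfies the Jacobi identity; the resulting Lie algebra is denoted $N^{(-)}$. Let $X=\{x_1,\ldots,x_n\}$ and let $K\{X\}=K[x_i^{(r)}\mid 1\le i\le n,\ r\ge 0]$ be the free commutative differential algebra, with $x_i=x_i^{(0)}$ and derivation $D$ given by $D(x_i^{(r)})=x_i^{(r+1)}$. With the product $f\circ g=f\,D(g)$ it is a Novikov algebra, and (Dzhumadil'daev–Löfwall) the subalgebra of $(K\{X\},\circ)$ generated by $X$ is the free Novikov algebra $\mathrm{Nov}\langle X\rangle$ on $X$; we identify the two. $\mathrm{Nov}(n)$ denotes the multilinear component of $\mathrm{Nov}\langle X\rangle$ in $x_1,\ldots,x_n$; it has as basis the differential monomials $x_1^{(\alpha_1)}\cdots x_n^{(\alpha_n)}$ with $\alpha\in\mathbb Z_{\ge0}^n$, $\alpha_1+\cdots+\alpha_n=n-1$. The symbol $P_f$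 of $f\in\mathrm{Nov}(n)$ is its image under the linear isomorphism $x_1^{(\alpha_1)}\cdots x_n^{(\alpha_n)}\mapsto t_1^{\alpha_1}\cdots t_n^{\alpha_n}$ from $\mathrm{Nov}(n)$ onto the space $S_{n-1}$ of homogeneous polynomials of degree $n-1$ in $K[t_1,\ldots,t_n]$. An element of $\mathrm{Nov}\langle X\rangle$ is a Lie element if it belongs to the Lie subalgebra of $\mathrm{Nov}\langle X\rangle^{(-)}$ generated by $X$. Put $L_n=\{P_f\mid f\in\mathrm{Nov}(n)\text{ is a Lie element}\}\subseteq S_{n-1}$. *)

theory Defs
  imports
    Complex_Main
    "HOL-Library.Poly_Mapping"
    "HOL-Computational_Algebra.Polynomial"
    "HOL-Combinatorics.Permutations"
begin

section \<open>Linear structure on finitely supported functions\<close>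

definition scale :: "'k::field \<Rightarrow> ('a \<Rightarrow>\<^sub>0 'k) \<Rightarrow> ('a \<Rightarrow>\<^sub>0 'k)" where
  "scale c p = Poly_Mapping.map ((*) c) p"

text \<open>The linear map determined by its values on the basis \<open>Poly_Mapping.single a 1\<close>.\<close>

definition lin_ext :: "('a \<Rightarrow> ('b \<Rightarrow>\<^sub>0 'k)) \<Rightarrow> ('a \<Rightarrow>\<^sub>0 'k::field) \<Rightarrow> ('b \<Rightarrow>\<^sub>0 'k)" where
  "lin_ext g p = (\<Sum>a\<in>Poly_Mapping.keys p. scale (Poly_Mapping.lookup p a) (g a))"

lemma lookup_scale: "Poly_Mapping.lookup (scale c p) a = c * Poly_Mapping.lookup p a"
  unfolding scale_def by (simp add: Poly_Mapping.map.rep_eq when_def)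

interpretation scale: vector_space scale
  by unfold_locales
    (auto intro!: poly_mapping_eqI simp: lookup_scale lookup_add algebra_simps)

lemma scale_single: "scale c (Poly_Mapping.single a d) = Poly_Mapping.single a (c * d)"
  by (rule poly_mapping_eqI) (simp add: lookup_scale lookup_single when_def)

lemma scale_mult_left: "scale c p * q = scale c (p * (q :: 'a::comm_monoid_add \<Rightarrow>\<^sub>0 _))"
  by (simp add: scale_def mult_map_scale_conv_mult mult.assoc)

lemma scale_mult_right: "p * scale c q = scale c (p * (q :: 'a::comm_monoid_add \<Rightarrow>\<^sub>0 _))"
  by (metis scale_mult_left mult.commute)

lemma lin_ext_superset:
  assumes "finite A" "Poly_Mapping.keys p \<subseteq> A"
  shows "lin_ext g p = (\<Sum>a\<in>A. scale (Poly_Mapping.lookup p a) (g a))"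
  unfolding lin_ext_def
  by (rule sum.mono_neutral_left) (use assms in \<open>auto simp: in_keys_iff\<close>)

lemma lin_ext_add: "lin_ext g (p + q) = lin_ext g p + lin_ext g q"
proof -
  let ?A = "Poly_Mapping.keys p \<union> Poly_Mapping.keys q"
  have "lin_ext g r = (\<Sum>a\<in>?A. scale (Poly_Mapping.lookup r a) (g a))"
    if "Poly_Mapping.keys r \<subseteq> ?A" for r
    using that by (intro lin_ext_superset) auto
  moreover have "Poly_Mapping.keys (p + q) \<subseteq> ?A"
    by (rule Poly_Mapping.keys_add)
  ultimately show ?thesis
    by (simp add: lookup_add scale.scale_left_distrib sum.distrib)
qed

lemma lin_ext_scale: "lin_ext g (scale c p) = scale c (lin_ext g p)"
proof -
  have "Poly_Mapping.keys (scale c p) \<subseteq> Poly_Mapping.keys p"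
    by (auto simp: in_keys_iff lookup_scale)
  then have "lin_ext g (scale c p) =
      (\<Sum>a\<in>Poly_Mapping.keys p. scale (Poly_Mapping.lookup (scale c p) a) (g a))"
    by (intro lin_ext_superset) auto
  then show ?thesis
    by (simp add: lin_ext_def scale.scale_sum_right lookup_scale)
qed

lemma lin_ext_0 [simp]: "lin_ext g 0 = 0"
  by (simp add: lin_ext_def)

lemma lin_ext_single: "lin_ext g (Poly_Mapping.single a c) = scale c (g a)"
  by (subst lin_ext_superset[of "{a}"]) auto

lemma poly_mapping_linear_induct [case_names zero single add]:
  assumes "P 0" "\<And>a c. P (Poly_Mapping.single a c)"
    and "\<And>p q. P p \<Longrightarrow> P q \<Longrightarrow> P (p + q)"
  shows "P (p :: 'a \<Rightarrow>\<^sub>0 'k::comm_monoid_add)"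
proof -
  have "p = (\<Sum>a\<in>Poly_Mapping.keys p. Poly_Mapping.single a (Poly_Mapping.lookup p a))"
    by (rule poly_mapping_eqI)
      (auto simp: lookup_sum lookup_single when_def sum.delta in_keys_iff)
  moreover have "P (\<Sum>a\<in>A. Poly_Mapping.single a (Poly_Mapping.lookup p a))" if "finite A" for A
    using that by induction (use assms in auto)
  ultimately show ?thesis
    by (metis finite_keys)
qed


section \<open>Differential polynomials and the Novikov product\<close>

text \<open>
  The index \<open>(i, r)\<close> stands for the variable \<open>x\<^sub>i\<^sup>(\<^sup>r\<^sup>)\<close>. The type has variables
  for all \<open>i\<close>; the restriction to \<open>1 \<le> i \<le> n\<close> is imposed through the generators of the subalgebras below.
\<close>

type_synonym dmonom = "(nat \<times> nat) \<Rightarrow>\<^sub>0 nat"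
type_synonym 'k dpoly = "dmonom \<Rightarrow>\<^sub>0 'k"

definition dvar :: "nat \<Rightarrow> nat \<Rightarrow> 'k::field dpoly" where
  "dvar i r = Poly_Mapping.single (Poly_Mapping.single (i, r) 1) 1"

text \<open>
  On a monomial the Leibniz rule gives
  \<open>D m = (\<Sum>v. e\<^sub>v \<cdot> (m / v) \<cdot> v')\<close>, where \<open>e\<^sub>v\<close> is the exponent of \<open>v\<close> in \<open>m\<close>.
\<close>

definition D_monom :: "dmonom \<Rightarrow> 'k::field dpoly" where
  "D_monom m = (\<Sum>v\<in>Poly_Mapping.keys m.
     Poly_Mapping.single
       (m - Poly_Mapping.single v 1 + Poly_Mapping.single (fst v, Suc (snd v)) 1)
       (of_nat (Poly_Mapping.lookup m v)))"

definition D :: "'k::field dpoly \<Rightarrow> 'k dpoly" where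
  "D = lin_ext D_monom"

lemma D_add: "D (f + g) = D f + D g"
  by (simp add: D_def lin_ext_add)

lemma D_scale: "D (scale c f) = scale c (D f)"
  by (simp add: D_def lin_ext_scale)

lemma D_dvar: "D (dvar i r) = dvar i (Suc r)"
  by (simp add: D_def dvar_def lin_ext_single D_monom_def)

lemma D_monom_superset:
  assumes "finite A" "Poly_Mapping.keys m \<subseteq> A"
  shows "D_monom m = (\<Sum>v\<in>A.
     Poly_Mapping.single
       (m - Poly_Mapping.single v 1 + Poly_Mapping.single (fst v, Suc (snd v)) 1)
       (of_nat (Poly_Mapping.lookup m v)))"
  unfolding D_monom_def
  by (rule sum.mono_neutral_left) (use assms in \<open>auto simp: in_keys_iff\<close>)

lemma monom_minus_var:
  fixes m m' :: "'v \<Rightarrow>\<^sub>0 nat"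
  assumes "Poly_Mapping.lookup m v \<noteq> 0"
  shows "m + m' - Poly_Mapping.single v 1 = m - Poly_Mapping.single v 1 + m'"
  by (rule poly_mapping_eqI)
    (use assms in \<open>auto simp: lookup_add lookup_minus lookup_single when_def\<close>)

lemma D_monom_add:
  "D_monom (m + m') =
     (D_monom m * Poly_Mapping.single m' 1 + Poly_Mapping.single m 1 * D_monom m' :: 'k::field dpoly)"
proof -
  let ?A = "Poly_Mapping.keys m \<union> Poly_Mapping.keys m'"
  let ?s = "\<lambda>v. Poly_Mapping.single (fst v, Suc (snd v)) (1::nat)"
  let ?t = "\<lambda>(m::dmonom) v. Poly_Mapping.single (m - Poly_Mapping.single v 1 + ?s v)
              (of_nat (Poly_Mapping.lookup m v) :: 'k)"
  have *: "?t (m + m') v = ?t m v * Poly_Mapping.single m' 1 + Poly_Mapping.single m 1 * ?t m' v"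
    (is "?l = ?r") for v
  proof -
    let ?k = "m + m' - Poly_Mapping.single v 1 + ?s v"
    have k1: "m - Poly_Mapping.single v 1 + ?s v + m' = ?k" if "Poly_Mapping.lookup m v \<noteq> 0"
      unfolding monom_minus_var[of m v m', OF that] by (simp only: ac_simps)
    have k2: "m + (m' - Poly_Mapping.single v 1 + ?s v) = ?k" if "Poly_Mapping.lookup m' v \<noteq> 0"
      unfolding add.commute[of m m'] monom_minus_var[of m' v m, OF that] by (simp only: ac_simps)
    have 1: "?t m v * Poly_Mapping.single m' 1 =
        Poly_Mapping.single ?k (of_nat (Poly_Mapping.lookup m v))"
      using k1 by (cases "Poly_Mapping.lookup m v = 0") (simp_all add: mult_single del: One_nat_def)
    have 2: "Poly_Mapping.single m 1 * ?t m' v =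
        Poly_Mapping.single ?k (of_nat (Poly_Mapping.lookup m' v))"
      using k2 by (cases "Poly_Mapping.lookup m' v = 0") (simp_all add: mult_single del: One_nat_def)
    show ?thesis
      unfolding 1 2 by (simp add: lookup_add single_add)
  qed
  have "D_monom (m + m') = (\<Sum>v\<in>?A. ?t (m + m') v)"
    using Poly_Mapping.keys_add[of m m'] by (intro D_monom_superset) auto
  also have "\<dots> = (\<Sum>v\<in>?A. ?t m v) * Poly_Mapping.single m' 1
      + Poly_Mapping.single m 1 * (\<Sum>v\<in>?A. ?t m' v)"
    by (simp only: * sum.distrib sum_distrib_left sum_distrib_right)
  also have "(\<Sum>v\<in>?A. ?t m v) = D_monom m"
    by (rule D_monom_superset[symmetric]) auto
  also have "(\<Sum>v\<in>?A. ?t m' v) = D_monom m'"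
    by (rule D_monom_superset[symmetric]) auto
  finally show ?thesis .
qed

lemma D_mult: "D (f * g :: 'k::field dpoly) = D f * g + f * D g"
proof (induction f rule: poly_mapping_linear_induct)
  case zero
  show ?case by (simp add: D_def)
next
  case (add p q)
  then show ?case by (simp add: D_add algebra_simps)
next
  case (single m c)
  show ?case
  proof (induction g rule: poly_mapping_linear_induct)
    case zero
    show ?case by (simp add: D_def)
  next
    case (add p q)
    then show ?case by (simp add: D_add algebra_simps)
  next
    case (single m' c')
    have eq: "Poly_Mapping.single a b = scale b (Poly_Mapping.single a 1)" for a :: dmonom and b :: 'k
      by (simp add: scale_single)
    have "D (Poly_Mapping.single m c * Poly_Mapping.single m' c') =
        scale (c * c') (D_monom (m + m'))"
      by (simp add: mult_single D_def lin_ext_single)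
    moreover have "D (Poly_Mapping.single m c) * Poly_Mapping.single m' c' =
        scale (c * c') (D_monom m * Poly_Mapping.single m' 1)"
      by (subst eq[of m' c'])
        (simp add: D_def lin_ext_single scale_mult_left scale_mult_right mult.commute)
    moreover have "Poly_Mapping.single m c * D (Poly_Mapping.single m' c') =
        scale (c * c') (Poly_Mapping.single m 1 * D_monom m')"
      by (subst eq[of m c])
        (simp add: D_def lin_ext_single scale_mult_left scale_mult_right mult.commute)
    ultimately show ?case
      by (simp add: D_monom_add scale.scale_right_distrib)
  qed
qed

definition nov_mult :: "'k::field dpoly \<Rightarrow> 'k dpoly \<Rightarrow> 'k dpoly" where
  "nov_mult f g = f * D g"

definition nov_bracket :: "'k::field dpoly \<Rightarrow> 'k dpoly \<Rightarrow> 'k dpoly" where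
  "nov_bracket f g = nov_mult f g - nov_mult g f"

lemma nov_mult_left_symmetric:
  "nov_mult (nov_mult a b) c - nov_mult a (nov_mult b c) =
   nov_mult (nov_mult b a) c - nov_mult b (nov_mult a c)"
  by (simp add: nov_mult_def D_mult algebra_simps)

lemma nov_mult_right_commutative:
  "nov_mult (nov_mult a b) c = nov_mult (nov_mult a c) b"
  by (simp add: nov_mult_def algebra_simps)


section \<open>Generated subalgebras\<close>

inductive_set gen_subalgebra ::
  "('k::field dpoly \<Rightarrow> 'k dpoly \<Rightarrow> 'k dpoly) \<Rightarrow> 'k dpoly set \<Rightarrow> 'k dpoly set"
  for mul X where
  gen: "f \<in> X \<Longrightarrow> f \<in> gen_subalgebra mul X"
| zero: "0 \<in> gen_subalgebra mul X"
| add: "f \<in> gen_subalgebra mul X \<Longrightarrow> g \<in> gen_subalgebra mul X \<Longrightarrow> f + g \<in> gen_subalgebra mul X"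
| scale: "f \<in> gen_subalgebra mul X \<Longrightarrow> scale c f \<in> gen_subalgebra mul X"
| mul: "f \<in> gen_subalgebra mul X \<Longrightarrow> g \<in> gen_subalgebra mul X \<Longrightarrow> mul f g \<in> gen_subalgebra mul X"

definition gens :: "nat \<Rightarrow> 'k::field dpoly set" where
  "gens n = (\<lambda>i. dvar i 0) ` {1..n}"

definition free_novikov :: "nat \<Rightarrow> 'k::field dpoly set" where
  "free_novikov n = gen_subalgebra nov_mult (gens n)"

definition lie_elements :: "nat \<Rightarrow> 'k::field dpoly set" where
  "lie_elements n = gen_subalgebra nov_bracket (gens n)"

lemma lie_elements_subset: "lie_elements n \<subseteq> (free_novikov n :: 'k::field dpoly set)"
proof
  fix f :: "'k dpoly" assume "f \<in> lie_elements n"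
  then show "f \<in> free_novikov n"
    unfolding lie_elements_def free_novikov_def
  proof induction
    case (mul f g)
    have "nov_bracket f g = nov_mult f g + scale (-1) (nov_mult g f)"
      by (simp add: nov_bracket_def)
    then show ?case
      using mul by (metis gen_subalgebra.add gen_subalgebra.scale gen_subalgebra.mul)
  qed (auto intro: gen_subalgebra.intros)
qed


section \<open>The multilinear component and symbols\<close>

text \<open>The degree of a monomial in the generator \<open>x\<^sub>i\<close>, all of its derivatives counted.\<close>

definition deg_in :: "nat \<Rightarrow> dmonom \<Rightarrow> nat" where
  "deg_in i m = (\<Sum>v\<in>{v \<in> Poly_Mapping.keys m. fst v = i}. Poly_Mapping.lookup m v)"

definition multilinear :: "nat \<Rightarrow> 'k::field dpoly \<Rightarrow> bool" where
  "multilinear n f \<longleftrightarrow>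
     (\<forall>m\<in>Poly_Mapping.keys f. \<forall>i. deg_in i m = (if i \<in> {1..n} then 1 else 0))"

definition Nov :: "nat \<Rightarrow> 'k::field dpoly set" where
  "Nov n = {f \<in> free_novikov n. multilinear n f}"

text \<open>Polynomials in \<open>t\<^sub>0, t\<^sub>1, \<dots>\<close>; only \<open>t\<^sub>1, \<dots>, t\<^sub>n\<close> occur in symbols of elements of \<open>Nov n\<close>.\<close>

type_synonym 'k tpoly = "(nat \<Rightarrow>\<^sub>0 nat) \<Rightarrow>\<^sub>0 'k"

definition tvar :: "nat \<Rightarrow> 'k::field tpoly" where
  "tvar i = Poly_Mapping.single (Poly_Mapping.single i 1) 1"

definition symbol_monom :: "dmonom \<Rightarrow> (nat \<Rightarrow>\<^sub>0 nat)" where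
  "symbol_monom m =
     (\<Sum>v\<in>Poly_Mapping.keys m. Poly_Mapping.single (fst v) (Poly_Mapping.lookup m v * snd v))"

text \<open>
  The linear map with \<open>x\<^sub>i\<^sup>(\<^sup>r\<^sup>) \<mapsto> t\<^sub>i\<^sup>r\<close>, multiplicative on monomials. It is defined on all differential
  polynomials but is only used on \<open>Nov n\<close>.
\<close>

definition symbol :: "'k::field dpoly \<Rightarrow> 'k tpoly" where
  "symbol = lin_ext (\<lambda>m. Poly_Mapping.single (symbol_monom m) 1)"

definition lie_symbols :: "nat \<Rightarrow> 'k::field tpoly set" where
  "lie_symbols n = symbol ` (Nov n \<inter> lie_elements n)"

lemma prod_single:
  "finite A \<Longrightarrow> (\<Prod>i\<in>A. Poly_Mapping.single (g i) (1::'k::field)) =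
     Poly_Mapping.single (\<Sum>i\<in>A. (g i :: 'v \<Rightarrow>\<^sub>0 nat)) 1"
  by (induction A rule: finite_induct) (auto simp: mult_single)

lemma tvar_power: "tvar i ^ r = Poly_Mapping.single (Poly_Mapping.single i r) 1"
  by (induction r) (auto simp: tvar_def mult_single simp flip: single_add)

lemma symbol_dvar_prod:
  "symbol (\<Prod>i=1..n. dvar i (\<alpha> i) :: 'k::field dpoly) = (\<Prod>i=1..n. tvar i ^ \<alpha> i)"
proof -
  let ?m = "\<Sum>i=1..n. Poly_Mapping.single (i, \<alpha> i) (1::nat)"
  have look: "Poly_Mapping.lookup ?m v = (if fst v \<in> {1..n} \<and> snd v = \<alpha> (fst v) then 1 else 0)" for v
  proof -
    have "Poly_Mapping.lookup ?m v =
        (\<Sum>i=1..n. if i = fst v then (if snd v = \<alpha> i then 1 else 0) else 0)"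
      unfolding lookup_sum by (rule sum.cong) (auto simp: lookup_single when_def prod_eq_iff)
    also have "\<dots> = (if fst v \<in> {1..n} then (if snd v = \<alpha> (fst v) then 1 else 0) else 0)"
      by (rule sum.delta) simp
    finally show ?thesis by simp
  qed
  have keys: "Poly_Mapping.keys ?m = (\<lambda>i. (i, \<alpha> i)) ` {1..n}"
    by (auto simp: in_keys_iff look simp del: One_nat_def split: if_splits)
  have "symbol_monom ?m = (\<Sum>i=1..n. Poly_Mapping.single i (\<alpha> i))"
    unfolding symbol_monom_def keys
    by (subst sum.reindex) (auto simp: inj_on_def look simp del: One_nat_def)
  then show ?thesis
    by (simp add: dvar_def prod_single symbol_def lin_ext_single tvar_power del: One_nat_def)
qed

lemma subspace_lie_symbols: "scale.subspace (lie_symbols n :: 'k::field tpoly set)"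
proof -
  have ml: "multilinear n (0::'k dpoly)"
    "\<And>f g :: 'k dpoly. multilinear n f \<Longrightarrow> multilinear n g \<Longrightarrow> multilinear n (f + g)"
    "\<And>c (f :: 'k dpoly). multilinear n f \<Longrightarrow> multilinear n (scale c f)"
    unfolding multilinear_def using Poly_Mapping.keys_add
    by (fastforce simp: in_keys_iff lookup_scale)+
  have N: "(0::'k dpoly) \<in> Nov n \<inter> lie_elements n"
    "\<And>f g :: 'k dpoly. f \<in> Nov n \<inter> lie_elements n \<Longrightarrow> g \<in> Nov n \<inter> lie_elements n \<Longrightarrow>
       f + g \<in> Nov n \<inter> lie_elements n"
    "\<And>c (f :: 'k dpoly). f \<in> Nov n \<inter> lie_elements n \<Longrightarrow> scale c f \<in> Nov n \<inter> lie_elements n"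
    by (auto simp: Nov_def free_novikov_def lie_elements_def ml intro: gen_subalgebra.intros)
  have s: "symbol (0::'k dpoly) = 0" "\<And>f g :: 'k dpoly. symbol (f + g) = symbol f + symbol g"
    "\<And>c (f :: 'k dpoly). symbol (scale c f) = scale c (symbol f)"
    by (simp_all add: symbol_def lin_ext_add lin_ext_scale)
  show ?thesis
    unfolding lie_symbols_def
  proof (rule scale.subspaceI)
    show "0 \<in> symbol ` (Nov n \<inter> lie_elements n :: 'k dpoly set)"
      using N(1) s(1) by (metis imageI)
  next
    fix x y :: "'k tpoly"
    assume "x \<in> symbol ` (Nov n \<inter> lie_elements n)" "y \<in> symbol ` (Nov n \<inter> lie_elements n)"
    then show "x + y \<in> symbol ` (Nov n \<inter> lie_elements n)"
      using N(2) s(2) by (smt (verit) image_iff)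
  next
    fix c and x :: "'k tpoly"
    assume "x \<in> symbol ` (Nov n \<inter> lie_elements n)"
    then show "scale c x \<in> symbol ` (Nov n \<inter> lie_elements n)"
      using N(3) s(3) by (smt (verit) image_iff)
  qed
qed


section \<open>Inversions of a permutation\<close>

definition inversions :: "nat \<Rightarrow> (nat \<Rightarrow> nat) \<Rightarrow> (nat \<times> nat) set" where
  "inversions n \<sigma> = {(i, j). 1 \<le> i \<and> i < j \<and> j \<le> n \<and> \<sigma> i > \<sigma> j}"

end

theory Submission
  imports
    Defs
    "HOL-Library.Function_Algebras"
    "HOL-Computational_Algebra.Formal_Power_Series"
begin

text \<open>
  View \<open>x\<^sub>1, \<dots>, x\<^sub>n\<close> as vector fields on the line: the commutator of the Novikov product is the Lie bracket,
  and \<open>P(x\<^sub>1, \<dots>, x\<^sub>n)\<close> is a Lie element if and only if it is a natural operation, that is, if \<open>P\<close> is annihilated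
  by the Lie derivatives along \<open>s\<^sup>r\<^sup>+\<^sup>1 d/ds\<close>, \<open>r \<ge> 1\<close>. The proof of this criterion works for
  a one-parameter family of conditions and brackets (tensor densities of weight \<open>1/e\<close> instead of vector
  fields), whose member \<open>e = -1\<close> is the given one and whose member \<open>e = 0\<close> describes the harmonic
  polynomials of the symmetric group.
  The brackets depend polynomially on \<open>e\<close>, so their rank is lower semicontinuous, while the dimension of the space of
  natural operations is upper semicontinuous. As both spaces agree for \<open>e = -1\<close> and for \<open>e = 0\<close>, the two
  members have the same dimension, and for \<open>e = 0\<close> this is the degree \<open>n - 1\<close> part of the coinvariant algebra
  with its staircase basis.

  To show that a natural operation \<open>P\<close> is a Lie element, induct on \<open>n\<close>. Leading coefficients show that \<open>P\<close> minus
  its image under a transposition is a Lie element. So modulo Lie elements \<open>P\<close> equals its symmetrisation, and a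
  symmetric natural operation of positive degree vanishes.
\<close>

section \<open>Natural operations\<close>

text \<open>On densities of weight lambda the field \<open>s^(r+1) d/ds\<close> acts by
  \<open>s^(r+1) f' + lambda (r+1) s^r f\<close>. Read on Taylor coefficients at 0 and divided by
  lambda = 1/e, this is \<open>contraction\<close>; the division lets \<open>e = 0\<close> join the
  family, with only power sums of derivatives left. Densities of weights p and q have the natural
  bracket \<open>p f g' - q f' g\<close> of weight p + q + 1. So a bracket monomial with m leaves
  has weight m lambda + m - 1, which is lambda times \<open>weight e m\<close>; hence the
  coefficients in \<open>bracket\<close>. For lambda = -1 all these weights are -1. The induction
  cannot stay within brackets: the leading coefficient of a Lie element in one variable is a
  combination of products of Lie elements in the others. Hence the criterion is proved for products
  of l bracket monomials, in degree |A| - l. The detour through \<open>e = 0\<close> is taken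
  because for other e the conditions involve multiplications by \<open>t\<^sub>i\<close> and do not
  commute, whereas for \<open>e = 0\<close> they generate an ideal of constant-coefficient
  operators, for which a basis of solutions can be written down.\<close>

definition fscale :: "'k::field \<Rightarrow> ('a \<Rightarrow> 'k) \<Rightarrow> 'a \<Rightarrow> 'k" where
  "fscale c f = (\<lambda>x. c * f x)"

lemma fscale_add_apply: "(fscale a f + g) x = a * f x + g x"
  by (simp add: fscale_def)

interpretation fs: vector_space fscale
  by unfold_locales (auto simp: fun_eq_iff algebra_simps fscale_def)

text \<open>
  A polynomial in the variables \<open>t\<^sub>i\<close>, \<open>i \<in> A\<close>, is encoded by the function that maps \<open>\<alpha>\<close> to \<open>\<Prod>i\<in>A. \<alpha>\<^sub>i!\<close> times the
  coefficient of \<open>t\<^sup>\<alpha>\<close>. It only depends on the restriction of \<open>\<alpha>\<close> to \<open>A\<close>, so that the product of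
  polynomials in disjoint sets of variables is the pointwise product. Because of the factorials,
  differentiation is a shift of the exponent.
\<close>

type_synonym 'k cfun = "(nat \<Rightarrow> nat) \<Rightarrow> 'k"

definition depends_on :: "nat set \<Rightarrow> 'k cfun \<Rightarrow> bool" where
  "depends_on A c \<longleftrightarrow> (\<forall>\<alpha> \<beta>. (\<forall>i\<in>A. \<alpha> i = \<beta> i) \<longrightarrow> c \<alpha> = c \<beta>)"

definition homogeneous :: "nat set \<Rightarrow> nat \<Rightarrow> 'k::zero cfun \<Rightarrow> bool" where
  "homogeneous A k c \<longleftrightarrow> (\<forall>\<alpha>. c \<alpha> \<noteq> 0 \<longrightarrow> sum \<alpha> A = k)"

text \<open>The operator \<open>\<Sum>i\<in>A. e t\<^sub>i \<partial>\<^sub>i\<^sup>r\<^sup>+\<^sup>1 + (r + 1) \<partial>\<^sub>i\<^sup>r\<close>.\<close>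

definition contraction :: "'k::comm_semiring_1 \<Rightarrow> nat set \<Rightarrow> nat \<Rightarrow> 'k cfun \<Rightarrow> 'k cfun" where
  "contraction e A r c \<alpha> = (\<Sum>i\<in>A. (e * of_nat (\<alpha> i) + of_nat (Suc r)) * c (\<alpha>(i := \<alpha> i + r)))"

text \<open>Multiplication by \<open>\<Sum>i\<in>A. t\<^sub>i\<close>.\<close>

definition mult_t :: "nat set \<Rightarrow> 'k::comm_semiring_1 cfun \<Rightarrow> 'k cfun" where
  "mult_t A c \<alpha> = (\<Sum>i\<in>A. of_nat (\<alpha> i) * c (\<alpha>(i := \<alpha> i - 1)))"

text \<open>For \<open>r \<ge> 1\<close> the field \<open>s^(r+1) d/ds\<close> vanishes to second
  order at 0, so it acts trivially on the value of the operation there, and invariance becomes the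
  vanishing of the contraction. For \<open>r = 0\<close> the contraction is a scalar on homogeneous
  functions. The degree \<open>k\<close> is a separate parameter because leading coefficients and
  products of brackets have degree below \<open>card A - 1\<close>.\<close>

definition invariants :: "'k::field \<Rightarrow> nat set \<Rightarrow> nat \<Rightarrow> 'k cfun set" where
  "invariants e A k = {c. depends_on A c \<and> homogeneous A k c \<and> (\<forall>r\<ge>1. \<forall>\<alpha>. contraction e A r c \<alpha> = 0)}"

lemma depends_onD: "depends_on A c \<Longrightarrow> (\<And>i. i \<in> A \<Longrightarrow> \<alpha> i = \<beta> i) \<Longrightarrow> c \<alpha> = c \<beta>"
  by (auto simp: depends_on_def)

lemma depends_on_upd: "depends_on A c \<Longrightarrow> x \<notin> A \<Longrightarrow> c (\<alpha>(x := v)) = c \<alpha>"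
  by (erule depends_onD) auto

lemma depends_on_lin:
  "depends_on A f \<Longrightarrow> depends_on A g \<Longrightarrow> depends_on A (\<lambda>\<alpha>. a * f \<alpha> - b * g \<alpha>)"
  unfolding depends_on_def
  by (intro allI impI arg_cong2[where f = "(-)"] arg_cong2[where f = "(*)"]) blast+

lemma homogeneous_lin:
  fixes a b :: "'k::field"
  shows "homogeneous A k f \<Longrightarrow> homogeneous A k g \<Longrightarrow> homogeneous A k (\<lambda>\<alpha>. a * f \<alpha> - b * g \<alpha>)"
  unfolding homogeneous_def by force

lemma contraction_lin:
  fixes e :: "'k::field"
  shows "contraction e A r (\<lambda>\<alpha>. a * f \<alpha> - b * g \<alpha>) \<alpha> = a * contraction e A r f \<alpha> - b * contraction e A r g \<alpha>"
  by (simp add: contraction_def sum_distrib_left sum_subtractf algebra_simps)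

lemma invariants_lin:
  fixes e :: "'k::field"
  shows "f \<in> invariants e A k \<Longrightarrow> g \<in> invariants e A k \<Longrightarrow> (\<lambda>\<alpha>. a * f \<alpha> - b * g \<alpha>) \<in> invariants e A k"
  by (simp add: invariants_def depends_on_lin homogeneous_lin contraction_lin)

lemma invariants_0: "0 \<in> invariants e A k"
  by (simp add: invariants_def depends_on_def homogeneous_def contraction_def)

lemma invariants_subspace: "fs.subspace (invariants e A k)"
proof (rule fs.subspaceI)
  fix x y assume *: "x \<in> invariants e A k" "y \<in> invariants e A k"
  have "x + y = (\<lambda>\<alpha>. 1 * x \<alpha> - (-1) * y \<alpha>)" by (simp add: fun_eq_iff)
  then show "x + y \<in> invariants e A k" by (simp only: invariants_lin[OF *])
next
  fix a x assume *: "x \<in> invariants e A k"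
  have "fscale a x = (\<lambda>\<alpha>. a * x \<alpha> - 0 * x \<alpha>)" by (simp add: fun_eq_iff fscale_def)
  then show "fscale a x \<in> invariants e A k" by (simp only: invariants_lin[OF * *])
qed (rule invariants_0)

text \<open>Leibniz rule: each summand shifts the exponent of one variable and passes through the
  factor that does not depend on it.\<close>

lemma contraction_mult:
  assumes "finite I" "finite J" "I \<inter> J = {}" "depends_on I f" "depends_on J g"
  shows "contraction e (I \<union> J) r (\<lambda>\<alpha>. f \<alpha> * g \<alpha>) \<alpha> = contraction e I r f \<alpha> * g \<alpha> + f \<alpha> * contraction e J r g \<alpha>"
proof -
  let ?h = "\<lambda>i. (e * of_nat (\<alpha> i) + of_nat (Suc r)) * (f (\<alpha>(i := \<alpha> i + r)) * g (\<alpha>(i := \<alpha> i + r)))"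
  have "contraction e (I \<union> J) r (\<lambda>\<alpha>. f \<alpha> * g \<alpha>) \<alpha> = sum ?h I + sum ?h J"
    using assms by (simp add: contraction_def sum.union_disjoint)
  moreover have "sum ?h I = contraction e I r f \<alpha> * g \<alpha>"
    unfolding contraction_def sum_distrib_right
  proof (rule sum.cong)
    fix i assume "i \<in> I"
    then have "g (\<alpha>(i := \<alpha> i + r)) = g \<alpha>" using assms by (meson depends_on_upd disjoint_iff)
    then show "?h i = (e * of_nat (\<alpha> i) + of_nat (Suc r)) * f (\<alpha>(i := \<alpha> i + r)) * g \<alpha>"
      by (simp add: mult.assoc)
  qed simp
  moreover have "sum ?h J = f \<alpha> * contraction e J r g \<alpha>"
    unfolding contraction_def sum_distrib_left
  proof (rule sum.cong)
    fix i assume "i \<in> J"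
    then have "f (\<alpha>(i := \<alpha> i + r)) = f \<alpha>" using assms by (meson depends_on_upd disjoint_iff)
    then show "?h i = f \<alpha> * ((e * of_nat (\<alpha> i) + of_nat (Suc r)) * g (\<alpha>(i := \<alpha> i + r)))"
      by (simp add: mult.left_commute)
  qed simp
  ultimately show ?thesis by simp
qed

text \<open>Up to sign this is the commutator of \<open>s^(r+2) d/ds\<close> with
  \<open>d/ds\<close>, since \<open>mult_t\<close> is the total derivative.\<close>

lemma contraction_mult_t:
  fixes e :: "'k::field"
  assumes "finite J"
  shows "contraction e J (Suc r) (mult_t J g) \<alpha> =
     mult_t J (contraction e J (Suc r) g) \<alpha> + of_nat (r + 2) * contraction e J r g \<alpha>"
proof -
  let ?u = "\<lambda>i j. \<alpha>(i := \<alpha> i + Suc r, j := (\<alpha>(i := \<alpha> i + Suc r)) j - 1)"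
  let ?w = "\<lambda>i j. \<alpha>(j := \<alpha> j - 1, i := (\<alpha>(j := \<alpha> j - 1)) i + Suc r)"
  let ?L = "\<lambda>i j. (e * of_nat (\<alpha> i) + of_nat (Suc (Suc r))) * (of_nat ((\<alpha>(i := \<alpha> i + Suc r)) j) * g (?u i j))"
  let ?R = "\<lambda>i j. of_nat (\<alpha> j) * ((e * of_nat ((\<alpha>(j := \<alpha> j - 1)) i) + of_nat (Suc (Suc r))) * g (?w i j))"
  \<comment> \<open>Changes at different positions commute. For \<open>i = j\<close> the exponent is
    read off after the shift by \<open>Suc r\<close> on one side and before it on the other, which
    leaves the extra term.\<close>
  have "?L i j = ?R i j + (if i = j then of_nat (r + 2) * ((e * of_nat (\<alpha> j) + of_nat (Suc r)) * g (\<alpha>(j := \<alpha> j + r))) else 0)"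
    for i j
  proof (cases "i = j")
    case True
    show ?thesis
    proof (cases "\<alpha> j")
      case 0
      then show ?thesis using True by simp
    next
      case (Suc a)
      then show ?thesis using True by (simp add: algebra_simps)
    qed
  next
    case False
    then have 1: "(\<alpha>(i := \<alpha> i + Suc r)) j = \<alpha> j" "(\<alpha>(j := \<alpha> j - 1)) i = \<alpha> i" by auto
    have 2: "\<alpha>(i := \<alpha> i + Suc r, j := \<alpha> j - 1) = \<alpha>(j := \<alpha> j - 1, i := \<alpha> i + Suc r)"
      using False by (rule fun_upd_twist)
    show ?thesis
      unfolding 1 2 using False by (simp only: if_False add_0_right mult.left_commute)
  qed
  then have "contraction e J (Suc r) (mult_t J g) \<alpha> = (\<Sum>i\<in>J. \<Sum>j\<in>J. ?R i j +
     (if i = j then of_nat (r + 2) * ((e * of_nat (\<alpha> j) + of_nat (Suc r)) * g (\<alpha>(j := \<alpha> j + r))) else 0))"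
    unfolding contraction_def mult_t_def sum_distrib_left by simp
  also have "\<dots> = (\<Sum>i\<in>J. \<Sum>j\<in>J. ?R i j) +
     (\<Sum>j\<in>J. of_nat (r + 2) * ((e * of_nat (\<alpha> j) + of_nat (Suc r)) * g (\<alpha>(j := \<alpha> j + r))))"
    unfolding sum.distrib using assms by simp
  also have "(\<Sum>i\<in>J. \<Sum>j\<in>J. ?R i j) = mult_t J (contraction e J (Suc r) g) \<alpha>"
    unfolding contraction_def mult_t_def sum_distrib_left by (subst sum.swap) simp
  finally show ?thesis
    by (simp only: contraction_def[of e J r] sum_distrib_left)
qed

lemma contraction_0:
  fixes e :: "'k::field"
  assumes "homogeneous J k g"
  shows "contraction e J 0 g \<alpha> = (e * of_nat k + of_nat (card J)) * g \<alpha>"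
proof (cases "g \<alpha> = 0")
  case True
  then show ?thesis by (simp add: contraction_def)
next
  case False
  then have "k = sum \<alpha> J" using assms by (simp add: homogeneous_def)
  then show ?thesis
    by (simp add: contraction_def sum.distrib sum_distrib_left flip: sum_distrib_right)
qed

lemma depends_on_mult_t: "depends_on J g \<Longrightarrow> depends_on J (mult_t J g)"
  unfolding depends_on_def mult_t_def
proof (intro allI impI sum.cong refl)
  fix \<alpha> \<beta> :: "nat \<Rightarrow> nat" and i
  assume g: "\<forall>\<alpha> \<beta>. (\<forall>i\<in>J. \<alpha> i = \<beta> i) \<longrightarrow> g \<alpha> = g \<beta>" and ab: "\<forall>i\<in>J. \<alpha> i = \<beta> i" and i: "i \<in> J"
  have "g (\<alpha>(i := \<alpha> i - 1)) = g (\<beta>(i := \<beta> i - 1))"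
    by (rule g[rule_format]) (use ab i in auto)
  then show "of_nat (\<alpha> i) * g (\<alpha>(i := \<alpha> i - 1)) = of_nat (\<beta> i) * g (\<beta>(i := \<beta> i - 1))"
    using ab i by simp
qed

lemma homogeneous_mult_t:
  fixes g :: "'k::field_char_0 cfun"
  assumes "homogeneous J k g" "finite J"
  shows "homogeneous J (Suc k) (mult_t J g)"
  unfolding homogeneous_def
proof (intro allI impI)
  fix \<alpha> assume "mult_t J g \<alpha> \<noteq> 0"
  then obtain i where i: "i \<in> J" "of_nat (\<alpha> i) * g (\<alpha>(i := \<alpha> i - 1)) \<noteq> 0"
    unfolding mult_t_def by (rule sum.not_neutral_contains_not_neutral)
  then have pos: "\<alpha> i \<noteq> 0" and "g (\<alpha>(i := \<alpha> i - 1)) \<noteq> 0" by auto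
  then have "sum (\<alpha>(i := \<alpha> i - 1)) J = k" using assms(1) unfolding homogeneous_def by blast
  moreover have "sum \<beta> J = \<beta> i + sum \<beta> (J - {i})" for \<beta> :: "nat \<Rightarrow> nat"
    using assms(2) i(1) by (rule sum.remove)
  moreover have "sum (\<alpha>(i := \<alpha> i - 1)) (J - {i}) = sum \<alpha> (J - {i})"
    by (rule sum.cong) auto
  ultimately show "sum \<alpha> J = Suc k"
    using pos by (metis Suc_pred' add_Suc fun_upd_same gr0I)
qed

lemma homogeneous_mult:
  fixes f :: "'k::field cfun"
  assumes "homogeneous I k f" "homogeneous J l g" "finite I" "finite J" "I \<inter> J = {}"
  shows "homogeneous (I \<union> J) (k + l) (\<lambda>\<alpha>. f \<alpha> * g \<alpha>)"
  using assms by (auto simp: homogeneous_def sum.union_disjoint)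

lemma depends_on_mult:
  "depends_on I f \<Longrightarrow> depends_on J g \<Longrightarrow> depends_on (I \<union> J) (\<lambda>\<alpha>. f \<alpha> * g \<alpha>)"
  unfolding depends_on_def by (intro allI impI arg_cong2[where f = "(*)"]) blast+

lemma invariants_mult:
  fixes e :: "'k::field"
  assumes "f \<in> invariants e I k" "g \<in> invariants e J l" "finite I" "finite J" "I \<inter> J = {}"
  shows "(\<lambda>\<alpha>. f \<alpha> * g \<alpha>) \<in> invariants e (I \<union> J) (k + l)"
  using assms by (simp add: invariants_def homogeneous_mult depends_on_mult contraction_mult)

lemma mult_t_lin: "mult_t A (fscale a f + g) = fscale a (mult_t A f) + mult_t A g"
proof
  fix \<alpha>
  show "mult_t A (fscale a f + g) \<alpha> = (fscale a (mult_t A f) + mult_t A g) \<alpha>"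
    unfolding mult_t_def fscale_add_apply sum_distrib_left sum.distrib[symmetric]
    by (intro sum.cong refl) (simp only: algebra_simps)
qed

text \<open>
  The value of \<open>contraction e I 0\<close>, an Euler operator, on polynomials of degree \<open>m - 1\<close> in \<open>m\<close> variables.
  For \<open>e = -1\<close> it is \<open>1\<close>, so that \<open>bracket\<close> becomes \<open>f g (t\<^sub>J - t\<^sub>I)\<close>.
\<close>

definition weight :: "'k::field \<Rightarrow> nat \<Rightarrow> 'k" where
  "weight e m = of_nat m + e * of_nat (m - 1)"

definition bracket :: "'k::field \<Rightarrow> nat set \<Rightarrow> nat set \<Rightarrow> 'k cfun \<Rightarrow> 'k cfun \<Rightarrow> 'k cfun" where
  "bracket e I J f g \<alpha> = weight e (card I) * f \<alpha> * mult_t J g \<alpha> - weight e (card J) * mult_t I f \<alpha> * g \<alpha>"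

lemma mult_t_0 [simp]: "mult_t A (\<lambda>_. 0) \<alpha> = 0"
  by (simp add: mult_t_def)

text \<open>By the Leibniz rule and the commutator with \<open>mult_t\<close>, contraction number
  \<open>s + 1\<close> of the bracket only involves contractions number \<open>s\<close> of
  \<open>f\<close> and \<open>g\<close>. These vanish for \<open>s \<ge> 1\<close>. For
  \<open>s = 0\<close> they multiply by the two weights, and the coefficients in
  \<open>bracket\<close> are those for which the two terms cancel.\<close>

lemma invariants_bracket:
  fixes e :: "'k::field_char_0"
  assumes f: "f \<in> invariants e I (card I - 1)" and g: "g \<in> invariants e J (card J - 1)"
    and fin: "finite I" "finite J" "I \<inter> J = {}" "I \<noteq> {}" "J \<noteq> {}"
  shows "bracket e I J f g \<in> invariants e (I \<union> J) (card (I \<union> J) - 1)"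
proof -
  have *: "Suc (card I - 1) + (card J - 1) = card (I \<union> J) - 1" "card I - 1 + Suc (card J - 1) = card (I \<union> J) - 1"
    using fin card_gt_0_iff[of I] card_gt_0_iff[of J] by (auto simp: card_Un_disjoint)
  have d: "depends_on I f" "depends_on J g" and h: "homogeneous I (card I - 1) f" "homogeneous J (card J - 1) g"
    using f g by (auto simp: invariants_def)
  have z: "contraction e I r f \<alpha> = 0" "contraction e J r g \<alpha> = 0" if "r \<ge> 1" for r \<alpha>
    using f g that by (auto simp: invariants_def)
  have br: "bracket e I J f g = (\<lambda>\<alpha>. weight e (card I) * (f \<alpha> * mult_t J g \<alpha>) - weight e (card J) * (mult_t I f \<alpha> * g \<alpha>))"
    by (simp add: bracket_def fun_eq_iff)
  have d': "depends_on I (mult_t I f)" "depends_on J (mult_t J g)" using d by (auto intro: depends_on_mult_t)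
  have h': "homogeneous I (Suc (card I - 1)) (mult_t I f)" "homogeneous J (Suc (card J - 1)) (mult_t J g)"
    using h fin by (auto intro: homogeneous_mult_t)
  have dep: "depends_on (I \<union> J) (bracket e I J f g)"
    unfolding br by (intro depends_on_lin depends_on_mult d d')
  have hom: "homogeneous (I \<union> J) (card (I \<union> J) - 1) (bracket e I J f g)"
    using homogeneous_mult[OF h(1) h'(2) fin(1-3)] homogeneous_mult[OF h'(1) h(2) fin(1-3)]
    unfolding br * by (rule homogeneous_lin)
  have "contraction e (I \<union> J) r (bracket e I J f g) \<alpha> = 0" if r1: "r \<ge> 1" for r \<alpha>
  proof -
    obtain s where r: "r = Suc s" using r1 by (cases r) auto
    have zz: "contraction e J (Suc s) g = (\<lambda>_. 0)" "contraction e I (Suc s) f = (\<lambda>_. 0)"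
      using z[of "Suc s"] by auto
    have I: "contraction e I r (mult_t I f) \<alpha> = of_nat (s + 2) * contraction e I s f \<alpha>"
     and J: "contraction e J r (mult_t J g) \<alpha> = of_nat (s + 2) * contraction e J s g \<alpha>"
      unfolding r contraction_mult_t[OF fin(1)] contraction_mult_t[OF fin(2)] zz by simp_all
    have "contraction e (I \<union> J) r (bracket e I J f g) \<alpha> =
       of_nat (s + 2) * (weight e (card I) * f \<alpha> * contraction e J s g \<alpha> - weight e (card J) * contraction e I s f \<alpha> * g \<alpha>)"
      unfolding br contraction_lin contraction_mult[OF fin(1-3) d(1) d'(2)] contraction_mult[OF fin(1-3) d'(1) d(2)] I J z[OF r1]
      by (simp add: algebra_simps)
    also have "\<dots> = 0"
    proof (cases s)
      case 0
      have w: "e * of_nat (card I - 1) + of_nat (card I) = weight e (card I)" 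
         "e * of_nat (card J - 1) + of_nat (card J) = weight e (card J)" by (simp_all add: weight_def)
      show ?thesis unfolding 0 contraction_0[OF h(1)] contraction_0[OF h(2)] w by simp
    next
      case (Suc t)
      then show ?thesis using z[of s] by simp
    qed
    finally show ?thesis .
  qed
  with dep hom show ?thesis by (simp add: invariants_def)
qed

section \<open>Bracket monomials\<close>

datatype tree = Leaf nat | Br tree tree

primrec leaves :: "tree \<Rightarrow> nat list" where
  "leaves (Leaf i) = [i]"
| "leaves (Br T U) = leaves T @ leaves U"

text \<open>The generator \<open>x\<^sub>i\<close> has the constant symbol 1, encoded by the
  indicator of exponent 0.\<close>

primrec tree_symbol :: "'k::field \<Rightarrow> tree \<Rightarrow> 'k cfun" where
  "tree_symbol e (Leaf i) = (\<lambda>\<alpha>. of_bool (\<alpha> i = 0))"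
| "tree_symbol e (Br T U) = bracket e (set (leaves T)) (set (leaves U)) (tree_symbol e T) (tree_symbol e U)"

definition trees :: "nat set \<Rightarrow> tree set" where
  "trees A = {T. distinct (leaves T) \<and> set (leaves T) = A}"

definition fleaves :: "tree list \<Rightarrow> nat list" where
  "fleaves F = concat (map leaves F)"

definition forest_symbol :: "'k::field \<Rightarrow> tree list \<Rightarrow> 'k cfun" where
  "forest_symbol e F \<alpha> = prod_list (map (\<lambda>T. tree_symbol e T \<alpha>) F)"

text \<open>A tree on m leaves has degree m - 1, so \<open>l\<close> trees on \<open>A\<close> have
  degree \<open>card A - l\<close>.\<close>

definition forests :: "nat set \<Rightarrow> nat \<Rightarrow> tree list set" where
  "forests A l = {F. distinct (fleaves F) \<and> set (fleaves F) = A \<and> length F = l}"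

lemma leaves_ne [simp]: "leaves T \<noteq> []"
  by (induction T) auto

lemma fleaves_simps [simp]:
  "fleaves [] = []" "fleaves (T # F) = leaves T @ fleaves F" "fleaves (F @ G) = fleaves F @ fleaves G"
  by (simp_all add: fleaves_def)

lemma forest_symbol_simps [simp]:
  "forest_symbol e [] \<alpha> = 1" "forest_symbol e (T # F) \<alpha> = tree_symbol e T \<alpha> * forest_symbol e F \<alpha>"
  "forest_symbol e (F @ G) \<alpha> = forest_symbol e F \<alpha> * forest_symbol e G \<alpha>"
  by (simp_all add: forest_symbol_def)

lemma length_fleaves: "length F \<le> length (fleaves F)"
proof (induction F)
  case (Cons T F)
  have "0 < length (leaves T)" by simp
  with Cons show ?case by (simp del: length_greater_0_conv)
qed simp

lemma tree_symbol_invariants: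
  fixes e :: "'k::field_char_0"
  shows "T \<in> trees A \<Longrightarrow> tree_symbol e T \<in> invariants e A (card A - 1)"
proof (induction T arbitrary: A)
  case (Leaf i)
  then have "A = {i}" by (simp add: trees_def)
  then show ?case
    by (auto simp: invariants_def depends_on_def homogeneous_def contraction_def)
next
  case (Br T U)
  then have A: "A = set (leaves T) \<union> set (leaves U)" "set (leaves T) \<inter> set (leaves U) = {}"
    and "T \<in> trees (set (leaves T))" "U \<in> trees (set (leaves U))"
    by (auto simp: trees_def)
  then show ?case
    using Br.IH unfolding A(1) tree_symbol.simps by (intro invariants_bracket) auto
qed

lemma forest_symbol_invariants:
  fixes e :: "'k::field_char_0"
  shows "F \<in> forests A l \<Longrightarrow> card A = k + l \<Longrightarrow> forest_symbol e F \<in> invariants e A k"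
proof (induction F arbitrary: A l k)
  case Nil
  then show ?case
    by (auto simp: forests_def invariants_def depends_on_def homogeneous_def contraction_def)
next
  case (Cons T F)
  let ?I = "set (leaves T)" and ?J = "set (fleaves F)"
  have A: "A = ?I \<union> ?J" "?I \<inter> ?J = {}" and d: "distinct (leaves T)" "distinct (fleaves F)" and l: "l = Suc (length F)"
    using Cons.prems by (auto simp: forests_def)
  have c: "card ?J = (card ?J - length F) + length F"
    using length_fleaves[of F] d by (simp add: distinct_card)
  have "forest_symbol e F \<in> invariants e ?J (card ?J - length F)"
    by (rule Cons.IH[OF _ c]) (use d in \<open>auto simp: forests_def\<close>)
  moreover have "tree_symbol e T \<in> invariants e ?I (card ?I - 1)"
    by (rule tree_symbol_invariants) (use d in \<open>auto simp: trees_def\<close>)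
  ultimately have "(\<lambda>\<alpha>. tree_symbol e T \<alpha> * forest_symbol e F \<alpha>) \<in> invariants e (?I \<union> ?J) (card ?I - 1 + (card ?J - length F))"
    using A by (intro invariants_mult) auto
  moreover have "card A = card ?I + card ?J"
    using A by (simp add: card_Un_disjoint)
  moreover have "card ?I > 0" by (simp add: card_gt_0_iff)
  ultimately show ?case
    using A(1) Cons.prems(2) l c by (simp add: forest_symbol_def)
qed

lemma depends_on_tree_symbol: "depends_on (set (leaves T)) (tree_symbol (e::'k::field_char_0) T)"
proof (induction T)
  case (Br T U)
  then show ?case
    unfolding tree_symbol.simps bracket_def leaves.simps set_append mult.assoc
    by (intro depends_on_lin depends_on_mult depends_on_mult_t) simp_all
qed (simp add: depends_on_def)

lemma depends_on_forest_symbol: "depends_on (set (fleaves F)) (forest_symbol (e::'k::field_char_0) F)"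
proof (induction F)
  case (Cons T F)
  show ?case
    using depends_on_mult[OF depends_on_tree_symbol[of T e] Cons] by (simp add: forest_symbol_def)
qed (simp add: depends_on_def)

section \<open>Leading coefficients in one variable\<close>

text \<open>Equal arguments give nonzero weights, by which nested brackets scale their leading
  coefficients. The mixed sums occur when a bracket is antisymmetrised and both of its terms
  contribute to one leading coefficient.\<close>

definition nondeg :: "'k::field \<Rightarrow> bool" where
  "nondeg e \<longleftrightarrow> (\<forall>m\<ge>1. \<forall>m'\<ge>1. weight e m + weight e m' \<noteq> 0)"

lemma nondeg_weight: "nondeg e \<Longrightarrow> m \<ge> 1 \<Longrightarrow> weight e m \<noteq> 0"
  by (auto simp: nondeg_def)

lemma mult_t_vanish:
  assumes "\<And>\<alpha>. \<alpha> x > j \<Longrightarrow> g \<alpha> = 0" "\<alpha> x > Suc j"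
  shows "mult_t J g \<alpha> = 0"
proof -
  have "g (\<alpha>(i := \<alpha> i - 1)) = 0" for i
    by (rule assms(1)) (use assms(2) in auto)
  then show ?thesis by (simp add: mult_t_def)
qed

text \<open>The factor \<open>Suc j\<close> is the quotient of the factorials of
  \<open>Suc j\<close> and \<open>j\<close> in the encoding. A summand \<open>i \<noteq> x\<close>
  leaves the exponent of \<open>x\<close> at \<open>Suc j\<close>, where \<open>g\<close>
  vanishes.\<close>

lemma mult_t_lead:
  assumes "\<And>\<alpha>. \<alpha> x > j \<Longrightarrow> g \<alpha> = 0" "\<alpha> x = Suc j" "finite J" "x \<in> J"
  shows "mult_t J g \<alpha> = of_nat (Suc j) * g (\<alpha>(x := j))"
proof -
  have "of_nat (\<alpha> i) * g (\<alpha>(i := \<alpha> i - 1)) = (if i = x then of_nat (Suc j) * g (\<alpha>(x := j)) else 0)" for i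
    using assms(1,2) by auto
  then show ?thesis
    using assms(3,4) by (simp add: mult_t_def)
qed

definition ad_tree :: "tree list \<Rightarrow> nat \<Rightarrow> tree" where
  "ad_tree Ts x = foldr Br Ts (Leaf x)"

lemma leaves_ad_tree: "leaves (ad_tree Ts x) = fleaves Ts @ [x]"
  by (induction Ts) (auto simp: ad_tree_def)

text \<open>The tree is \<open>[T1, [T2, ..., [Tk, x]]]\<close>. Of the two terms of a bracket with
  \<open>T\<close> only the one that differentiates the part containing \<open>x\<close> raises the
  exponent of \<open>x\<close>, by one per bracket, and it multiplies the leading coefficient by the
  symbol of \<open>T\<close>. The factor \<open>u\<close> collects the weights of the trees and the
  factorial of their number.\<close>

lemma tree_symbol_ad_tree:
  fixes e :: "'k::field_char_0"
  assumes "nondeg e" "x \<notin> set (fleaves Ts)"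
  obtains u where "u \<noteq> 0" "\<And>\<alpha>. \<alpha> x > length Ts \<Longrightarrow> tree_symbol e (ad_tree Ts x) \<alpha> = 0"
    "\<And>\<alpha>. \<alpha> x = length Ts \<Longrightarrow> tree_symbol e (ad_tree Ts x) \<alpha> = u * forest_symbol e Ts \<alpha>"
proof -
  have "\<exists>u. u \<noteq> 0 \<and> (\<forall>\<alpha>. \<alpha> x > length Ts \<longrightarrow> tree_symbol e (ad_tree Ts x) \<alpha> = 0) \<and>
    (\<forall>\<alpha>. \<alpha> x = length Ts \<longrightarrow> tree_symbol e (ad_tree Ts x) \<alpha> = u * forest_symbol e Ts \<alpha>)"
    using assms(2)
  proof (induction Ts)
    case Nil
    then show ?case by (intro exI[of _ 1]) (auto simp: ad_tree_def)
  next
    case (Cons T Ts)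
    let ?X = "ad_tree Ts x" and ?j = "length Ts"
    obtain u where u: "u \<noteq> 0" "\<And>\<alpha>. \<alpha> x > ?j \<Longrightarrow> tree_symbol e ?X \<alpha> = 0"
      "\<And>\<alpha>. \<alpha> x = ?j \<Longrightarrow> tree_symbol e ?X \<alpha> = u * forest_symbol e Ts \<alpha>"
      using Cons by auto
    let ?w = "weight e (card (set (leaves T)))"
    have w: "?w \<noteq> 0"
      by (rule nondeg_weight[OF assms(1)]) (simp add: Suc_le_eq card_gt_0_iff)
    have xX: "x \<in> set (leaves ?X)" by (simp add: leaves_ad_tree)
    have br: "tree_symbol e (ad_tree (T # Ts) x) \<alpha> = ?w * tree_symbol e T \<alpha> * mult_t (set (leaves ?X)) (tree_symbol e ?X) \<alpha>"
      if "\<alpha> x > ?j" for \<alpha>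
      using u(2)[of \<alpha>, OF that] by (simp add: ad_tree_def bracket_def)
    have "tree_symbol e (ad_tree (T # Ts) x) \<alpha> = 0" if "\<alpha> x > Suc ?j" for \<alpha>
      using mult_t_vanish[of ?j x _ \<alpha>, OF u(2) that] br[of \<alpha>] that by simp
    moreover have "tree_symbol e (ad_tree (T # Ts) x) \<alpha> = ?w * of_nat (Suc ?j) * u * forest_symbol e (T # Ts) \<alpha>"
      if a: "\<alpha> x = Suc ?j" for \<alpha>
    proof -
      have "forest_symbol e Ts (\<alpha>(x := ?j)) = forest_symbol e Ts \<alpha>"
        by (rule depends_on_upd[OF depends_on_forest_symbol]) (use Cons.prems in simp)
      moreover have "mult_t (set (leaves ?X)) (tree_symbol e ?X) \<alpha> = of_nat (Suc ?j) * tree_symbol e ?X (\<alpha>(x := ?j))"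
        by (rule mult_t_lead[where x = x]) (use u(2) xX a in auto)
      moreover have "tree_symbol e ?X (\<alpha>(x := ?j)) = u * forest_symbol e Ts (\<alpha>(x := ?j))"
        by (rule u(3)) simp
      ultimately have "mult_t (set (leaves ?X)) (tree_symbol e ?X) \<alpha> = of_nat (Suc ?j) * (u * forest_symbol e Ts \<alpha>)"
        by (simp only:)
      then show ?thesis using br[of \<alpha>] a by (simp only: forest_symbol_simps mult_ac lessI)
    qed
    moreover have "?w * of_nat (Suc ?j) * u \<noteq> 0" using w u(1) by (simp del: of_nat_Suc)
    ultimately show ?case by (metis length_Cons)
  qed
  then show thesis using that by blast
qed

lemma span_invariants:
  fixes e :: "'k::field_char_0"
  assumes "c \<in> fs.span (forest_symbol e ` forests A l)" "card A = k + l"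
  shows "c \<in> invariants e A k"
  using fs.span_minimal[OF _ invariants_subspace, of "forest_symbol e ` forests A l"] forest_symbol_invariants[OF _ assms(2)] assms(1)
  by (metis (no_types, lifting) image_subset_iff in_mono)

text \<open>At the top exponent \<open>j\<close> of \<open>x\<close> the summand of the contraction
  at \<open>x\<close> reads \<open>c\<close> at exponent \<open>j + r > j\<close>, where it is zero;
  what remains is the contraction over \<open>B\<close>.\<close>

lemma lead_invariants:
  fixes e :: "'k::field_char_0"
  assumes c: "c \<in> invariants e (insert x B) k" and x: "x \<notin> B" and B: "finite B"
    and j: "\<And>\<alpha>. \<alpha> x > j \<Longrightarrow> c \<alpha> = 0" and k: "j \<le> k"
  shows "(\<lambda>\<alpha>. c (\<alpha>(x := j))) \<in> invariants e B (k - j)"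
proof -
  have d: "depends_on (insert x B) c" and h: "homogeneous (insert x B) k c"
    and z: "\<And>r \<alpha>. r \<ge> 1 \<Longrightarrow> contraction e (insert x B) r c \<alpha> = 0"
    using c by (auto simp: invariants_def)
  have "depends_on B (\<lambda>\<alpha>. c (\<alpha>(x := j)))"
    unfolding depends_on_def by (intro allI impI depends_onD[OF d]) auto
  moreover have "homogeneous B (k - j) (\<lambda>\<alpha>. c (\<alpha>(x := j)))"
    unfolding homogeneous_def
  proof (intro allI impI)
    fix \<alpha> assume "c (\<alpha>(x := j)) \<noteq> 0"
    then have "sum (\<alpha>(x := j)) (insert x B) = k" using h unfolding homogeneous_def by blast
    moreover have "sum (\<alpha>(x := j)) B = sum \<alpha> B" by (rule sum.cong) (use x in auto)
    ultimately show "sum \<alpha> B = k - j" using x B by simp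
  qed
  moreover have "contraction e B r (\<lambda>\<alpha>. c (\<alpha>(x := j))) \<alpha> = 0" if r: "r \<ge> 1" for r \<alpha>
  proof -
    let ?a = "\<alpha>(x := j)"
    have "c (?a(x := ?a x + r)) = 0" using r by (intro j) simp
    then have "contraction e (insert x B) r c ?a = (\<Sum>i\<in>B. (e * of_nat (?a i) + of_nat (Suc r)) * c (?a(i := ?a i + r)))"
      unfolding contraction_def using x B by simp
    also have "\<dots> = contraction e B r (\<lambda>\<alpha>. c (\<alpha>(x := j))) \<alpha>"
      unfolding contraction_def
    proof (rule sum.cong[OF refl])
      fix i assume "i \<in> B"
      then have i: "i \<noteq> x" using x by blast
      then have "?a i = \<alpha> i" "?a(i := \<alpha> i + r) = \<alpha>(i := \<alpha> i + r, x := j)" 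
        by (simp, intro fun_upd_twist) simp
      then show "(e * of_nat (?a i) + of_nat (Suc r)) * c (?a(i := ?a i + r)) =
         (e * of_nat (\<alpha> i) + of_nat (Suc r)) * c (\<alpha>(i := \<alpha> i + r, x := j))"
        by (simp only:)
    qed
    finally show ?thesis using z[OF r] by simp
  qed
  ultimately show ?thesis by (simp add: invariants_def)
qed

lemma homogeneous_vanish:
  assumes "homogeneous A k c" "finite A" "x \<in> A" "\<alpha> x > k"
  shows "c \<alpha> = 0"
proof (rule ccontr)
  assume "c \<alpha> \<noteq> 0"
  then have "sum \<alpha> A = k" using assms(1) by (simp add: homogeneous_def)
  then show False using member_le_sum[of x A \<alpha>] assms by simp
qed

text \<open>Of the \<open>l + j\<close> trees, \<open>j\<close> are nested around \<open>x\<close>,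
  which produces the exponent \<open>j\<close>, and the other \<open>l\<close> stay as factors. With
  the tree containing \<open>x\<close> this makes \<open>Suc l\<close> trees.\<close>

lemma lead_exists:
  fixes e :: "'k::field_char_0"
  assumes e: "nondeg e" and x: "x \<notin> B"
    and g: "g \<in> fs.span (forest_symbol e ` forests B (l + j))"
  shows "\<exists>E \<in> fs.span (forest_symbol e ` forests (insert x B) (Suc l)).
     (\<forall>\<alpha>. \<alpha> x > j \<longrightarrow> E \<alpha> = 0) \<and> (\<forall>\<alpha>. \<alpha> x = j \<longrightarrow> E \<alpha> = g \<alpha>)"
  using g
proof (induction rule: fs.span_induct_alt)
  case base
  show ?case by (intro bexI[of _ 0]) (auto simp: fs.span_zero)
next
  case (step a f g)
  then obtain E where E: "E \<in> fs.span (forest_symbol e ` forests (insert x B) (Suc l))"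
     "\<And>\<alpha>. \<alpha> x > j \<Longrightarrow> E \<alpha> = 0" "\<And>\<alpha>. \<alpha> x = j \<Longrightarrow> E \<alpha> = g \<alpha>" by auto
  obtain F where F: "f = forest_symbol e F" "F \<in> forests B (l + j)" using step by auto
  let ?P = "take j F" and ?R = "drop j F"
  let ?G = "ad_tree ?P x # ?R"
  have FPR: "F = ?P @ ?R" by simp
  have len: "length ?P = j" "length ?R = l" using F by (auto simp: forests_def)
  have fl: "fleaves F = fleaves ?P @ fleaves ?R" by (subst FPR) (simp only: fleaves_simps)
  have dis: "distinct (fleaves ?P @ fleaves ?R)" "set (fleaves ?P @ fleaves ?R) = B"
    using F(2) fl by (auto simp: forests_def)
  then have xP: "x \<notin> set (fleaves ?P)" using x by auto
  obtain u where u: "u \<noteq> 0" "\<And>\<alpha>. \<alpha> x > j \<Longrightarrow> tree_symbol e (ad_tree ?P x) \<alpha> = 0"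
    "\<And>\<alpha>. \<alpha> x = j \<Longrightarrow> tree_symbol e (ad_tree ?P x) \<alpha> = u * forest_symbol e ?P \<alpha>"
    using tree_symbol_ad_tree[OF e xP] unfolding len(1) by metis
  have G: "?G \<in> forests (insert x B) (Suc l)"
    using dis x len by (auto simp: forests_def leaves_ad_tree)
  have "forest_symbol e F \<alpha> = forest_symbol e ?P \<alpha> * forest_symbol e ?R \<alpha>" for \<alpha> by (metis FPR forest_symbol_simps(3))
  then have "forest_symbol e ?G \<alpha> = u * f \<alpha>" if "\<alpha> x = j" for \<alpha>
    using u(3)[of \<alpha>, OF that] F(1) by simp
  moreover have "forest_symbol e ?G \<alpha> = 0" if "\<alpha> x > j" for \<alpha> using u(2)[of \<alpha>, OF that] by simp
  moreover have "fscale (a / u) (forest_symbol e ?G) + E \<in> fs.span (forest_symbol e ` forests (insert x B) (Suc l))"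
    by (intro fs.span_add fs.span_scale fs.span_base imageI G E(1))
  ultimately show ?case
    using E(2,3) u(1) fscale_add_apply[of "a / u" "forest_symbol e ?G" E] fscale_add_apply[of a f g]
    by (intro bexI[of _ "fscale (a / u) (forest_symbol e ?G) + E"] conjI allI impI) simp_all
qed

text \<open>Descent on the exponent of \<open>x\<close>. A leading coefficient at exponent
  \<open>j\<close> corresponds to \<open>l + j\<close> trees on \<open>B\<close>, and the induction
  hypothesis asks for at least one; at \<open>j = 0\<close> this means \<open>l \<ge> 1\<close>. So
  the argument reaches products of at least two trees, but not a single tree with several
  leaves.\<close>

lemma lead_step:
  fixes e :: "'k::field_char_0"
  assumes e: "nondeg e" and x: "x \<notin> B" and B: "finite B"
    and IH: "\<And>k l. card B = k + l \<Longrightarrow> l \<ge> 1 \<or> B = {} \<Longrightarrow> invariants e B k \<subseteq> fs.span (forest_symbol e ` forests B l)"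
    and k: "card (insert x B) = k + Suc l" and l: "l \<ge> 1 \<or> B = {}"
    and c: "c \<in> invariants e (insert x B) k"
  shows "c \<in> fs.span (forest_symbol e ` forests (insert x B) (Suc l))"
proof -
  have "c \<in> fs.span (forest_symbol e ` forests (insert x B) (Suc l))"
    if "c \<in> invariants e (insert x B) k" "\<And>\<alpha>. \<alpha> x \<ge> j \<Longrightarrow> c \<alpha> = 0" for j c
    using that
  proof (induction j arbitrary: c)
    case 0
    then have "c = 0" by (simp add: fun_eq_iff)
    show ?case unfolding \<open>c = 0\<close> by (rule fs.span_zero)
  next
    case (Suc j)
    show ?case
    proof (cases "j \<le> k")
      case False
      have h: "homogeneous (insert x B) k c" using Suc.prems by (simp add: invariants_def)
      show ?thesis
        by (rule Suc.IH[OF Suc.prems(1)]) (use False B homogeneous_vanish[OF h, of x] in auto)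
    next
      case True
      have j: "c \<alpha> = 0" if "\<alpha> x > j" for \<alpha> using Suc.prems(2) that by simp
      have "(\<lambda>\<alpha>. c (\<alpha>(x := j))) \<in> invariants e B (k - j)"
        by (rule lead_invariants[OF Suc.prems(1) x B j True])
      moreover have "card B = (k - j) + (l + j)" using k x B True by simp
      ultimately have "(\<lambda>\<alpha>. c (\<alpha>(x := j))) \<in> fs.span (forest_symbol e ` forests B (l + j))"
        using IH[of "k - j" "l + j"] l by auto
      from lead_exists[OF e x this] obtain E where E: "E \<in> fs.span (forest_symbol e ` forests (insert x B) (Suc l))"
        "\<And>\<alpha>. \<alpha> x > j \<Longrightarrow> E \<alpha> = 0" "\<And>\<alpha>. \<alpha> x = j \<Longrightarrow> E \<alpha> = c (\<alpha>(x := j))" by auto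
      have "E \<in> invariants e (insert x B) k" using E(1) k by (rule span_invariants)
      then have "c - E \<in> invariants e (insert x B) k"
        using Suc.prems(1) by (simp add: fs.subspace_diff invariants_subspace)
      moreover have "(c - E) \<alpha> = 0" if "\<alpha> x \<ge> j" for \<alpha>
      proof (cases "\<alpha> x = j")
        case True
        then have "\<alpha>(x := j) = \<alpha>" by auto
        then show ?thesis using E(3)[of \<alpha>, OF True] by simp
      next
        case False
        then show ?thesis using j E(2) that by simp
      qed
      ultimately have "c - E \<in> fs.span (forest_symbol e ` forests (insert x B) (Suc l))" by (rule Suc.IH)
      then have "(c - E) + E \<in> fs.span (forest_symbol e ` forests (insert x B) (Suc l))"
        using E(1) by (rule fs.span_add)
      then show ?thesis by simp
    qed
  qed
  \<comment> \<open>The descent starts above the total degree.\<close>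
  moreover have "c \<alpha> = 0" if "\<alpha> x \<ge> Suc k" for \<alpha>
    using c B that homogeneous_vanish[of "insert x B" k c x \<alpha>] by (simp add: invariants_def)
  ultimately show ?thesis using c by blast
qed

section \<open>Natural operations are Lie elements\<close>

primrec relabel :: "(nat \<Rightarrow> nat) \<Rightarrow> tree \<Rightarrow> tree" where
  "relabel \<pi> (Leaf i) = Leaf (\<pi> i)"
| "relabel \<pi> (Br T U) = Br (relabel \<pi> T) (relabel \<pi> U)"

definition perm_act :: "(nat \<Rightarrow> nat) \<Rightarrow> 'k cfun \<Rightarrow> 'k cfun" where
  "perm_act \<pi> c \<alpha> = c (\<alpha> \<circ> \<pi>)"

lemma leaves_relabel [simp]: "leaves (relabel \<pi> T) = map \<pi> (leaves T)"
  by (induction T) auto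

lemma fun_upd_comp_inj: "inj \<pi> \<Longrightarrow> (\<alpha>(\<pi> j := v)) \<circ> \<pi> = (\<alpha> \<circ> \<pi>)(j := v)"
  by (auto simp: fun_eq_iff inj_eq)

lemma mult_t_perm_act:
  assumes "inj \<pi>"
  shows "mult_t (\<pi> ` J) (perm_act \<pi> c) \<alpha> = mult_t J c (\<alpha> \<circ> \<pi>)"
  unfolding mult_t_def perm_act_def
  using inj_on_subset[OF assms subset_UNIV, of J] by (simp add: sum.reindex fun_upd_comp_inj[OF assms])

lemma tree_symbol_relabel:
  assumes "inj \<pi>"
  shows "tree_symbol e (relabel \<pi> T) = perm_act \<pi> (tree_symbol e T)"
proof (induction T)
  case (Br T U)
  have c: "card (\<pi> ` set (leaves V)) = card (set (leaves V))" for V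
    by (rule card_image) (rule inj_on_subset[OF assms subset_UNIV])
  show ?case
    by (simp add: fun_eq_iff perm_act_def[of _ "bracket _ _ _ _ _"] bracket_def Br c mult_t_perm_act[OF assms])
       (simp add: perm_act_def)
qed (simp add: fun_eq_iff perm_act_def)

lemma relabel_trees:
  assumes "\<pi> permutes A" "T \<in> trees A"
  shows "relabel \<pi> T \<in> trees A"
proof -
  have "inj \<pi>" using assms(1) permutes_inj by blast
  then show ?thesis
    using assms permutes_image[OF assms(1)] inj_on_subset[of \<pi> UNIV A] by (auto simp: trees_def distinct_map)
qed

lemma contraction_perm_act:
  assumes "\<pi> permutes A"
  shows "contraction e A r (perm_act \<pi> c) \<alpha> = contraction e A r c (\<alpha> \<circ> \<pi>)"
proof -
  have i: "inj \<pi>" using assms permutes_inj by blast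
  have "contraction e A r (perm_act \<pi> c) \<alpha> = (\<Sum>i\<in>\<pi> ` A. (e * of_nat (\<alpha> i) + of_nat (Suc r)) * perm_act \<pi> c (\<alpha>(i := \<alpha> i + r)))"
    by (simp add: contraction_def permutes_image[OF assms])
  also have "\<dots> = contraction e A r c (\<alpha> \<circ> \<pi>)"
    unfolding contraction_def perm_act_def
    using inj_on_subset[OF i subset_UNIV, of A] by (simp add: sum.reindex fun_upd_comp_inj[OF i])
  finally show ?thesis .
qed

lemma perm_act_invariants:
  assumes p: "\<pi> permutes A" and c: "c \<in> invariants e A k"
  shows "perm_act \<pi> c \<in> invariants e A k"
proof -
  have d: "depends_on A c" using c by (simp add: invariants_def)
  have "depends_on A (perm_act \<pi> c)"
    unfolding depends_on_def perm_act_def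
  proof (intro allI impI)
    fix \<alpha> \<beta> :: "nat \<Rightarrow> nat" assume *: "\<forall>i\<in>A. \<alpha> i = \<beta> i"
    show "c (\<alpha> \<circ> \<pi>) = c (\<beta> \<circ> \<pi>)"
      by (rule depends_onD[OF d]) (use * permutes_in_image[OF p] in auto)
  qed
  moreover have "homogeneous A k (perm_act \<pi> c)"
    unfolding homogeneous_def perm_act_def
  proof (intro allI impI)
    fix \<alpha> assume "c (\<alpha> \<circ> \<pi>) \<noteq> 0"
    then have "sum (\<alpha> \<circ> \<pi>) A = k" using c unfolding invariants_def homogeneous_def by blast
    then show "sum \<alpha> A = k" using sum.permute[OF p, of \<alpha>] by simp
  qed
  ultimately show ?thesis
    using c by (simp add: invariants_def contraction_perm_act[OF p])
qed

lemma perm_act_span: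
  assumes "\<pi> permutes A" "c \<in> fs.span (tree_symbol e ` trees A)"
  shows "perm_act \<pi> c \<in> fs.span (tree_symbol e ` trees A)"
  using assms(2)
proof (induction rule: fs.span_induct_alt)
  case base
  have "perm_act \<pi> (0 :: 'a cfun) = 0" by (simp add: fun_eq_iff perm_act_def)
  then show ?case using fs.span_zero by metis
next
  case (step a f g)
  then obtain T where T: "T \<in> trees A" "f = tree_symbol e T" by auto
  have "perm_act \<pi> f = tree_symbol e (relabel \<pi> T)"
    using T permutes_inj[OF assms(1)] by (simp add: tree_symbol_relabel)
  then have "perm_act \<pi> f \<in> fs.span (tree_symbol e ` trees A)"
    using relabel_trees[OF assms(1) T(1)] by (auto intro: fs.span_base)
  moreover have "perm_act \<pi> (fscale a f + g) = fscale a (perm_act \<pi> f) + perm_act \<pi> g"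
    by (rule ext) (simp add: perm_act_def fscale_def)
  ultimately show ?case using step by (simp only: fs.span_add fs.span_scale)
qed

text \<open>
  Take \<open>\<alpha>\<close> of minimal support with \<open>c \<alpha> \<noteq> 0\<close> and contract one of its nonzero exponents to \<open>0\<close>: only
  permutations of \<open>\<alpha>\<close> contribute.
\<close>

lemma symmetric_invariants_zero:
  fixes e :: "'k::field_char_0"
  assumes c: "c \<in> invariants e A k" and k: "k \<ge> 1" and A: "finite A"
    and s: "\<And>i j \<alpha>. i \<in> A \<Longrightarrow> j \<in> A \<Longrightarrow> c (\<alpha> \<circ> transpose i j) = c \<alpha>"
  shows "c = 0"
proof (rule ccontr)
  assume "c \<noteq> 0"
  define N where "N \<alpha> = card {i\<in>A. \<alpha> i \<noteq> 0}" for \<alpha> :: "nat \<Rightarrow> nat"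
  obtain \<alpha>0 where "c \<alpha>0 \<noteq> 0" using \<open>c \<noteq> 0\<close> by (auto simp: fun_eq_iff)
  then obtain \<alpha> where \<alpha>: "c \<alpha> \<noteq> 0" and min: "\<And>\<beta>. c \<beta> \<noteq> 0 \<Longrightarrow> N \<alpha> \<le> N \<beta>"
    using ex_has_least_nat[of "\<lambda>\<alpha>. c \<alpha> \<noteq> 0" \<alpha>0 N] by blast
  have "sum \<alpha> A = k" using c \<alpha> by (auto simp: invariants_def homogeneous_def)
  then obtain i0 where i0: "i0 \<in> A" "\<alpha> i0 \<noteq> 0" using k by (metis not_one_le_zero sum.neutral)
  define r where "r = \<alpha> i0"
  define \<alpha>' where "\<alpha>' = \<alpha>(i0 := 0)"
  have r: "r \<ge> 1" using i0 by (simp add: r_def)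
  have "c (\<alpha>'(i := \<alpha>' i + r)) = (if \<alpha>' i = 0 then c \<alpha> else 0)" if i: "i \<in> A" for i
  proof (cases "\<alpha>' i = 0")
    case True
    have "\<alpha>'(i := r) = \<alpha> \<circ> transpose i i0"
      using True by (auto simp: fun_eq_iff \<alpha>'_def r_def transpose_def)
    then show ?thesis using True s[OF i i0(1)] by simp
  next
    case False
    \<comment> \<open>Adding \<open>r\<close> to an exponent that is already nonzero gives a support
      smaller by \<open>i0\<close>, so minimality makes \<open>c\<close> vanish there.\<close>
    have "{l\<in>A. (\<alpha>'(i := \<alpha>' i + r)) l \<noteq> 0} = {l\<in>A. \<alpha> l \<noteq> 0} - {i0}"
      using False by (auto simp: \<alpha>'_def)
    then have "N (\<alpha>'(i := \<alpha>' i + r)) = N \<alpha> - 1"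
      using i0 A by (simp add: N_def)
    moreover have "N \<alpha> \<ge> 1" using i0 A by (auto simp: N_def Suc_le_eq card_gt_0_iff)
    ultimately have "c (\<alpha>'(i := \<alpha>' i + r)) = 0" using min[of "\<alpha>'(i := \<alpha>' i + r)"] by fastforce
    then show ?thesis using False by simp
  qed
  then have "contraction e A r c \<alpha>' = (\<Sum>i\<in>A. if \<alpha>' i = 0 then of_nat (Suc r) * c \<alpha> else 0)"
    unfolding contraction_def by (intro sum.cong) auto
  also have "\<dots> = of_nat (card {i\<in>A. \<alpha>' i = 0}) * (of_nat (Suc r) * c \<alpha>)"
    using A by (simp add: sum.If_cases Int_def)
  finally have "of_nat (card {i\<in>A. \<alpha>' i = 0}) * (of_nat (Suc r) * c \<alpha>) = 0"
    using c r by (simp add: invariants_def)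
  \<comment> \<open>The position \<open>i0\<close> is counted, so in characteristic 0 the factor is
    nonzero.\<close>
  moreover have "card {i\<in>A. \<alpha>' i = 0} \<noteq> 0"
    using A i0 by (auto simp: \<alpha>'_def)
  ultimately show False using \<alpha> by (simp del: of_nat_Suc)
qed

section \<open>Operations antisymmetric in two variables\<close>

text \<open>
  \<open>E\<close> is antisymmetric in \<open>m\<close> and \<open>n\<close>, and for the lexicographic order on the exponents at \<open>m\<close> and \<open>n\<close>
  its leading coefficient, at the exponents \<open>a\<close> and \<open>b\<close>, is \<open>g\<close>.
\<close>

definition antisym_lead :: "nat \<Rightarrow> nat \<Rightarrow> nat \<Rightarrow> nat \<Rightarrow> 'k::field cfun \<Rightarrow> 'k cfun \<Rightarrow> bool" where
  "antisym_lead m n a b g E \<longleftrightarrow> (\<forall>\<alpha>. E (\<alpha> \<circ> transpose m n) = - E \<alpha>) \<and> (\<forall>\<alpha>. \<alpha> m > a \<longrightarrow> E \<alpha> = 0) \<and>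
     (\<forall>\<alpha>. \<alpha> m = a \<longrightarrow> \<alpha> n > b \<longrightarrow> E \<alpha> = 0) \<and> (\<forall>\<alpha>. \<alpha> m = a \<longrightarrow> \<alpha> n = b \<longrightarrow> E \<alpha> = g \<alpha>)"

text \<open>The bracket of \<open>b\<close> trees nested around \<open>n\<close> with the other
  \<open>a - 1\<close> trees nested around \<open>m\<close> has leading exponents \<open>a\<close>
  at \<open>m\<close> and \<open>b\<close> at \<open>n\<close>; the outer bracket supplies the last
  derivative at \<open>m\<close>, hence the number \<open>a + b - 1\<close> of trees. Subtracting
  its image under the transposition makes it antisymmetric and changes the leading coefficient at
  most by a factor.\<close>

lemma antisym_lead_forest:
  fixes e :: "'k::field_char_0"
  assumes e: "nondeg e" and mn: "m \<noteq> n" "m \<notin> B" "n \<notin> B" and ab: "b < a"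
    and F: "F \<in> forests B (a + b - 1)"
  shows "\<exists>E \<in> fs.span (tree_symbol e ` trees (insert m (insert n B))). antisym_lead m n a b (forest_symbol e F) E"
proof -
  let ?A = "insert m (insert n B)" and ?\<tau> = "transpose m n"
  let ?P = "take b F" and ?R = "drop b F"
  have FPR: "F = ?P @ ?R" by simp
  have len: "length ?P = b" "length ?R = a - 1" using F ab by (auto simp: forests_def)
  have fl: "fleaves F = fleaves ?P @ fleaves ?R" by (subst FPR) (simp only: fleaves_simps)
  have dis: "distinct (fleaves ?P @ fleaves ?R)" "set (fleaves ?P @ fleaves ?R) = B"
    using F fl by (auto simp: forests_def)
  have nP: "n \<notin> set (fleaves ?P)" "m \<notin> set (fleaves ?P)" and mR: "m \<notin> set (fleaves ?R)" "n \<notin> set (fleaves ?R)"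
    using mn dis by auto
  obtain u where u: "u \<noteq> 0" "\<And>\<alpha>. \<alpha> n > b \<Longrightarrow> tree_symbol e (ad_tree ?P n) \<alpha> = 0"
    "\<And>\<alpha>. \<alpha> n = b \<Longrightarrow> tree_symbol e (ad_tree ?P n) \<alpha> = u * forest_symbol e ?P \<alpha>"
    using tree_symbol_ad_tree[OF e nP(1)] unfolding len(1) by metis
  obtain v where v: "v \<noteq> 0" "\<And>\<alpha>. \<alpha> m > a - 1 \<Longrightarrow> tree_symbol e (ad_tree ?R m) \<alpha> = 0"
    "\<And>\<alpha>. \<alpha> m = a - 1 \<Longrightarrow> tree_symbol e (ad_tree ?R m) \<alpha> = v * forest_symbol e ?R \<alpha>"
    using tree_symbol_ad_tree[OF e mR(1)] unfolding len(2) by metis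
  define sA where "sA = tree_symbol e (ad_tree ?P n)"
  define sC where "sC = tree_symbol e (ad_tree ?R m)"
  define I where "I = set (leaves (ad_tree ?P n))"
  define J where "J = set (leaves (ad_tree ?R m))"
  define wA where "wA = weight e (card I)"
  define wC where "wC = weight e (card J)"
  define E0 where "E0 = tree_symbol e (Br (ad_tree ?P n) (ad_tree ?R m))"
  have E0: "E0 \<alpha> = wA * sA \<alpha> * mult_t J sC \<alpha> - wC * mult_t I sA \<alpha> * sC \<alpha>" for \<alpha>
    by (simp add: E0_def bracket_def sA_def sC_def wA_def wC_def I_def J_def)
  have T: "Br (ad_tree ?P n) (ad_tree ?R m) \<in> trees ?A"
    using dis mn nP mR by (auto simp: trees_def leaves_ad_tree)
  have IJ: "n \<in> I" "m \<in> J" "finite I" "finite J" by (auto simp: I_def J_def leaves_ad_tree)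
  have "card I \<ge> 1" "card J \<ge> 1" using IJ by (auto simp: Suc_le_eq card_gt_0_iff)
  then have w: "wA \<noteq> 0" "wA + wC \<noteq> 0" using e by (auto simp: wA_def wC_def nondeg_def nondeg_weight)
  have a: "Suc (a - 1) = a" using ab by simp
  have fP: "forest_symbol e ?P (\<alpha>(x := y)) = forest_symbol e ?P \<alpha>" if "x = m \<or> x = n" for \<alpha> x y
    by (rule depends_on_upd[OF depends_on_forest_symbol]) (use that nP in auto)
  have fR: "forest_symbol e ?R (\<alpha>(x := y)) = forest_symbol e ?R \<alpha>" if "x = m \<or> x = n" for \<alpha> x y
    by (rule depends_on_upd[OF depends_on_forest_symbol]) (use that mR in auto)
  have fP': "forest_symbol e ?P (\<alpha> \<circ> ?\<tau>) = forest_symbol e ?P \<alpha>" for \<alpha>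
    by (rule depends_onD[OF depends_on_forest_symbol]) (use nP in \<open>auto simp: transpose_def\<close>)
  have fR': "forest_symbol e ?R (\<alpha> \<circ> ?\<tau>) = forest_symbol e ?R \<alpha>" for \<alpha>
    by (rule depends_onD[OF depends_on_forest_symbol]) (use mR in \<open>auto simp: transpose_def\<close>)
  have A0: "sA \<alpha> = 0" if "\<alpha> n > b" for \<alpha> using u(2) that by (simp add: sA_def)
  have A1: "sA \<alpha> = u * forest_symbol e ?P \<alpha>" if "\<alpha> n = b" for \<alpha> using u(3) that by (simp add: sA_def)
  have C0: "sC \<alpha> = 0" if "\<alpha> m > a - 1" for \<alpha> using v(2) that by (simp add: sC_def)
  have C1: "sC \<alpha> = v * forest_symbol e ?R \<alpha>" if "\<alpha> m = a - 1" for \<alpha> using v(3) that by (simp add: sC_def)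
  have mA0: "mult_t I sA \<alpha> = 0" if "\<alpha> n > Suc b" for \<alpha>
    by (rule mult_t_vanish[where x = n]) (use A0 that in auto)
  have mC0: "mult_t J sC \<alpha> = 0" if "\<alpha> m > a" for \<alpha>
    by (rule mult_t_vanish[where x = m and j = "a - 1"]) (use C0 that a in auto)
  have mA1: "mult_t I sA \<alpha> = of_nat (Suc b) * (u * forest_symbol e ?P \<alpha>)" if "\<alpha> n = Suc b" for \<alpha>
  proof -
    have "mult_t I sA \<alpha> = of_nat (Suc b) * sA (\<alpha>(n := b))"
      by (rule mult_t_lead) (use A0 that IJ in auto)
    also have "sA (\<alpha>(n := b)) = u * forest_symbol e ?P (\<alpha>(n := b))" by (rule A1) simp
    finally show ?thesis using fP[of n \<alpha> b] by (simp only: simp_thms)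
  qed
  have mC1: "mult_t J sC \<alpha> = of_nat a * (v * forest_symbol e ?R \<alpha>)" if "\<alpha> m = a" for \<alpha>
  proof -
    have "mult_t J sC \<alpha> = of_nat (Suc (a - 1)) * sC (\<alpha>(m := a - 1))"
      by (rule mult_t_lead) (use C0 that IJ ab in auto)
    also have "sC (\<alpha>(m := a - 1)) = v * forest_symbol e ?R (\<alpha>(m := a - 1))" by (rule C1) simp
    finally show ?thesis using fR[of m \<alpha> "a - 1"] by (simp only: simp_thms a)
  qed
  \<comment> \<open>If \<open>a = Suc b\<close>, the exchanged exponents are \<open>b + 1\<close> at
    \<open>n\<close> and \<open>a - 1\<close> at \<open>m\<close>, the leading ones of the second
    term of the bracket, which therefore contributes \<open>wC\<close>. By \<open>nondeg\<close> the
    sum of the weights is not 0.\<close>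
  define \<kappa> where "\<kappa> = of_nat a * u * v * (wA + (if a = Suc b then wC else 0))"
  have \<kappa>: "\<kappa> \<noteq> 0" using u(1) v(1) w ab by (simp add: \<kappa>_def)
  define E where "E = fscale (1 / \<kappa>) E0 + fscale (- 1 / \<kappa>) (perm_act ?\<tau> E0)"
  have E: "E \<alpha> = (E0 \<alpha> - E0 (\<alpha> \<circ> ?\<tau>)) / \<kappa>" for \<alpha>
    by (simp add: E_def fscale_add_apply) (simp add: fscale_def perm_act_def diff_divide_distrib)
  have "?\<tau> permutes ?A" by (rule permutes_swap_id) auto
  then have "E \<in> fs.span (tree_symbol e ` trees ?A)"
    unfolding E_def E0_def using T
    by (intro fs.span_add fs.span_scale perm_act_span fs.span_base imageI)
  moreover have "antisym_lead m n a b (forest_symbol e F) E"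
    unfolding antisym_lead_def
  proof (intro conjI allI impI)
    fix \<alpha> :: "nat \<Rightarrow> nat"
    have tt: "\<alpha> \<circ> ?\<tau> \<circ> ?\<tau> = \<alpha>" by (simp add: comp_assoc)
    show "E (\<alpha> \<circ> ?\<tau>) = - E \<alpha>"
      unfolding E tt by (simp add: diff_divide_distrib)
    have tm: "(\<alpha> \<circ> ?\<tau>) m = \<alpha> n" "(\<alpha> \<circ> ?\<tau>) n = \<alpha> m" by simp_all
    {
      assume *: "\<alpha> m > a"
      have "E0 \<alpha> = 0" using C0[of \<alpha>] mC0[of \<alpha>] * by (simp add: E0)
      moreover have "E0 (\<alpha> \<circ> ?\<tau>) = 0"
        using A0[of "\<alpha> \<circ> ?\<tau>"] mA0[of "\<alpha> \<circ> ?\<tau>"] * ab unfolding tm by (simp add: E0)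
      ultimately show "E \<alpha> = 0" by (simp add: E)
    }
    {
      assume *: "\<alpha> m = a" "\<alpha> n > b"
      have "E0 \<alpha> = 0" using C0[of \<alpha>] A0[of \<alpha>] * ab by (simp add: E0)
      moreover have "E0 (\<alpha> \<circ> ?\<tau>) = 0"
      proof (cases "a = Suc b")
        case True
        then show ?thesis
          using A0[of "\<alpha> \<circ> ?\<tau>"] C0[of "\<alpha> \<circ> ?\<tau>"] * ab unfolding tm by (simp add: E0)
      next
        case False
        then show ?thesis
          using A0[of "\<alpha> \<circ> ?\<tau>"] mA0[of "\<alpha> \<circ> ?\<tau>"] * ab unfolding tm by (simp add: E0)
      qed
      ultimately show "E \<alpha> = 0" by (simp add: E)
    }
    {
      assume *: "\<alpha> m = a" "\<alpha> n = b"
      have 1: "E0 \<alpha> = wA * (u * forest_symbol e ?P \<alpha>) * (of_nat a * (v * forest_symbol e ?R \<alpha>))"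
        using C0[of \<alpha>] A1[of \<alpha>] mC1[of \<alpha>] * ab by (simp add: E0)
      have 2: "E0 (\<alpha> \<circ> ?\<tau>) = - (if a = Suc b then wC else 0) * (u * forest_symbol e ?P \<alpha>) * (of_nat a * (v * forest_symbol e ?R \<alpha>))"
      proof (cases "a = Suc b")
        case True
        then show ?thesis
          using A0[of "\<alpha> \<circ> ?\<tau>"] C1[of "\<alpha> \<circ> ?\<tau>"] mA1[of "\<alpha> \<circ> ?\<tau>"] * ab
          unfolding tm fP' fR' by (simp add: E0 algebra_simps)
      next
        case False
        then show ?thesis
          using A0[of "\<alpha> \<circ> ?\<tau>"] mA0[of "\<alpha> \<circ> ?\<tau>"] * ab unfolding tm by (simp add: E0)
      qed
      have "forest_symbol e F \<alpha> = forest_symbol e ?P \<alpha> * forest_symbol e ?R \<alpha>" by (metis FPR forest_symbol_simps(3))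
      then have "E0 \<alpha> - E0 (\<alpha> \<circ> ?\<tau>) = \<kappa> * forest_symbol e F \<alpha>"
        unfolding 1 2 \<kappa>_def by (simp add: algebra_simps)
      then show "E \<alpha> = forest_symbol e F \<alpha>" using \<kappa> by (simp add: E)
    }
  qed
  ultimately show ?thesis by blast
qed

lemma antisym_lead_span:
  fixes e :: "'k::field_char_0"
  assumes e: "nondeg e" and mn: "m \<noteq> n" "m \<notin> B" "n \<notin> B" and ab: "b < a"
    and g: "g \<in> fs.span (forest_symbol e ` forests B (a + b - 1))"
  shows "\<exists>E \<in> fs.span (tree_symbol e ` trees (insert m (insert n B))). antisym_lead m n a b g E"
  using g
proof (induction rule: fs.span_induct_alt)
  case base
  show ?case by (intro bexI[of _ 0]) (auto simp: fs.span_zero antisym_lead_def)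
next
  case (step s f g)
  then obtain E where E: "E \<in> fs.span (tree_symbol e ` trees (insert m (insert n B)))" "antisym_lead m n a b g E" by auto
  from step(1) obtain F where F: "f = forest_symbol e F" "F \<in> forests B (a + b - 1)" by auto
  obtain E' where E': "E' \<in> fs.span (tree_symbol e ` trees (insert m (insert n B)))" "antisym_lead m n a b f E'"
    using antisym_lead_forest[OF e mn ab F(2)] F(1) by auto
  have "antisym_lead m n a b (fscale s f + g) (fscale s E' + E)"
    using E(2) E'(2) unfolding antisym_lead_def fscale_add_apply by auto
  then show ?case using E(1) E'(1) by (meson fs.span_add fs.span_scale)
qed

text \<open>
  Here \<open>g\<close> is not a product of Lie elements, but \<open>x\<^sub>m g\<close> and \<open>x\<^sub>n g\<close> are Lie elements by induction, and
  \<open>[x\<^sub>n g, x\<^sub>m] - [x\<^sub>m g, x\<^sub>n]\<close> is a multiple of \<open>[x\<^sub>n, x\<^sub>m] g\<close>.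
\<close>

lemma antisym_lead_10:
  fixes e :: "'k::field_char_0"
  assumes e: "nondeg e" and mn: "m \<noteq> n" "m \<notin> B" "n \<notin> B" and B: "finite B"
    and IH: "invariants e (insert m B) (card B) \<subseteq> fs.span (tree_symbol e ` trees (insert m B))"
    and g: "g \<in> invariants e B (card B)"
  shows "\<exists>E \<in> fs.span (tree_symbol e ` trees (insert m (insert n B))). antisym_lead m n 1 0 g E"
proof -
  let ?A = "insert m (insert n B)" and ?\<tau> = "transpose m n" and ?M = "insert m B"
  let ?S = "fs.span (tree_symbol e ` trees ?A)"
  define br where "br f = bracket e ?M {n} f (tree_symbol e (Leaf n))" for f :: "'k cfun"
  define w where "w = weight e (card ?M)"
  have br: "br f \<alpha> = w * f \<alpha> * of_bool (\<alpha> n = 1) - mult_t ?M f \<alpha> * of_bool (\<alpha> n = 0)" for f \<alpha>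
  proof -
    have "mult_t {n} (tree_symbol e (Leaf n)) \<alpha> = of_bool (\<alpha> n = 1)"
      by (cases "\<alpha> n") (auto simp: mult_t_def)
    then show ?thesis by (simp add: br_def bracket_def w_def weight_def)
  qed
  have br_span: "br f \<in> ?S" if "f \<in> fs.span (tree_symbol e ` trees ?M)" for f
    using that
  proof (induction rule: fs.span_induct_alt)
    case base
    have "br 0 = 0" by (rule ext) (simp add: br mult_t_def)
    then show ?case using fs.span_zero by metis
  next
    case (step a f g)
    then obtain T where T: "T \<in> trees ?M" "f = tree_symbol e T" by auto
    then have "br f = tree_symbol e (Br T (Leaf n))"
      by (auto simp: br_def trees_def)
    moreover have "Br T (Leaf n) \<in> trees ?A" using T mn by (auto simp: trees_def)
    ultimately have "br f \<in> ?S" by (metis fs.span_base imageI)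
    moreover have "br (fscale a f + g) = fscale a (br f) + br g"
    proof (rule ext)
      fix \<alpha>
      show "br (fscale a f + g) \<alpha> = (fscale a (br f) + br g) \<alpha>"
        unfolding fscale_add_apply br mult_t_lin by (simp only: algebra_simps)
    qed
    ultimately show ?case using step by (simp only: fs.span_add fs.span_scale)
  qed
  \<comment> \<open>The symbol of \<open>x\<^sub>m g\<close>: it has degree \<open>card B\<close> in
    \<open>card B + 1\<close> variables, the degree of a single tree, so that \<open>IH\<close>
    applies.\<close>
  define g' where "g' \<alpha> = g \<alpha> * of_bool (\<alpha> m = 0)" for \<alpha>
  have "tree_symbol e (Leaf m) \<in> invariants e {m} 0"
    using tree_symbol_invariants[of "Leaf m" "{m}" e] by (simp add: trees_def del: tree_symbol.simps)
  then have "(\<lambda>\<alpha>. g \<alpha> * tree_symbol e (Leaf m) \<alpha>) \<in> invariants e (B \<union> {m}) (card B + 0)"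
    using g B mn by (intro invariants_mult) auto
  then have "g' \<in> invariants e ?M (card B)" by (simp add: g'_def[abs_def])
  then have g': "br g' \<in> ?S" using IH by (intro br_span) blast
  \<comment> \<open>At the leading exponent one of the two brackets contributes \<open>w\<close> and
    the other 1, the weight of a leaf.\<close>
  define \<kappa> where "\<kappa> = w + 1"
  have "weight e (card ?M) + weight e 1 \<noteq> 0" using e B mn unfolding nondeg_def by simp
  then have \<kappa>: "\<kappa> \<noteq> 0" by (simp add: \<kappa>_def w_def weight_def)
  define E where "E = fscale (1 / \<kappa>) (perm_act ?\<tau> (br g')) + fscale (- 1 / \<kappa>) (br g')"
  have E: "E \<alpha> = (br g' (\<alpha> \<circ> ?\<tau>) - br g' \<alpha>) / \<kappa>" for \<alpha>
    by (simp add: E_def fscale_add_apply) (simp add: fscale_def perm_act_def diff_divide_distrib)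
  have "?\<tau> permutes ?A" by (rule permutes_swap_id) auto
  then have "E \<in> ?S"
    unfolding E_def using g' by (intro fs.span_add fs.span_scale perm_act_span)
  moreover have "antisym_lead m n 1 0 g E"
    unfolding antisym_lead_def
  proof (intro conjI allI impI)
    fix \<alpha> :: "nat \<Rightarrow> nat"
    have tt: "\<alpha> \<circ> ?\<tau> \<circ> ?\<tau> = \<alpha>" by (simp add: comp_assoc)
    show "E (\<alpha> \<circ> ?\<tau>) = - E \<alpha>"
      unfolding E tt by (simp add: diff_divide_distrib)
    have tm: "(\<alpha> \<circ> ?\<tau>) m = \<alpha> n" "(\<alpha> \<circ> ?\<tau>) n = \<alpha> m" by simp_all
    have z: "g' \<beta> = 0" if "\<beta> m > 0" for \<beta> using that by (simp add: g'_def)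
    {
      assume *: "\<alpha> m > 1"
      have "mult_t ?M g' \<alpha> = 0" by (rule mult_t_vanish[where x = m and j = 0]) (use z * in auto)
      then have "br g' \<alpha> = 0" using z[of \<alpha>] * by (simp add: br)
      moreover have "br g' (\<alpha> \<circ> ?\<tau>) = 0" unfolding br tm using * by simp
      ultimately show "E \<alpha> = 0" by (simp add: E)
    }
    {
      assume *: "\<alpha> m = 1" "\<alpha> n > 0"
      have "br g' \<alpha> = 0" using z[of \<alpha>] * by (simp add: br)
      moreover have "br g' (\<alpha> \<circ> ?\<tau>) = 0" using z[of "\<alpha> \<circ> ?\<tau>"] * unfolding br tm by simp
      ultimately show "E \<alpha> = 0" by (simp add: E)
    }
    {
      assume *: "\<alpha> m = 1" "\<alpha> n = 0"
      have d: "depends_on B g" using g by (simp add: invariants_def)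
      have "mult_t ?M g' \<alpha> = of_nat (Suc 0) * g' (\<alpha>(m := 0))"
        by (rule mult_t_lead) (use z * B in auto)
      also have "\<dots> = g \<alpha>"
        using depends_on_upd[OF d mn(2), of \<alpha> 0] by (simp add: g'_def)
      finally have "br g' \<alpha> = - g \<alpha>" using z[of \<alpha>] * by (simp add: br)
      moreover have "g (\<alpha> \<circ> ?\<tau>) = g \<alpha>"
        by (rule depends_onD[OF d]) (use mn in \<open>auto simp: transpose_def\<close>)
      then have "br g' (\<alpha> \<circ> ?\<tau>) = w * g \<alpha>" unfolding br tm using * by (simp add: g'_def)
      ultimately have "br g' (\<alpha> \<circ> ?\<tau>) - br g' \<alpha> = \<kappa> * g \<alpha>" by (simp add: \<kappa>_def algebra_simps)
      then show "E \<alpha> = g \<alpha>" using \<kappa> by (simp add: E)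
    }
  qed
  ultimately show ?thesis by blast
qed

lemma tree_symbol_span_invariants:
  fixes e :: "'k::field_char_0"
  assumes "c \<in> fs.span (tree_symbol e ` trees A)"
  shows "c \<in> invariants e A (card A - 1)"
  using fs.span_minimal[OF _ invariants_subspace, of "tree_symbol e ` trees A" e A "card A - 1"] tree_symbol_invariants assms
  by blast

text \<open>Lexicographic descent on the exponents \<open>a\<close> of \<open>m\<close> and
  \<open>b\<close> of \<open>n\<close>, where antisymmetry forces \<open>b < a\<close> for a leading
  pair. The leading coefficient has degree \<open>card B + 1 - a - b\<close>, which corresponds to
  \<open>a + b - 1\<close> trees on \<open>B\<close>. This number is at least 1 except for the pair
  1, 0, where \<open>antisym_lead_10\<close> steps in.\<close>

lemma antisym_invariants_span:
  fixes e :: "'k::field_char_0"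
  assumes e: "nondeg e" and mn: "m \<noteq> n" "m \<notin> B" "n \<notin> B" and B: "finite B"
    and IHB: "\<And>k l. card B = k + l \<Longrightarrow> l \<ge> 1 \<or> B = {} \<Longrightarrow> invariants e B k \<subseteq> fs.span (forest_symbol e ` forests B l)"
    and IHm: "invariants e (insert m B) (card B) \<subseteq> fs.span (tree_symbol e ` trees (insert m B))"
    and c: "c \<in> invariants e (insert m (insert n B)) (Suc (card B))" "\<And>\<alpha>. c (\<alpha> \<circ> transpose m n) = - c \<alpha>"
  shows "c \<in> fs.span (tree_symbol e ` trees (insert m (insert n B)))"
proof -
  let ?A = "insert m (insert n B)" and ?\<tau> = "transpose m n" and ?k = "Suc (card B)"
  let ?S = "fs.span (tree_symbol e ` trees ?A)"
  have cA: "card ?A - 1 = ?k" using mn B by simp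
  have main: "c \<in> ?S" if "c \<in> invariants e ?A ?k" "\<And>\<alpha>. c (\<alpha> \<circ> ?\<tau>) = - c \<alpha>" "\<And>\<alpha>. \<alpha> m \<ge> a \<Longrightarrow> c \<alpha> = 0" for a c
    using that
  proof (induction a arbitrary: c)
    case 0
    then have "c = 0" by (simp add: fun_eq_iff)
    show ?case unfolding \<open>c = 0\<close> by (rule fs.span_zero)
  next
    case (Suc a)
    note outer = Suc.IH
    have Q: "c \<in> ?S" if "b \<le> a" "c \<in> invariants e ?A ?k" "\<And>\<alpha>. c (\<alpha> \<circ> ?\<tau>) = - c \<alpha>" "\<And>\<alpha>. \<alpha> m > a \<Longrightarrow> c \<alpha> = 0"
      "\<And>\<alpha>. \<alpha> m = a \<Longrightarrow> \<alpha> n \<ge> b \<Longrightarrow> c \<alpha> = 0" for b c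
      using that
    proof (induction b arbitrary: c)
      case 0
      \<comment> \<open>With \<open>b = 0\<close> nothing is left at exponent \<open>a\<close> of
        \<open>m\<close>, and the outer induction takes over.\<close>
      show ?case
      proof (rule outer[OF "0.prems"(2,3)])
        fix \<alpha> :: "nat \<Rightarrow> nat" assume "a \<le> \<alpha> m"
        then show "c \<alpha> = 0" using "0.prems"(4)[of \<alpha>] "0.prems"(5)[of \<alpha>] by (cases "\<alpha> m = a") auto
      qed
    next
      case (Suc b)
      note c = Suc.prems
      have ab: "b < a" using c(1) by simp
      have h: "homogeneous ?A ?k c" using c(2) by (simp add: invariants_def)
      show ?case
      proof (cases "a + b \<le> ?k")
        case False
        have "c \<alpha> = 0" if "\<alpha> m = a" "\<alpha> n = b" for \<alpha>
        proof (rule ccontr)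
          assume "c \<alpha> \<noteq> 0"
          then have "sum \<alpha> ?A = ?k" using h by (simp add: homogeneous_def)
          then show False using False mn B that by simp
        qed
        then have "c \<alpha> = 0" if "\<alpha> m = a" "\<alpha> n \<ge> b" for \<alpha>
          using c(5)[of \<alpha>] that by (cases "\<alpha> n = b") auto
        then show ?thesis using Suc.IH[OF _ c(2,3,4)] ab by simp
      next
        case True
        let ?g = "\<lambda>\<alpha>. c (\<alpha>(n := b, m := a))"
        have "(\<lambda>\<alpha>. c (\<alpha>(m := a))) \<in> invariants e (insert n B) (?k - a)"
          by (rule lead_invariants[OF c(2) _ _ c(4)]) (use mn B True in auto)
        then have "?g \<in> invariants e B (?k - a - b)"
          by (rule lead_invariants) (use mn B True c(5) in auto)
        moreover have "\<exists>E\<in>?S. antisym_lead m n a b ?g E"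
        proof (cases "a = 1")
          case True
          then have "?g \<in> invariants e B (card B)" using calculation ab by simp
          then show ?thesis using antisym_lead_10[OF e mn B IHm, of ?g] True ab by simp
        next
          case False
          have "card B = (?k - a - b) + (a + b - 1)" "a + b - 1 \<ge> 1" using True False ab by auto
          then have "?g \<in> fs.span (forest_symbol e ` forests B (a + b - 1))"
            using IHB[of "?k - a - b" "a + b - 1"] calculation by auto
          then show ?thesis by (rule antisym_lead_span[OF e mn ab])
        qed
        ultimately obtain E where ES: "E \<in> ?S" and "antisym_lead m n a b ?g E" by blast
        then have E: "\<And>\<alpha>. E (\<alpha> \<circ> ?\<tau>) = - E \<alpha>" "\<And>\<alpha>. \<alpha> m > a \<Longrightarrow> E \<alpha> = 0"
          "\<And>\<alpha>. \<alpha> m = a \<Longrightarrow> \<alpha> n > b \<Longrightarrow> E \<alpha> = 0" "\<And>\<alpha>. \<alpha> m = a \<Longrightarrow> \<alpha> n = b \<Longrightarrow> E \<alpha> = ?g \<alpha>"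
          by (auto simp: antisym_lead_def)
        have "E \<in> invariants e ?A ?k" using tree_symbol_span_invariants[OF ES] by (simp only: cA)
        then have "c - E \<in> invariants e ?A ?k" using c(2) by (simp add: fs.subspace_diff invariants_subspace)
        then have "c - E \<in> ?S"
        proof (rule Suc.IH[rotated])
          fix \<alpha> :: "nat \<Rightarrow> nat"
          show "(c - E) (\<alpha> \<circ> ?\<tau>) = - (c - E) \<alpha>" using c(3)[of \<alpha>] E(1)[of \<alpha>] by (simp del: o_apply)
          show "(c - E) \<alpha> = 0" if "\<alpha> m > a" using c(4)[of \<alpha>] E(2)[of \<alpha>] that by simp
          show "(c - E) \<alpha> = 0" if *: "\<alpha> m = a" "b \<le> \<alpha> n"
          proof (cases "\<alpha> n = b")
            case True
            have "\<alpha>(n := b, m := a) = \<alpha>" using True * by auto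
            then show ?thesis using E(4)[of \<alpha>] True * by simp
          next
            case False
            then show ?thesis using c(5)[of \<alpha>] E(3)[of \<alpha>] * by simp
          qed
        qed (use ab in simp)
        then have "(c - E) + E \<in> ?S" using ES by (rule fs.span_add)
        then show ?thesis by simp
      qed
    qed
    show ?case
    proof (rule Q[of a])
      show "c \<alpha> = 0" if "\<alpha> m > a" for \<alpha> using Suc.prems(3) that by simp
      \<comment> \<open>On the diagonal the exponents are fixed by the transposition, so
        \<open>c \<alpha>\<close> equals its negative; beyond it the mirror image has exponent
        greater than \<open>a\<close> at \<open>m\<close>.\<close>
      show "c \<alpha> = 0" if *: "\<alpha> m = a" "\<alpha> n \<ge> a" for \<alpha>
      proof (cases "\<alpha> n = a")
        case True
        have "\<alpha> \<circ> ?\<tau> = \<alpha>" using True * by (auto simp: fun_eq_iff transpose_def)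
        then show ?thesis using Suc.prems(2)[of \<alpha>] by simp
      next
        case False
        then have "c (\<alpha> \<circ> ?\<tau>) = 0" using * by (intro Suc.prems(3)) simp
        then show ?thesis using Suc.prems(2)[of \<alpha>] by simp
      qed
    qed (use Suc.prems in auto)
  qed
  have "c \<alpha> = 0" if "\<alpha> m \<ge> Suc ?k" for \<alpha>
    using homogeneous_vanish[of ?A ?k c m \<alpha>] c(1) that B by (simp add: invariants_def)
  then show ?thesis using main[OF c] by blast
qed

lemma forests_1: "forest_symbol e ` forests A 1 = tree_symbol e ` trees A"
proof -
  have "forest_symbol e [T] = tree_symbol e T" for T by (rule ext) simp
  moreover have "forests A 1 = (\<lambda>T. [T]) ` trees A"
    by (auto simp: forests_def trees_def length_Suc_conv)
  ultimately show ?thesis by (simp add: image_image)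
qed

lemma invariants_span_trees:
  fixes e :: "'k::field_char_0"
  assumes e: "nondeg e" and A: "finite A" "card A \<ge> 2"
    and IH: "\<And>B k l. B \<subset> A \<Longrightarrow> card B = k + l \<Longrightarrow> l \<ge> 1 \<or> B = {} \<Longrightarrow> invariants e B k \<subseteq> fs.span (forest_symbol e ` forests B l)"
    and c: "c \<in> invariants e A (card A - 1)"
  shows "c \<in> fs.span (tree_symbol e ` trees A)"
proof -
  let ?S = "fs.span (tree_symbol e ` trees A)" and ?k = "card A - 1"
  have sw: "c - perm_act (transpose m n) c \<in> ?S" if mnA: "m \<in> A" "n \<in> A" and c: "c \<in> invariants e A ?k" for m n c
  proof (cases "m = n")
    case True
    then have "c - perm_act (transpose m n) c = 0" by (simp add: fun_eq_iff perm_act_def)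
    then show ?thesis using fs.span_zero by metis
  next
    case False
    define B where "B = A - {m, n}"
    have B: "m \<notin> B" "n \<notin> B" "finite B" "A = insert m (insert n B)"
      using A mnA by (auto simp: B_def)
    have k: "?k = Suc (card B)" using B False by simp
    have "insert m B \<subset> A" "B \<subset> A" using B False by auto
    have "invariants e (insert m B) (card B) \<subseteq> fs.span (forest_symbol e ` forests (insert m B) 1)"
      by (rule IH) (use \<open>insert m B \<subset> A\<close> B in auto)
    then have m: "invariants e (insert m B) (card B) \<subseteq> fs.span (tree_symbol e ` trees (insert m B))"
      by (simp only: forests_1)
    have "transpose m n permutes A" using mnA by (rule permutes_swap_id)
    then have "c - perm_act (transpose m n) c \<in> invariants e A ?k"
      by (intro fs.subspace_diff invariants_subspace c perm_act_invariants)
    moreover have "(c - perm_act (transpose m n) c) (\<alpha> \<circ> transpose m n) = - (c - perm_act (transpose m n) c) \<alpha>" for \<alpha>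
      by (simp add: perm_act_def comp_assoc)
    ultimately show ?thesis
      using antisym_invariants_span[OF e False B(1,2,3) IH[OF \<open>B \<subset> A\<close>] m, of "c - perm_act (transpose m n) c"]
      unfolding k B(4)[symmetric] by blast
  qed
  have perm: "c - perm_act \<pi> c \<in> ?S" if "\<pi> permutes A" for \<pi>
    using that A(1)
  proof (induction rule: permutes_induct)
    case id
    have "c - perm_act id c = 0" by (simp add: fun_eq_iff perm_act_def)
    then show ?case using fs.span_zero by metis
  next
    case (swap a b p)
    have "perm_act (transpose a b \<circ> p) c = perm_act (transpose a b) (perm_act p c)"
      by (simp add: fun_eq_iff perm_act_def comp_assoc)
    then have "c - perm_act (transpose a b \<circ> p) c = (c - perm_act p c) + (perm_act p c - perm_act (transpose a b) (perm_act p c))"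
      by simp
    moreover have "perm_act p c - perm_act (transpose a b) (perm_act p c) \<in> ?S"
      using swap.hyps c by (intro sw perm_act_invariants) auto
    ultimately show ?case using swap.IH fs.span_add by metis
  qed
  let ?P = "{\<pi>. \<pi> permutes A}"
  define d where "d = (\<Sum>\<pi>\<in>?P. perm_act \<pi> c)"
  have dn: "d \<in> invariants e A ?k"
    unfolding d_def using perm_act_invariants[OF _ c] by (intro fs.subspace_sum invariants_subspace) simp
  have ap: "(\<Sum>x\<in>X. f x) \<alpha> = (\<Sum>x\<in>X. f x \<alpha>)" for X and f :: "(nat \<Rightarrow> nat) \<Rightarrow> 'k cfun" and \<alpha>
    by (induction X rule: infinite_finite_induct) auto
  have "d (\<alpha> \<circ> transpose i j) = d \<alpha>" if ij: "i \<in> A" "j \<in> A" for i j \<alpha>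
  proof -
    let ?t = "transpose i j"
    have t: "?t permutes A" using ij by (rule permutes_swap_id)
    have "d (\<alpha> \<circ> ?t) = (\<Sum>\<pi>\<in>?P. c (\<alpha> \<circ> (?t \<circ> \<pi>)))"
      unfolding d_def ap perm_act_def by (simp add: comp_assoc)
    also have "\<dots> = (\<Sum>\<pi>\<in>?P. c (\<alpha> \<circ> \<pi>))"
      by (rule sum.reindex_bij_witness[where i = "\<lambda>\<pi>. ?t \<circ> \<pi>" and j = "\<lambda>\<pi>. ?t \<circ> \<pi>"])
         (auto simp: permutes_compose[OF _ t] simp flip: comp_assoc)
    finally show ?thesis by (simp add: d_def ap perm_act_def)
  qed
  then have "d = 0" using symmetric_invariants_zero[OF dn _ A(1)] A(2) by simp
  have fP: "finite ?P" "card ?P \<noteq> 0" using A(1) by (simp_all add: finite_permutations card_permutations)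
  \<comment> \<open>The sum of all \<open>perm_act \<pi> c\<close> is \<open>d = 0\<close>, so this
    sum is \<open>card ?P\<close> times \<open>c\<close>, and \<open>card ?P\<close> is invertible
    in characteristic 0.\<close>
  have "(\<Sum>\<pi>\<in>?P. c - perm_act \<pi> c) \<in> ?S" using perm by (intro fs.span_sum) simp
  then have "fscale (1 / of_nat (card ?P)) (\<Sum>\<pi>\<in>?P. c - perm_act \<pi> c) \<in> ?S" by (rule fs.span_scale)
  moreover have "(\<Sum>\<pi>\<in>?P. c - perm_act \<pi> c) \<alpha> = of_nat (card ?P) * c \<alpha>" for \<alpha>
  proof -
    have "(\<Sum>\<pi>\<in>?P. c - perm_act \<pi> c) \<alpha> = (\<Sum>\<pi>\<in>?P. c \<alpha> - perm_act \<pi> c \<alpha>)" unfolding ap by simp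
    also have "\<dots> = of_nat (card ?P) * c \<alpha> - d \<alpha>" by (simp add: sum_subtractf d_def ap)
    finally show ?thesis using \<open>d = 0\<close> by simp
  qed
  then have "fscale (1 / of_nat (card ?P)) (\<Sum>\<pi>\<in>?P. c - perm_act \<pi> c) = c"
    unfolding fscale_def using fP(2) by (intro ext) simp
  ultimately show ?thesis by simp
qed

text \<open>For \<open>l = 0\<close> and nonempty \<open>A\<close> this fails: with
  \<open>e = 0\<close> the Vandermonde determinant in three variables has degree 3, and no empty
  forest has three leaves. Several trees reduce to fewer variables through leading coefficients in
  one variable; a single tree takes two variables and the symmetrisation.\<close>

theorem invariants_span_forests:
  fixes e :: "'k::field_char_0"
  assumes e: "nondeg e" and "finite A" "card A = k + l" "l \<ge> 1 \<or> A = {}"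
  shows "invariants e A k \<subseteq> fs.span (forest_symbol e ` forests A l)"
  using assms(2-)
proof (induction A arbitrary: k l rule: finite_psubset_induct)
  case (psubset A)
  have IH: "invariants e B k \<subseteq> fs.span (forest_symbol e ` forests B l)" if "B \<subset> A" "card B = k + l" "l \<ge> 1 \<or> B = {}" for B k l
    using psubset.IH[OF that(1)] that by blast
  consider "A = {}" | "A \<noteq> {}" "l \<ge> 2 \<or> card A = 1" | "card A \<ge> 2" "l = 1"
    using psubset.prems by fastforce
  then show ?case
  proof cases
    case 1
    have "c \<in> fs.span (forest_symbol e ` forests A l)" if "c \<in> invariants e A k" for c
    proof -
      have "c \<alpha> = c (\<lambda>_. 0)" for \<alpha> using that 1 by (auto simp: invariants_def depends_on_def)
      then have "c = fscale (c (\<lambda>_. 0)) (forest_symbol e [])" by (auto simp: fun_eq_iff fscale_def)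
      moreover have "[] \<in> forests A l" using 1 psubset.prems by (simp add: forests_def)
      ultimately show ?thesis by (metis fs.span_scale fs.span_base imageI)
    qed
    then show ?thesis by blast
  next
    case 2
    then obtain x where x: "x \<in> A" by blast
    define B where "B = A - {x}"
    have B: "A = insert x B" "x \<notin> B" "finite B" "B \<subset> A" using x psubset.hyps by (auto simp: B_def)
    obtain l' where l: "l = Suc l'" using psubset.prems 2(1) by (cases l) auto
    have "l' \<ge> 1 \<or> B = {}" using 2(2) B l by auto
    then show ?thesis
      using lead_step[OF e B(2,3) IH[OF B(4)]] psubset.prems(1) unfolding B(1) l by blast
  next
    case 3
    then have "k = card A - 1" using psubset.prems by simp
    then show ?thesis
      using invariants_span_trees[OF e psubset.hyps 3(1) IH] 3(2) by (auto simp: forests_1 simp del: One_nat_def)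
  qed
qed

section \<open>Semicontinuity of ranks\<close>

text \<open>The columns \<open>I\<close> are linearly independent, that is, the rank is
  \<open>card I\<close>. The set \<open>R\<close> of rows may be infinite.\<close>

definition trivial_kernel :: "'i set \<Rightarrow> 'r set \<Rightarrow> ('r \<Rightarrow> 'i \<Rightarrow> 'k::field) \<Rightarrow> bool" where
  "trivial_kernel I R M \<longleftrightarrow> (\<forall>c. (\<forall>r\<in>R. (\<Sum>i\<in>I. c i * M r i) = 0) \<longrightarrow> (\<forall>i\<in>I. c i = 0))"

lemma trivial_kernelD: "trivial_kernel I R M \<Longrightarrow> (\<And>r. r \<in> R \<Longrightarrow> (\<Sum>i\<in>I. c i * M r i) = 0) \<Longrightarrow> i \<in> I \<Longrightarrow> c i = 0"
  unfolding trivial_kernel_def by blast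

lemma trivial_kernel_mono: "trivial_kernel I Y M \<Longrightarrow> Y \<subseteq> R \<Longrightarrow> trivial_kernel I R M"
  unfolding trivial_kernel_def by blast

text \<open>Cross multiplication keeps the entries in the ring, so elimination on a matrix of
  polynomials commutes with evaluation at a parameter.\<close>

definition eliminate :: "'r \<Rightarrow> 'i \<Rightarrow> ('r \<Rightarrow> 'i \<Rightarrow> 'a::comm_ring_1) \<Rightarrow> 'r \<Rightarrow> 'i \<Rightarrow> 'a" where
  "eliminate r0 i M r j = M r0 i * M r j - M r i * M r0 j"

lemma sum_eliminate:
  "(\<Sum>j\<in>I. c j * eliminate r0 i M r j) = M r0 i * (\<Sum>j\<in>I. c j * M r j) - M r i * (\<Sum>j\<in>I. c j * M r0 j)"
  unfolding eliminate_def sum_distrib_left sum_subtractf[symmetric]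
  by (intro sum.cong refl) (simp add: algebra_simps)

lemma trivial_kernel_eliminate:
  assumes t: "trivial_kernel (insert i I) R M" and i: "i \<notin> I" "finite I" and r0: "M r0 i \<noteq> 0"
  shows "trivial_kernel I R (eliminate r0 i M)"
  unfolding trivial_kernel_def
proof (intro allI impI ballI)
  fix c j assume c: "\<forall>r\<in>R. (\<Sum>j\<in>I. c j * eliminate r0 i M r j) = 0" and j: "j \<in> I"
  \<comment> \<open>The new entry at \<open>i\<close> is the one that solves equation
    \<open>r0\<close>.\<close>
  define c' where "c' = c(i := - (\<Sum>j\<in>I. c j * M r0 j) / M r0 i)"
  have eq: "(\<Sum>j\<in>I. c' j * M r j) = (\<Sum>j\<in>I. c j * M r j)" for r
    using i by (intro sum.cong) (auto simp: c'_def)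
  have "c' j = 0"
  proof (rule trivial_kernelD[OF t])
    fix r assume "r \<in> R"
    then have "M r0 i * (\<Sum>j\<in>I. c j * M r j) - M r i * (\<Sum>j\<in>I. c j * M r0 j) = 0"
      using c by (simp add: sum_eliminate)
    moreover have "(\<Sum>j\<in>insert i I. c' j * M r j) = c' i * M r i + (\<Sum>j\<in>I. c j * M r j)"
      using i eq by simp
    ultimately show "(\<Sum>j\<in>insert i I. c' j * M r j) = 0"
      using r0 by (simp add: c'_def field_simps)
  qed (use j in simp)
  then show "c j = 0" using i j by (auto simp: c'_def split: if_splits)
qed

lemma trivial_kernel_uneliminate:
  assumes t: "trivial_kernel I Y (eliminate r0 i M)" and i: "i \<notin> I" "finite I" and r0: "M r0 i \<noteq> 0"
  shows "trivial_kernel (insert i I) (insert r0 Y) M"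
  unfolding trivial_kernel_def
proof (intro allI impI)
  fix c assume c: "\<forall>r\<in>insert r0 Y. (\<Sum>j\<in>insert i I. c j * M r j) = 0"
  have s: "(\<Sum>j\<in>I. c j * M r j) = - (c i * M r i)" if "r \<in> insert r0 Y" for r
  proof -
    have "(\<Sum>j\<in>insert i I. c j * M r j) = 0" using c that by blast
    then show ?thesis using i by (simp add: eq_neg_iff_add_eq_0 add.commute)
  qed
  have z: "c j = 0" if "j \<in> I" for j
    by (rule trivial_kernelD[OF t _ that]) (simp add: sum_eliminate s)
  then have "c i * M r0 i = 0" using c i by auto
  then show "\<forall>j\<in>insert i I. c j = 0" using z r0 by simp
qed

lemma trivial_kernel_pivot:
  assumes "trivial_kernel (insert i I) R M" "i \<notin> I" "finite I"
  obtains r0 where "r0 \<in> R" "M r0 i \<noteq> 0"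
proof (rule ccontr)
  assume nt: "\<not> thesis"
  have z: "M r i = 0" if r: "r \<in> R" for r using nt \<open>\<And>r0. r0 \<in> R \<Longrightarrow> M r0 i \<noteq> 0 \<Longrightarrow> thesis\<close> r by blast
  \<comment> \<open>Column \<open>i\<close> is zero, so the unit vector at \<open>i\<close> lies in
    the kernel.\<close>
  have "(\<lambda>j. of_bool (j = i)) i = (0 :: 'c)"
    by (rule trivial_kernelD[OF assms(1)]) (use assms z in \<open>auto intro!: sum.neutral\<close>)
  then show False by simp
qed

lemma trivial_kernel_card_le:
  assumes "finite I" "finite R" "trivial_kernel I R M"
  shows "card I \<le> card R"
  using assms
proof (induction I arbitrary: R M rule: finite_induct)
  case (insert i I)
  obtain r0 where r0: "r0 \<in> R" "M r0 i \<noteq> 0"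
    by (rule trivial_kernel_pivot[OF insert.prems(2) insert.hyps(2,1)])
  have eliminate_row_0: "(\<Sum>j\<in>I. c j * eliminate r0 i M r0 j) = 0" for c by (simp add: eliminate_def)
  have "trivial_kernel I R (eliminate r0 i M)" by (rule trivial_kernel_eliminate) (use insert r0 in auto)
  then have "trivial_kernel I (R - {r0}) (eliminate r0 i M)"
    unfolding trivial_kernel_def by (metis eliminate_row_0 insert_Diff insert_iff r0(1))
  then have "card I \<le> card (R - {r0})" by (rule insert.IH[rotated]) (use insert in auto)
  then show ?case using r0 insert card_Suc_Diff1[of R r0] by simp
qed simp

text \<open>Gaussian elimination without division, performed on matrices of polynomials: a pivot that is
  nonzero at \<open>e0\<close> stays nonzero outside finitely many values of the parameter.\<close>

lemma trivial_kernel_generic: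
  fixes M :: "'r \<Rightarrow> 'i \<Rightarrow> 'k::field poly"
  assumes "finite I" "trivial_kernel I R (\<lambda>r i. poly (M r i) e0)"
  shows "\<exists>Y\<subseteq>R. \<exists>p. finite Y \<and> card Y \<le> card I \<and> p \<noteq> 0 \<and>
    (\<forall>e. poly p e \<noteq> 0 \<longrightarrow> trivial_kernel I Y (\<lambda>r i. poly (M r i) e))"
  using assms
proof (induction I arbitrary: M rule: finite_induct)
  case empty
  show ?case by (intro exI[of _ "{}"] conjI exI[of _ 1]) (auto simp: trivial_kernel_def)
next
  case (insert i I)
  obtain r0 where r0: "r0 \<in> R" "poly (M r0 i) e0 \<noteq> 0"
    by (rule trivial_kernel_pivot[OF insert.prems(1) insert.hyps(2,1)])
  have ev: "(\<lambda>r j. poly (eliminate r0 i M r j) e) = eliminate r0 i (\<lambda>r j. poly (M r j) e)" for e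
    by (simp add: fun_eq_iff eliminate_def)
  have "trivial_kernel I R (\<lambda>r j. poly (eliminate r0 i M r j) e0)"
    unfolding ev by (rule trivial_kernel_eliminate) (use insert r0 in auto)
  then obtain Y p where Y: "Y \<subseteq> R" "finite Y" "card Y \<le> card I" "p \<noteq> 0"
    "\<And>e. poly p e \<noteq> 0 \<Longrightarrow> trivial_kernel I Y (\<lambda>r j. poly (eliminate r0 i M r j) e)"
    using insert.IH by blast
  have "trivial_kernel (insert i I) (insert r0 Y) (\<lambda>r j. poly (M r j) e)" if "poly (p * M r0 i) e \<noteq> 0" for e
  proof (rule trivial_kernel_uneliminate[OF _ insert.hyps(2,1)])
    show "trivial_kernel I Y (eliminate r0 i (\<lambda>r j. poly (M r j) e))" using Y(5)[of e] that by (simp add: ev)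
    show "poly (M r0 i) e \<noteq> 0" using that by simp
  qed
  moreover have "p * M r0 i \<noteq> 0" using Y(4) r0 by auto
  moreover have "card (insert r0 Y) \<le> card (insert i I)"
    using Y(2,3) insert by (simp add: card_insert_if)
  ultimately show ?case
    using r0 Y by (intro exI[of _ "insert r0 Y"] conjI exI[of _ "p * M r0 i"]) auto
qed

lemma poly_nonroot:
  fixes p :: "'k::field_char_0 poly"
  assumes "p \<noteq> 0"
  obtains e where "poly p e \<noteq> 0"
proof -
  have "finite {x. poly p x = 0}" using assms by (rule poly_roots_finite)
  then obtain e where "e \<notin> {x. poly p x = 0}"
    using ex_new_if_finite[OF infinite_UNIV_char_0] by blast
  then show thesis using that by blast
qed

section \<open>Linear systems depending on the parameter\<close>

text \<open>The value 0 outside \<open>A\<close> selects one representative for each tuple; the set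
  becomes finite, and homogeneous functions depending on \<open>A\<close> become vectors.\<close>

definition exponents :: "nat set \<Rightarrow> nat \<Rightarrow> (nat \<Rightarrow> nat) set" where
  "exponents A k = {\<beta>. (\<forall>i. i \<notin> A \<longrightarrow> \<beta> i = 0) \<and> sum \<beta> A = k}"

lemma finite_exponents:
  assumes "finite A"
  shows "finite (exponents A k)"
proof (rule finite_subset)
  show "exponents A k \<subseteq> {f. \<forall>x. (x \<in> A \<longrightarrow> f x \<in> {..k}) \<and> (x \<notin> A \<longrightarrow> f x = 0)}"
    using member_le_sum[of _ A] assms by (auto simp: exponents_def)
  show "finite {f. \<forall>x. (x \<in> A \<longrightarrow> f x \<in> {..k}) \<and> (x \<notin> A \<longrightarrow> f x = 0)}"
    using assms by (intro finite_set_of_finite_funs) auto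
qed

definition restrict0 :: "nat set \<Rightarrow> (nat \<Rightarrow> nat) \<Rightarrow> nat \<Rightarrow> nat" where
  "restrict0 A \<alpha> i = (if i \<in> A then \<alpha> i else 0)"

lemma invariants_eq_0:
  assumes c: "depends_on A c" "homogeneous A k c" and z: "\<And>\<beta>. \<beta> \<in> exponents A k \<Longrightarrow> c \<beta> = 0"
  shows "c = 0"
proof
  fix \<alpha>
  have eq: "c \<alpha> = c (restrict0 A \<alpha>)" by (rule depends_onD[OF c(1)]) (simp add: restrict0_def)
  show "c \<alpha> = 0 \<alpha>"
  proof (cases "sum \<alpha> A = k")
    case True
    then have "restrict0 A \<alpha> \<in> exponents A k" by (simp add: exponents_def restrict0_def)
    then show ?thesis using z eq by simp
  next
    case False
    then show ?thesis using c(2) by (auto simp: homogeneous_def)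
  qed
qed

text \<open>One row of the matrix of the conditions \<open>contraction e A r c \<alpha> = 0\<close>
  in the unknowns \<open>c \<beta>\<close>, with entries that are polynomials in
  \<open>e\<close>.\<close>

definition contraction_row :: "nat set \<Rightarrow> nat \<Rightarrow> (nat \<Rightarrow> nat) \<Rightarrow> (nat \<Rightarrow> nat) \<Rightarrow> 'k::field poly" where
  "contraction_row A r \<alpha> \<beta> = (\<Sum>i\<in>A. if \<alpha>(i := \<alpha> i + r) = \<beta> then [:of_nat (Suc r), of_nat (\<alpha> i):] else 0)"

lemma contraction_row:
  fixes e :: "'k::field"
  assumes A: "finite A" and c: "homogeneous A k c" and \<alpha>: "\<And>i. i \<notin> A \<Longrightarrow> \<alpha> i = 0"
  shows "(\<Sum>\<beta>\<in>exponents A k. c \<beta> * poly (contraction_row A r \<alpha> \<beta>) e) = contraction e A r c \<alpha>"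
proof -
  let ?X = "exponents A k"
  let ?u = "\<lambda>i. e * of_nat (\<alpha> i) + of_nat (Suc r)"
  let ?\<alpha> = "\<lambda>i. \<alpha>(i := \<alpha> i + r)"
  have "(\<Sum>\<beta>\<in>?X. c \<beta> * poly (contraction_row A r \<alpha> \<beta>) e) = (\<Sum>\<beta>\<in>?X. \<Sum>i\<in>A. if ?\<alpha> i = \<beta> then ?u i * c \<beta> else 0)"
    unfolding contraction_row_def poly_sum sum_distrib_left
    by (intro sum.cong refl) (auto simp: algebra_simps)
  also have "\<dots> = (\<Sum>i\<in>A. \<Sum>\<beta>\<in>?X. if ?\<alpha> i = \<beta> then ?u i * c \<beta> else 0)" by (rule sum.swap)
  also have "\<dots> = (\<Sum>i\<in>A. ?u i * c (?\<alpha> i))"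
  proof (rule sum.cong[OF refl])
    fix i assume i: "i \<in> A"
    have "c (?\<alpha> i) = 0" if "?\<alpha> i \<notin> ?X"
    proof -
      have "sum (?\<alpha> i) A \<noteq> k" using that \<alpha> i by (auto simp: exponents_def split: if_splits)
      then show ?thesis using c unfolding homogeneous_def by blast
    qed
    then show "(\<Sum>\<beta>\<in>?X. if ?\<alpha> i = \<beta> then ?u i * c \<beta> else 0) = ?u i * c (?\<alpha> i)"
      using sum.delta'[OF finite_exponents[OF A], where a = "?\<alpha> i" and b = "\<lambda>\<beta>. ?u i * c \<beta>"] by auto
  qed
  finally show ?thesis by (simp add: contraction_def)
qed

lemma tree_symbol_poly: "\<exists>p. \<forall>e::'k::field. tree_symbol e T \<alpha> = poly p e"
proof (induction T arbitrary: \<alpha>)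
  case (Leaf i)
  show ?case by (intro exI[of _ "[:of_bool (\<alpha> i = 0):]"]) simp
next
  case (Br T U)
  obtain P where P: "\<And>e::'k. \<And>\<alpha>. tree_symbol e T \<alpha> = poly (P \<alpha>) e" using Br.IH(1) by metis
  obtain Q where Q: "\<And>e::'k. \<And>\<alpha>. tree_symbol e U \<alpha> = poly (Q \<alpha>) e" using Br.IH(2) by metis
  define w :: "nat \<Rightarrow> 'k poly" where "w m = [:of_nat m, of_nat (m - 1):]" for m
  have w: "weight e m = poly (w m) e" for e m by (simp add: w_def weight_def)
  define mt where "mt J R = (\<Sum>i\<in>J. [:of_nat (\<alpha> i):] * R (\<alpha>(i := \<alpha> i - 1)))" for J and R :: "_ \<Rightarrow> 'k poly"
  have mt: "mult_t J (\<lambda>\<alpha>. poly (R \<alpha>) e) \<alpha> = poly (mt J R) e" for J R e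
    by (simp add: mult_t_def mt_def poly_sum)
  let ?I = "set (leaves T)" and ?J = "set (leaves U)"
  have fe: "tree_symbol e T = (\<lambda>\<alpha>. poly (P \<alpha>) e)" "tree_symbol e U = (\<lambda>\<alpha>. poly (Q \<alpha>) e)" for e
    by (simp_all add: fun_eq_iff P Q)
  show ?case
    by (intro exI[of _ "w (card ?I) * P \<alpha> * mt ?J Q - w (card ?J) * mt ?I P * Q \<alpha>"])
       (simp add: bracket_def w mt fe)
qed

text \<open>Trees independent at \<open>e1\<close> stay independent for all but finitely many
  parameters. Likewise, coefficients \<open>Y\<close> that determine the natural operations at
  \<open>e2\<close> determine them for all but finitely many parameters. At a common good value the
  trees are independent natural operations, hence still independent after evaluation at
  \<open>Y\<close>.\<close>

lemma semicontinuity: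
  fixes e1 e2 :: "'k::field_char_0"
  assumes A: "finite A" and Ts: "finite Ts" "Ts \<subseteq> trees A" "trivial_kernel Ts UNIV (\<lambda>\<alpha> T. tree_symbol e1 T \<alpha>)"
    and Y: "finite Y" "Y \<subseteq> exponents A (card A - 1)"
    and inj: "\<And>c. c \<in> invariants e2 A (card A - 1) \<Longrightarrow> (\<And>y. y \<in> Y \<Longrightarrow> c y = 0) \<Longrightarrow> c = 0"
  shows "card Ts \<le> card Y"
proof -
  let ?k = "card A - 1"
  let ?X = "exponents A ?k"
  have X: "finite ?X" by (rule finite_exponents[OF A])
  define P :: "(nat \<Rightarrow> nat) \<Rightarrow> tree \<Rightarrow> 'k poly" where "P \<alpha> T = (SOME p. \<forall>e. tree_symbol e T \<alpha> = poly p e)" for \<alpha> T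
  have P: "tree_symbol e T \<alpha> = poly (P \<alpha> T) e" for \<alpha> T e
    unfolding P_def using someI_ex[OF tree_symbol_poly[of T \<alpha>]] by blast
  have "trivial_kernel Ts UNIV (\<lambda>\<alpha> T. poly (P \<alpha> T) e1)" using Ts(3) by (simp only: P)
  from trivial_kernel_generic[OF Ts(1) this] obtain Z p1
    where p1: "p1 \<noteq> 0" "\<And>e. poly p1 e \<noteq> 0 \<Longrightarrow> trivial_kernel Ts Z (\<lambda>\<alpha> T. poly (P \<alpha> T) e)"
    by blast
  \<comment> \<open>The rows are the conditions of naturality together with the evaluations at
    \<open>Y\<close>: a kernel vector is a natural operation that vanishes on
    \<open>Y\<close>.\<close>
  define R :: "(nat \<times> (nat \<Rightarrow> nat) + (nat \<Rightarrow> nat)) set" where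
    "R = Inl ` {(r, \<alpha>). r \<ge> 1 \<and> (\<forall>i. i \<notin> A \<longrightarrow> \<alpha> i = 0)} \<union> Inr ` Y"
  define M :: "(nat \<times> (nat \<Rightarrow> nat) + (nat \<Rightarrow> nat)) \<Rightarrow> (nat \<Rightarrow> nat) \<Rightarrow> 'k poly" where
    "M \<rho> \<beta> = (case \<rho> of Inl (r, \<alpha>) \<Rightarrow> contraction_row A r \<alpha> \<beta> | Inr y \<Rightarrow> of_bool (\<beta> = y))" for \<rho> \<beta>
  have MY: "(\<Sum>\<beta>\<in>?X. c \<beta> * poly (M (Inr y) \<beta>) e) = c y" if "y \<in> Y" for c y e
  proof -
    have "c \<beta> * poly (M (Inr y) \<beta>) e = (if \<beta> = y then c y else 0)" for \<beta>
      by (simp add: M_def of_bool_def)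
    then show ?thesis using X Y that by auto
  qed
  have "trivial_kernel ?X R (\<lambda>\<rho> \<beta>. poly (M \<rho> \<beta>) e2)"
    unfolding trivial_kernel_def
  proof (intro allI impI ballI)
    fix c \<beta> assume c: "\<forall>\<rho>\<in>R. (\<Sum>\<beta>\<in>?X. c \<beta> * poly (M \<rho> \<beta>) e2) = 0" and \<beta>: "\<beta> \<in> ?X"
    \<comment> \<open>Extends a vector indexed by the finite set \<open>?X\<close> to a function of
      all exponents, as \<open>invariants\<close> requires.\<close>
    define c' where "c' \<alpha> = (if sum \<alpha> A = ?k then c (restrict0 A \<alpha>) else 0)" for \<alpha>
    have c'X: "c' \<beta> = c \<beta>" if "\<beta> \<in> ?X" for \<beta>
    proof -
      have "restrict0 A \<beta> = \<beta>" "sum \<beta> A = ?k" using that by (auto simp: fun_eq_iff restrict0_def exponents_def)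
      then show ?thesis by (simp add: c'_def)
    qed
    have d: "depends_on A c'"
      unfolding depends_on_def
    proof (intro allI impI)
      fix \<alpha> \<beta> :: "nat \<Rightarrow> nat" assume *: "\<forall>i\<in>A. \<alpha> i = \<beta> i"
      then have "restrict0 A \<alpha> = restrict0 A \<beta>" "sum \<alpha> A = sum \<beta> A" by (auto simp: restrict0_def fun_eq_iff)
      then show "c' \<alpha> = c' \<beta>" by (simp add: c'_def)
    qed
    have h: "homogeneous A ?k c'" by (auto simp: homogeneous_def c'_def)
    have "contraction e2 A r c' \<alpha> = 0" if r: "r \<ge> 1" for r \<alpha>
    proof -
      have "contraction e2 A r c' \<alpha> = contraction e2 A r c' (restrict0 A \<alpha>)"
        unfolding contraction_def
      proof (rule sum.cong[OF refl])
        fix i assume i: "i \<in> A"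
        have "c' (\<alpha>(i := \<alpha> i + r)) = c' ((restrict0 A \<alpha>)(i := \<alpha> i + r))"
          by (rule depends_onD[OF d]) (auto simp: restrict0_def)
        then show "(e2 * of_nat (\<alpha> i) + of_nat (Suc r)) * c' (\<alpha>(i := \<alpha> i + r)) =
          (e2 * of_nat (restrict0 A \<alpha> i) + of_nat (Suc r)) * c' ((restrict0 A \<alpha>)(i := restrict0 A \<alpha> i + r))"
          using i by (simp add: restrict0_def)
      qed
      also have "\<dots> = (\<Sum>\<beta>\<in>?X. c' \<beta> * poly (contraction_row A r (restrict0 A \<alpha>) \<beta>) e2)"
        by (rule contraction_row[OF A h, symmetric]) (simp add: restrict0_def)
      also have "\<dots> = (\<Sum>\<beta>\<in>?X. c \<beta> * poly (M (Inl (r, restrict0 A \<alpha>)) \<beta>) e2)"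
        by (intro sum.cong refl) (simp add: c'X M_def)
      also have "\<dots> = 0"
        by (rule c[rule_format]) (use r in \<open>auto simp: R_def restrict0_def\<close>)
      finally show ?thesis .
    qed
    then have "c' \<in> invariants e2 A ?k" using d h by (simp add: invariants_def)
    moreover have "c' y = 0" if "y \<in> Y" for y
      using c[rule_format, of "Inr y"] that c'X[of y] Y MY[OF that] by (auto simp: R_def)
    ultimately have "c' = 0" by (rule inj)
    then show "c \<beta> = 0" using c'X[OF \<beta>] by simp
  qed
  from trivial_kernel_generic[OF X this] obtain Z' p2
    where p2: "Z' \<subseteq> R" "p2 \<noteq> 0" "\<And>e. poly p2 e \<noteq> 0 \<Longrightarrow> trivial_kernel ?X Z' (\<lambda>\<rho> \<beta>. poly (M \<rho> \<beta>) e)"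
    by blast
  \<comment> \<open>A value where the product is nonzero avoids both exceptional sets.\<close>
  have "p1 * p2 \<noteq> 0" using p1 p2 by simp
  then obtain e where "poly (p1 * p2) e \<noteq> 0" by (rule poly_nonroot)
  then have e1: "trivial_kernel Ts UNIV (\<lambda>\<alpha> T. tree_symbol e T \<alpha>)" and e2: "trivial_kernel ?X R (\<lambda>\<rho> \<beta>. poly (M \<rho> \<beta>) e)"
    using trivial_kernel_mono[OF p1(2), of e UNIV] trivial_kernel_mono[OF p2(3) p2(1), of e] by (simp_all add: P[abs_def])
  have "trivial_kernel Ts Y (\<lambda>y T. tree_symbol e T y)"
    unfolding trivial_kernel_def
  proof (intro allI impI ballI)
    fix x T assume x: "\<forall>y\<in>Y. (\<Sum>T\<in>Ts. x T * tree_symbol e T y) = 0" and T: "T \<in> Ts"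
    define c where "c = (\<Sum>T\<in>Ts. fscale (x T) (tree_symbol e T))"
    have ap: "(\<Sum>T\<in>Z. fscale (x T) (tree_symbol e T)) \<alpha> = (\<Sum>T\<in>Z. x T * tree_symbol e T \<alpha>)" for Z \<alpha>
      by (induction Z rule: infinite_finite_induct) (simp_all add: fscale_def)
    have c: "c \<in> invariants e A ?k"
      unfolding c_def using Ts(2) by (intro fs.subspace_sum fs.subspace_scale invariants_subspace tree_symbol_invariants) auto
    then have d: "depends_on A c" "homogeneous A ?k c" by (auto simp: invariants_def)
    have "c \<beta> = 0" if "\<beta> \<in> ?X" for \<beta>
    proof (rule trivial_kernelD[OF e2 _ that])
      fix \<rho> assume "\<rho> \<in> R"
      then consider r \<alpha> where "\<rho> = Inl (r, \<alpha>)" "r \<ge> 1" "\<And>i. i \<notin> A \<Longrightarrow> \<alpha> i = 0" | y where "\<rho> = Inr y" "y \<in> Y"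
        by (auto simp: R_def)
      then show "(\<Sum>\<beta>\<in>?X. c \<beta> * poly (M \<rho> \<beta>) e) = 0"
      proof cases
        case 1
        then show ?thesis using contraction_row[OF A d(2) 1(3), where r = r and e = e] c by (simp add: M_def invariants_def)
      next
        case 2
        then show ?thesis using MY[OF 2(2), of c e] x by (simp add: c_def ap)
      qed
    qed
    then have "c = 0" by (rule invariants_eq_0[OF d])
    then have "(\<Sum>T\<in>Ts. x T * tree_symbol e T \<alpha>) = 0" for \<alpha>
      unfolding ap[symmetric] c_def[symmetric] by simp
    then show "x T = 0" by (intro trivial_kernelD[OF e1 _ T]) auto
  qed
  then show ?thesis by (rule trivial_kernel_card_le[OF Ts(1) Y(1)])
qed

section \<open>Harmonic polynomials\<close>

definition geo :: "'a::comm_ring_1 \<Rightarrow> 'a fps" where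
  "geo t = Abs_fps (\<lambda>j. t ^ j)"

lemma geo_inverse: "(1 - fps_const t * fps_X) * geo t = 1"
proof (rule fps_ext)
  fix j
  show "fps_nth ((1 - fps_const t * fps_X) * geo t) j = fps_nth 1 j"
    by (cases j) (simp_all add: geo_def left_diff_distrib mult.assoc)
qed

lemma fps_deriv_geo: "fps_deriv (geo t) = fps_const t * geo t * geo t"
proof (rule fps_ext)
  fix j
  have "fps_nth (geo t * geo t) j = of_nat (Suc j) * t ^ j"
    by (simp add: fps_mult_nth geo_def flip: power_add)
  then show "fps_nth (fps_deriv (geo t)) j = fps_nth (fps_const t * geo t * geo t) j"
    by (simp add: mult.assoc geo_def del: of_nat_Suc)
qed

text \<open>The logarithmic derivative; its coefficients are Newton's identities between complete
  symmetric polynomials and power sums.\<close>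

lemma fps_deriv_prod_geo:
  assumes "finite B"
  shows "fps_deriv (\<Prod>i\<in>B. geo (t i)) = (\<Prod>i\<in>B. geo (t i)) * (\<Sum>i\<in>B. fps_const (t i) * geo (t i))"
  using assms by (induction B) (simp_all add: fps_deriv_geo algebra_simps)

text \<open>
  The coefficients of \<open>\<Prod>i\<in>B. 1 / (1 - t\<^sub>i z)\<close> are the complete symmetric polynomials. Those of \<open>A\<close> lie in the
  ideal by Newton's identities, and each removal of a variable costs one degree.
\<close>

lemma power_in_power_sum_ideal:
  fixes t :: "'i \<Rightarrow> 'a::comm_ring_1"
  assumes A: "finite A" and x: "x \<in> A" and m: "m \<ge> card A"
    and J: "0 \<in> J" "\<And>a b. a \<in> J \<Longrightarrow> b \<in> J \<Longrightarrow> a + b \<in> J" "\<And>a b. b \<in> J \<Longrightarrow> a * b \<in> J"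
      "\<And>k a. of_nat (Suc k) * a \<in> J \<Longrightarrow> a \<in> J"
    and p: "\<And>r. r \<ge> 1 \<Longrightarrow> (\<Sum>i\<in>A. t i ^ r) \<in> J"
  shows "t x ^ m \<in> J"
proof -
  define G where "G B = (\<Prod>i\<in>B. geo (t i))" for B
  have Jsum: "(\<Sum>i\<in>I. f i) \<in> J" if "\<And>i. i \<in> I \<Longrightarrow> f i \<in> J" for I :: "nat set" and f
    using that by (induction I rule: infinite_finite_induct) (auto intro: J)
  have GA: "fps_nth (G A) (Suc m) \<in> J" for m
  proof (rule J(4)[of m])
    have "of_nat (Suc m) * fps_nth (G A) (Suc m) = fps_nth (fps_deriv (G A)) m"
      by (simp only: fps_deriv_nth Suc_eq_plus1)
    also have "\<dots> = (\<Sum>j=0..m. fps_nth (G A) j * (\<Sum>i\<in>A. t i ^ Suc (m - j)))"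
      unfolding G_def fps_deriv_prod_geo[OF A] fps_mult_nth[of _ _ m]
      by (simp add: fps_sum_nth geo_def)
    also have "\<dots> \<in> J" by (intro Jsum J(3) p) simp
    finally show "of_nat (Suc m) * fps_nth (G A) (Suc m) \<in> J" .
  qed
  have GB: "fps_nth (G (A - B)) m \<in> J" if "finite B" "B \<subseteq> A" "m > card B" for B m
    using that
  proof (induction B arbitrary: m rule: finite_induct)
    case empty
    then show ?case using GA[of "m - 1"] by simp
  next
    case (insert i B)
    obtain m' where m': "m = Suc m'" "m' > card B" using insert by (cases m) auto
    have "A - B = insert i (A - insert i B)" using insert by auto
    moreover have "finite (A - insert i B)" "i \<notin> A - insert i B" using A by auto
    ultimately have G: "G (A - B) = geo (t i) * G (A - insert i B)"
      unfolding G_def by (metis prod.insert)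
    \<comment> \<open>The factor cancels the geometric series of \<open>i\<close>. In degree
      \<open>m\<close>, removing \<open>t i\<close> thus costs the two consecutive degrees
      \<open>m\<close> and \<open>m'\<close>.\<close>
    have "(1 - fps_const (t i) * fps_X) * G (A - B) = G (A - insert i B)"
      unfolding G mult.assoc[symmetric] geo_inverse by (rule mult_1_left)
    moreover have "fps_nth ((1 - fps_const (t i) * fps_X) * G (A - B)) m =
        fps_nth (G (A - B)) m + (- t i) * fps_nth (G (A - B)) m'"
      by (simp add: m' left_diff_distrib mult.assoc)
    ultimately have "fps_nth (G (A - insert i B)) m = fps_nth (G (A - B)) m + (- t i) * fps_nth (G (A - B)) m'"
      by simp
    moreover have "fps_nth (G (A - B)) m \<in> J" "fps_nth (G (A - B)) m' \<in> J"
      using insert m' by auto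
    ultimately show ?case by (simp only: J(2,3))
  qed
  \<comment> \<open>With only \<open>x\<close> left, the complete symmetric polynomial of degree
    \<open>m\<close> is \<open>t x ^ m\<close>.\<close>
  have "A - (A - {x}) = {x}" using x by auto
  moreover have "m > card (A - {x})" using A x m by (metis card_Diff1_less less_le_trans)
  ultimately have "fps_nth (G {x}) m \<in> J" using GB[of "A - {x}" m] A by auto
  then show ?thesis by (simp add: G_def geo_def)
qed

section \<open>Differential operators with constant coefficients\<close>

text \<open>Because of the factorials in the encoding, \<open>t\<^sub>i\<close> acts as the partial
  derivative by a shift of exponent \<open>i\<close>. For \<open>e = 0\<close> contraction
  \<open>r\<close> is \<open>r + 1\<close> times the action of the power sum of degree
  \<open>r\<close>.\<close>

definition shift_act :: "'k::field tpoly \<Rightarrow> 'k cfun \<Rightarrow> 'k cfun" where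
  "shift_act P c \<alpha> = (\<Sum>\<mu>\<in>Poly_Mapping.keys P. Poly_Mapping.lookup P \<mu> * c (\<lambda>i. \<alpha> i + Poly_Mapping.lookup \<mu> i))"

lemma shift_act_superset:
  assumes "finite B" "Poly_Mapping.keys P \<subseteq> B"
  shows "shift_act P c \<alpha> = (\<Sum>\<mu>\<in>B. Poly_Mapping.lookup P \<mu> * c (\<lambda>i. \<alpha> i + Poly_Mapping.lookup \<mu> i))"
  unfolding shift_act_def by (rule sum.mono_neutral_left) (use assms in \<open>auto simp: in_keys_iff\<close>)

lemma shift_act_0 [simp]: "shift_act 0 c = (\<lambda>_. 0)" "shift_act P (\<lambda>_. 0) = (\<lambda>_. 0)"
  by (simp_all add: shift_act_def fun_eq_iff)

lemma shift_act_add: "shift_act (P + Q) c \<alpha> = shift_act P c \<alpha> + shift_act Q c \<alpha>"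
proof -
  let ?B = "Poly_Mapping.keys P \<union> Poly_Mapping.keys Q"
  have "shift_act R c \<alpha> = (\<Sum>\<mu>\<in>?B. Poly_Mapping.lookup R \<mu> * c (\<lambda>i. \<alpha> i + Poly_Mapping.lookup \<mu> i))"
    if "Poly_Mapping.keys R \<subseteq> ?B" for R using that by (intro shift_act_superset) auto
  then show ?thesis
    using Poly_Mapping.keys_add[of P Q] by (simp add: lookup_add distrib_right sum.distrib)
qed

lemma shift_act_add_right: "shift_act P (\<lambda>\<alpha>. c \<alpha> + d \<alpha>) \<alpha> = shift_act P c \<alpha> + shift_act P d \<alpha>"
  by (simp add: shift_act_def distrib_left sum.distrib)

lemma shift_act_single: "shift_act (Poly_Mapping.single \<mu> a) c \<alpha> = a * c (\<lambda>i. \<alpha> i + Poly_Mapping.lookup \<mu> i)"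
  by (subst shift_act_superset[of "{\<mu>}"]) auto

lemma shift_act_mult: "shift_act (P * Q) c = shift_act P (shift_act Q c)"
proof (induction P rule: poly_mapping_linear_induct)
  case zero
  show ?case by simp
next
  case (add p q)
  then show ?case by (simp add: fun_eq_iff distrib_right shift_act_add)
next
  case (single \<mu> a)
  show ?case
  proof (induction Q rule: poly_mapping_linear_induct)
    case zero
    show ?case by simp
  next
    case (add p q)
    then show ?case by (simp add: fun_eq_iff distrib_left shift_act_add shift_act_add_right[symmetric])
  next
    case (single \<nu> b)
    show ?case by (simp add: fun_eq_iff mult_single shift_act_single lookup_add add.assoc)
  qed
qed

lemma shift_act_sum: "shift_act (\<Sum>i\<in>I. f i) c \<alpha> = (\<Sum>i\<in>I. shift_act (f i) c \<alpha>)"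
  by (induction I rule: infinite_finite_induct) (simp_all add: shift_act_add)

lemma shift_act_tvar_power: "shift_act (tvar i ^ r) c \<alpha> = c (\<alpha>(i := \<alpha> i + r))"
proof -
  have "(\<lambda>j. \<alpha> j + Poly_Mapping.lookup (Poly_Mapping.single i r) j) = \<alpha>(i := \<alpha> i + r)"
    by (auto simp: fun_eq_iff lookup_single when_def)
  then show ?thesis by (simp add: tvar_power shift_act_single)
qed

lemma shift_act_of_nat: "shift_act (of_nat k * P) c \<alpha> = of_nat k * shift_act P c \<alpha>"
  by (induction k) (simp_all add: distrib_right shift_act_add)

text \<open>The polynomials that annihilate \<open>c\<close> form an ideal with the power sums in
  it, so it contains every power of \<open>tvar x\<close> from exponent \<open>card A\<close> on.
  The value \<open>c \<alpha>\<close> is what \<open>tvar x ^ \<alpha> x\<close> makes of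
  \<open>c\<close> at the exponent with \<open>x\<close> reset to 0.\<close>

lemma invariants_0_order:
  fixes c :: "'k::field_char_0 cfun"
  assumes c: "c \<in> invariants 0 A k" and A: "finite A" "x \<in> A" and \<alpha>: "\<alpha> x \<ge> card A"
  shows "c \<alpha> = 0"
proof -
  define J where "J = {P. shift_act P c = (\<lambda>_. 0)}"
  have "tvar x ^ (\<alpha> x) \<in> J"
  proof (rule power_in_power_sum_ideal[OF A \<alpha>])
    fix r :: nat assume r: "r \<ge> 1"
    have "of_nat (Suc r) * shift_act (\<Sum>i\<in>A. tvar i ^ r) c \<beta> = contraction 0 A r c \<beta>" for \<beta>
      by (simp add: shift_act_sum shift_act_tvar_power contraction_def sum_distrib_left)
    then have "of_nat (Suc r) * shift_act (\<Sum>i\<in>A. tvar i ^ r) c \<beta> = 0" for \<beta>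
      using c r by (simp add: invariants_def)
    then show "(\<Sum>i\<in>A. tvar i ^ r) \<in> J"
      by (simp add: J_def fun_eq_iff del: of_nat_Suc)
  next
    fix k and a :: "'k tpoly" assume "of_nat (Suc k) * a \<in> J"
    then have "of_nat (Suc k) * shift_act a c \<beta> = 0" for \<beta>
      unfolding J_def using shift_act_of_nat[of "Suc k" a c \<beta>] by simp
    then show "a \<in> J" by (simp add: J_def fun_eq_iff del: of_nat_Suc)
  next
    show "a + b \<in> J" if "a \<in> J" "b \<in> J" for a b
      using that by (simp add: J_def fun_eq_iff shift_act_add)
  qed (simp_all add: J_def shift_act_mult)
  then have "shift_act (tvar x ^ (\<alpha> x)) c (\<alpha>(x := 0)) = 0" by (simp add: J_def)
  then show ?thesis by (simp add: shift_act_tvar_power)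
qed

definition stairs :: "nat \<Rightarrow> nat \<Rightarrow> (nat \<Rightarrow> nat) set" where
  "stairs n k = {\<beta> \<in> exponents {1..n} k. \<forall>i\<in>{1..n}. \<beta> i < i}"

lemma finite_stairs: "finite (stairs n k)"
  by (rule finite_subset[OF _ finite_exponents[of "{1..n}" k]]) (auto simp: stairs_def)

text \<open>Descent on the exponent of the last variable, which \<open>invariants_0_order\<close>
  bounds by the number of the other variables. Each leading coefficient is harmonic in one variable
  fewer and vanishes on the smaller staircase.\<close>

lemma invariants_0_stairs:
  fixes c :: "'k::field_char_0 cfun"
  assumes "c \<in> invariants 0 {1..n} k" "\<And>\<beta>. \<beta> \<in> stairs n k \<Longrightarrow> c \<beta> = 0"
  shows "c = 0"
  using assms
proof (induction n arbitrary: c k)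
  case 0
  show ?case
    by (rule invariants_eq_0[of "{1..0}" c k]) (use 0 in \<open>auto simp: invariants_def stairs_def\<close>)
next
  case (Suc n)
  let ?A = "{1..Suc n}" and ?x = "Suc n"
  have A: "?A = insert ?x {1..n}" by auto
  have "\<forall>\<alpha>. \<alpha> ?x \<ge> Suc n - j \<longrightarrow> c \<alpha> = 0" if "j \<le> Suc n" for j
    using that
  proof (induction j)
    case 0
    show ?case using invariants_0_order[OF Suc.prems(1), of ?x] by auto
  next
    case (Suc j)
    define l where "l = n - j"
    have l: "Suc n - j = Suc l" "Suc n - Suc j = l" "l \<le> n" using Suc.prems by (auto simp: l_def)
    have v: "c \<alpha> = 0" if "\<alpha> ?x > l" for \<alpha> using Suc that by (simp add: l)
    have "c \<alpha> = 0" if \<alpha>: "\<alpha> ?x = l" for \<alpha>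
    proof (cases "l \<le> k")
      case False
      then show ?thesis
        using homogeneous_vanish[of ?A k c ?x \<alpha>] Suc.prems(1) \<open>c \<in> invariants 0 ?A k\<close> \<alpha> by (auto simp: invariants_def)
    next
      case True
      have "(\<lambda>\<alpha>. c (\<alpha>(?x := l))) \<in> invariants 0 {1..n} (k - l)"
        by (rule lead_invariants) (use \<open>c \<in> invariants 0 ?A k\<close> A v True in auto)
      moreover have "c (\<beta>(?x := l)) = 0" if "\<beta> \<in> stairs n (k - l)" for \<beta>
      proof (rule \<open>\<And>\<beta>. \<beta> \<in> stairs (Suc n) k \<Longrightarrow> c \<beta> = 0\<close>)
        have "sum (\<beta>(?x := l)) {1..n} = sum \<beta> {1..n}" by (rule sum.cong) auto
        then have "sum (\<beta>(?x := l)) ?A = k" unfolding A using that True by (simp add: stairs_def exponents_def)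
        then show "\<beta>(?x := l) \<in> stairs (Suc n) k"
          using that l by (auto simp: stairs_def exponents_def)
      qed
      ultimately have "(\<lambda>\<alpha>. c (\<alpha>(?x := l))) = 0"
        by (rule \<open>\<And>k c. c \<in> invariants 0 {1..n} k \<Longrightarrow> (\<And>\<beta>. \<beta> \<in> stairs n k \<Longrightarrow> c \<beta> = 0) \<Longrightarrow> c = 0\<close>)
      then have "c (\<alpha>(?x := l)) = 0" by (metis zero_fun_apply)
      moreover have "\<alpha>(?x := l) = \<alpha>" using \<alpha> by auto
      ultimately show ?thesis by simp
    qed
    then show ?case using v unfolding l by (metis le_neq_implies_less)
  qed
  from this[of "Suc n"] show ?case by (simp add: fun_eq_iff)
qed

text \<open>The Vandermonde determinant and, below, its partial derivatives.\<close>

definition vandermonde :: "nat \<Rightarrow> 'k::field cfun" where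
  "vandermonde n \<gamma> = (\<Sum>\<pi> | \<pi> permutes {1..n}. of_int (sign \<pi>) * of_bool (\<forall>i\<in>{1..n}. Suc (\<gamma> i) = \<pi> i))"

lemma vandermonde_nonzero:
  assumes "vandermonde n \<gamma> \<noteq> 0"
  obtains \<pi> where "\<pi> permutes {1..n}" "\<And>i. i \<in> {1..n} \<Longrightarrow> Suc (\<gamma> i) = \<pi> i"
proof -
  obtain \<pi> where "\<pi> \<in> {\<pi>. \<pi> permutes {1..n}}"
      "of_int (sign \<pi>) * of_bool (\<forall>i\<in>{1..n}. Suc (\<gamma> i) = \<pi> i) \<noteq> (0 :: 'a)"
    using assms unfolding vandermonde_def by (rule sum.not_neutral_contains_not_neutral)
  then show thesis using that[of \<pi>] by (auto split: if_splits)
qed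

text \<open>The factorials of the encoding are the same for all monomials of the determinant;
  \<open>vandermonde\<close> omits this common factor and is alternating in its exponents.\<close>

lemma vandermonde_swap:
  assumes ij: "i \<in> {1..n}" "j \<in> {1..n}" "i \<noteq> j"
  shows "vandermonde n (\<gamma> \<circ> transpose i j) = - vandermonde n \<gamma>"
proof -
  let ?t = "transpose i j" and ?P = "{\<pi>. \<pi> permutes {1..n}}"
  have t: "?t permutes {1..n}" using ij by (intro permutes_swap_id)
  have 1: "(\<forall>l\<in>{1..n}. Suc ((\<gamma> \<circ> ?t) l) = \<pi> l) \<longleftrightarrow> (\<forall>l\<in>{1..n}. Suc (\<gamma> l) = (\<pi> \<circ> ?t) l)" for \<pi>
  proof (intro iffI ballI)
    fix l assume l: "l \<in> {1..n}"
    then have tl: "?t l \<in> {1..n}" by (simp only: permutes_in_image[OF t])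
    show "Suc (\<gamma> l) = (\<pi> \<circ> ?t) l" if H: "\<forall>l\<in>{1..n}. Suc ((\<gamma> \<circ> ?t) l) = \<pi> l"
      using H[rule_format, OF tl] by simp
    show "Suc ((\<gamma> \<circ> ?t) l) = \<pi> l" if H: "\<forall>l\<in>{1..n}. Suc (\<gamma> l) = (\<pi> \<circ> ?t) l"
      using H[rule_format, OF tl] by simp
  qed
  have "vandermonde n (\<gamma> \<circ> ?t) = (\<Sum>\<pi>\<in>?P. of_int (sign \<pi>) * of_bool (\<forall>l\<in>{1..n}. Suc (\<gamma> l) = (\<pi> \<circ> ?t) l) :: 'a)"
    unfolding vandermonde_def 1 ..
  also have "\<dots> = (\<Sum>\<pi>\<in>?P. - (of_int (sign \<pi>) * of_bool (\<forall>l\<in>{1..n}. Suc (\<gamma> l) = \<pi> l)))"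
  proof (rule sum.reindex_bij_witness[where i = "\<lambda>\<pi>. \<pi> \<circ> ?t" and j = "\<lambda>\<pi>. \<pi> \<circ> ?t"])
    fix \<pi> assume p: "\<pi> \<in> ?P"
    show "\<pi> \<circ> ?t \<circ> ?t = \<pi>" "\<pi> \<circ> ?t \<circ> ?t = \<pi>" by (simp_all add: comp_assoc)
    show "\<pi> \<circ> ?t \<in> ?P" "\<pi> \<circ> ?t \<in> ?P" using p permutes_compose[OF t] by auto
    have "sign (\<pi> \<circ> ?t) = - sign \<pi>"
      using p t ij by (subst sign_compose) (auto simp: sign_swap_id intro: permutation_permutes[THEN iffD2] exI[of _ "{1..n}"])
    then show "- (of_int (sign (\<pi> \<circ> ?t)) * of_bool (\<forall>l\<in>{1..n}. Suc (\<gamma> l) = (\<pi> \<circ> ?t) l)) =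
        (of_int (sign \<pi>) * of_bool (\<forall>l\<in>{1..n}. Suc (\<gamma> l) = (\<pi> \<circ> ?t) l) :: 'a)" by simp
  qed
  finally show ?thesis by (simp add: vandermonde_def sum_negf)
qed

lemma vandermonde_coincidence:
  fixes \<gamma> :: "nat \<Rightarrow> nat"
  assumes ij: "i \<in> {1..n}" "j \<in> {1..n}" "i \<noteq> j" "\<gamma> i = \<gamma> j"
  shows "vandermonde n \<gamma> = (0 :: 'k::field_char_0)"
proof -
  have "\<gamma> \<circ> transpose i j = \<gamma>" using ij by (auto simp: fun_eq_iff transpose_def)
  then show ?thesis using vandermonde_swap[OF ij(1-3), of \<gamma>, where ?'a = 'k] by simp
qed

text \<open>If the term at \<open>i\<close> is nonzero, the shifted exponents are all of 0 to n - 1,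
  so the unshifted \<open>\<gamma> i\<close> also occurs at some other \<open>l\<close>. Any third
  term then has equal exponents at \<open>i\<close> and \<open>l\<close> and vanishes, and the terms
  at \<open>i\<close> and \<open>l\<close> differ by a transposition, hence cancel.\<close>

lemma vandermonde_shift:
  fixes \<gamma> :: "nat \<Rightarrow> nat"
  assumes r: "r \<ge> 1"
  shows "(\<Sum>i\<in>{1..n}. vandermonde n (\<gamma>(i := \<gamma> i + r))) = (0 :: 'k::field_char_0)"
proof (cases "\<forall>i\<in>{1..n}. vandermonde n (\<gamma>(i := \<gamma> i + r)) = (0 :: 'k)")
  case False
  then obtain i where i: "i \<in> {1..n}" "vandermonde n (\<gamma>(i := \<gamma> i + r)) \<noteq> (0 :: 'k)" by blast
  then obtain \<pi> where p: "\<pi> permutes {1..n}" "\<And>l. l \<in> {1..n} \<Longrightarrow> Suc ((\<gamma>(i := \<gamma> i + r)) l) = \<pi> l"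
    by (rule_tac vandermonde_nonzero) auto
  have pi: "\<pi> i = Suc (\<gamma> i) + r" using p(2)[OF i(1)] by simp
  have "\<pi> i \<in> {1..n}" using p(1) i(1) by (simp only: permutes_in_image)
  then have "Suc (\<gamma> i) \<in> \<pi> ` {1..n}" using pi permutes_image[OF p(1)] by auto
  then obtain l where l: "l \<in> {1..n}" "\<pi> l = Suc (\<gamma> i)" by auto
  have li: "l \<noteq> i" using l(2) pi r by auto
  then have gl: "\<gamma> l = \<gamma> i" using p(2)[OF l(1)] l(2) by simp
  have z: "vandermonde n (\<gamma>(h := \<gamma> h + r)) = (0 :: 'k)" if "h \<in> {1..n} - {i, l}" for h
    by (rule vandermonde_coincidence[of i n l]) (use i l li gl that in auto)
  have "\<gamma>(l := \<gamma> l + r) = (\<gamma>(i := \<gamma> i + r)) \<circ> transpose i l"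
    using gl li by (auto simp: fun_eq_iff transpose_def)
  then have "vandermonde n (\<gamma>(l := \<gamma> l + r)) = - (vandermonde n (\<gamma>(i := \<gamma> i + r)) :: 'k)"
    by (simp only: vandermonde_swap[OF i(1) l(1) li[symmetric]])
  moreover have "(\<Sum>i\<in>{1..n}. vandermonde n (\<gamma>(i := \<gamma> i + r))) = (\<Sum>i\<in>{i, l}. vandermonde n (\<gamma>(i := \<gamma> i + r)) :: 'k)"
    by (rule sum.mono_neutral_right) (use z i l in auto)
  ultimately show ?thesis using li by simp
qed simp

text \<open>The derivative of order \<open>i - 1 - \<beta> i\<close> in each variable: it lowers the
  diagonal monomial, with exponents \<open>i - 1\<close>, to the exponents \<open>\<beta>\<close>.
  The bound \<open>\<beta> i < i\<close> in \<open>stairs\<close> keeps the subtraction from being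
  truncated.\<close>

definition vandermonde_shift :: "nat \<Rightarrow> (nat \<Rightarrow> nat) \<Rightarrow> 'k::field cfun" where
  "vandermonde_shift n \<beta> \<alpha> = vandermonde n (\<lambda>i. \<alpha> i + (i - 1 - \<beta> i))"

lemma vandermonde_shift_nonzero:
  assumes "\<beta> \<in> stairs n k" "vandermonde_shift n \<beta> \<alpha> \<noteq> 0"
  obtains \<pi> where "\<pi> permutes {1..n}" "\<And>i. i \<in> {1..n} \<Longrightarrow> \<alpha> i + i = \<pi> i + \<beta> i"
proof -
  obtain \<pi> where p: "\<pi> permutes {1..n}" "\<And>i. i \<in> {1..n} \<Longrightarrow> Suc (\<alpha> i + (i - 1 - \<beta> i)) = \<pi> i"
    using assms(2) unfolding vandermonde_shift_def by (rule vandermonde_nonzero) blast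
  have "\<alpha> i + i = \<pi> i + \<beta> i" if "i \<in> {1..n}" for i
  proof -
    have "\<beta> i < i" using assms(1) that by (simp add: stairs_def)
    then show ?thesis using p(2)[OF that] by linarith
  qed
  with p(1) show thesis by (rule that)
qed

text \<open>Constant-coefficient operators commute, so derivatives of a harmonic polynomial are
  harmonic.\<close>

lemma vandermonde_shift_invariants:
  assumes \<beta>: "\<beta> \<in> stairs n k"
  shows "(vandermonde_shift n \<beta> :: 'k::field_char_0 cfun) \<in> invariants 0 {1..n} k"
proof -
  have "depends_on {1..n} (vandermonde_shift n \<beta> :: 'k cfun)"
    unfolding depends_on_def vandermonde_shift_def vandermonde_def by (intro allI impI sum.cong refl) auto
  moreover have "homogeneous {1..n} k (vandermonde_shift n \<beta> :: 'k cfun)"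
    unfolding homogeneous_def
  proof (intro allI impI)
    fix \<alpha> assume "vandermonde_shift n \<beta> \<alpha> \<noteq> (0 :: 'k)"
    then obtain \<pi> where p: "\<pi> permutes {1..n}" "\<And>i. i \<in> {1..n} \<Longrightarrow> \<alpha> i + i = \<pi> i + \<beta> i"
      using vandermonde_shift_nonzero[OF \<beta>] by blast
    have "(\<Sum>i\<in>{1..n}. \<alpha> i + i) = (\<Sum>i\<in>{1..n}. \<pi> i + \<beta> i)" by (rule sum.cong) (use p in auto)
    moreover have "(\<Sum>i\<in>{1..n}. \<pi> i) = (\<Sum>i\<in>{1..n}. i)"
      using sum.permute[OF p(1), of "\<lambda>i. i"] by (simp add: comp_def)
    ultimately show "sum \<alpha> {1..n} = k" using \<beta> by (simp add: sum.distrib stairs_def exponents_def)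
  qed
  moreover have "contraction 0 {1..n} r (vandermonde_shift n \<beta>) \<alpha> = (0 :: 'k)" if r: "r \<ge> 1" for r \<alpha>
  proof -
    let ?\<gamma> = "\<lambda>i. \<alpha> i + (i - 1 - \<beta> i)"
    have "vandermonde_shift n \<beta> (\<alpha>(i := \<alpha> i + r)) = (vandermonde n (?\<gamma>(i := ?\<gamma> i + r)) :: 'k)" for i
    proof -
      have "(\<lambda>l. (\<alpha>(i := \<alpha> i + r)) l + (l - 1 - \<beta> l)) = ?\<gamma>(i := ?\<gamma> i + r)" by auto
      then show ?thesis by (simp only: vandermonde_shift_def)
    qed
    then have "contraction 0 {1..n} r (vandermonde_shift n \<beta>) \<alpha> = of_nat (Suc r) * (\<Sum>i\<in>{1..n}. vandermonde n (?\<gamma>(i := ?\<gamma> i + r)) :: 'k)"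
      by (simp add: contraction_def sum_distrib_left)
    then show ?thesis using vandermonde_shift[OF r, where ?'k = 'k and \<gamma> = ?\<gamma>] by simp
  qed
  ultimately show ?thesis by (simp add: invariants_def)
qed

lemma vandermonde_shift_self:
  assumes "\<beta> \<in> stairs n k"
  shows "vandermonde_shift n \<beta> \<beta> = (1 :: 'k::field)"
proof -
  have "Suc (\<beta> i + (i - 1 - \<beta> i)) = i" if "i \<in> {1..n}" for i
  proof -
    have "\<beta> i < i" using assms that by (simp add: stairs_def)
    then show ?thesis by simp
  qed
  then have "(\<forall>i\<in>{1..n}. Suc (\<beta> i + (i - 1 - \<beta> i)) = \<pi> i) \<longleftrightarrow> (\<forall>i\<in>{1..n}. \<pi> i = i)" for \<pi>
    by force
  moreover have "(\<forall>i\<in>{1..n}. \<pi> i = i) \<longleftrightarrow> \<pi> = id" if "\<pi> permutes {1..n}" for \<pi>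
    using that by (auto simp: fun_eq_iff permutes_def)
  ultimately have "vandermonde_shift n \<beta> \<beta> = (\<Sum>\<pi> | \<pi> permutes {1..n}. if \<pi> = id then 1 else (0 :: 'k))"
    unfolding vandermonde_shift_def vandermonde_def by (intro sum.cong refl) (auto simp: sign_id)
  also have "\<dots> = 1" by (simp add: finite_permutations permutes_id)
  finally show ?thesis .
qed

text \<open>Independence is triangularity for the statistic \<open>\<Sum>i. i * \<beta> i\<close>: by the rearrangement inequality
  every other exponent in the support of \<open>vandermonde_shift n \<beta>\<close> has a smaller value.\<close>

lemma trivial_kernel_vandermonde_shift: "trivial_kernel (stairs n k) UNIV (\<lambda>\<alpha> \<beta>. vandermonde_shift n \<beta> \<alpha> :: 'k::field_char_0)"
  unfolding trivial_kernel_def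
proof (intro allI impI)
  fix x :: "(nat \<Rightarrow> nat) \<Rightarrow> 'k"
  assume x: "\<forall>\<alpha>\<in>UNIV. (\<Sum>\<beta>\<in>stairs n k. x \<beta> * vandermonde_shift n \<beta> \<alpha>) = 0"
  let ?w = "\<lambda>\<beta>. \<Sum>i\<in>{1..n}. i * \<beta> i"
  let ?Z = "{\<beta> \<in> stairs n k. x \<beta> \<noteq> 0}"
  show "\<forall>\<beta>\<in>stairs n k. x \<beta> = 0"
  proof (rule ccontr)
    assume "\<not> (\<forall>\<beta>\<in>stairs n k. x \<beta> = 0)"
    then have "?Z \<noteq> {}" by blast
    moreover have fZ: "finite ?Z" using finite_stairs[of n k] by simp
    ultimately have "Max (?w ` ?Z) \<in> ?w ` ?Z" by (intro Max_in) auto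
    then obtain \<beta> where \<beta>: "\<beta> \<in> ?Z" and w: "?w \<beta> = Max (?w ` ?Z)" by (metis (no_types, lifting) imageE)
    have max: "?w \<beta>' \<le> ?w \<beta>" if "\<beta>' \<in> ?Z" for \<beta>'
      unfolding w using fZ that by (intro Max_ge imageI finite_imageI)
    have z: "x \<beta>' * vandermonde_shift n \<beta>' \<beta> = 0" if b': "\<beta>' \<in> stairs n k" "\<beta>' \<noteq> \<beta>" for \<beta>'
    proof (rule ccontr)
      assume nz: "x \<beta>' * vandermonde_shift n \<beta>' \<beta> \<noteq> 0"
      then have "vandermonde_shift n \<beta>' \<beta> \<noteq> (0 :: 'k)" and Z: "\<beta>' \<in> ?Z" using b' by auto
      then obtain \<pi> where p: "\<pi> permutes {1..n}" "\<And>i. i \<in> {1..n} \<Longrightarrow> \<beta> i + i = \<pi> i + \<beta>' i"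
        using vandermonde_shift_nonzero[OF b'(1)] by blast
      have "(\<Sum>i\<in>{1..n}. i * (\<beta> i + i)) = (\<Sum>i\<in>{1..n}. i * (\<pi> i + \<beta>' i))"
        by (rule sum.cong) (use p in auto)
      then have 1: "(\<Sum>i\<in>{1..n}. i * i) \<le> (\<Sum>i\<in>{1..n}. i * \<pi> i)"
        using max[OF Z] by (simp add: distrib_left sum.distrib)
      have 2: "(\<Sum>i\<in>{1..n}. \<pi> i * \<pi> i) = (\<Sum>i\<in>{1..n}. i * i)"
        using sum.permute[OF p(1), of "\<lambda>i. i * i"] by (simp add: comp_def)
      \<comment> \<open>A sum of squares that \<open>1\<close> and \<open>2\<close> bound by 0; so
        \<open>\<pi>\<close> is the identity on \<open>{1..n}\<close> and \<open>\<beta>'\<close>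
        equals \<open>\<beta>\<close>.\<close>
      have "(\<Sum>i\<in>{1..n}. (int i - int (\<pi> i))\<^sup>2) =
          int (\<Sum>i\<in>{1..n}. i * i) + int (\<Sum>i\<in>{1..n}. \<pi> i * \<pi> i) - 2 * int (\<Sum>i\<in>{1..n}. i * \<pi> i)"
        by (simp add: power2_eq_square algebra_simps sum.distrib sum_subtractf sum_distrib_left)
      also have "\<dots> \<le> 0" using 1 2 by linarith
      finally have "(\<Sum>i\<in>{1..n}. (int i - int (\<pi> i))\<^sup>2) = 0"
        by (meson order_antisym sum_nonneg zero_le_power2)
      then have "\<forall>i\<in>{1..n}. \<pi> i = i" by (subst (asm) sum_nonneg_eq_0_iff) auto
      then have "\<forall>i\<in>{1..n}. \<beta> i = \<beta>' i" using p(2) by force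
      moreover have "\<beta> i = \<beta>' i" if "i \<notin> {1..n}" for i
        using that b'(1) \<beta> by (auto simp: stairs_def exponents_def)
      ultimately have "\<beta>' = \<beta>" by (metis ext)
      then show False using b'(2) by simp
    qed
    have "(\<Sum>\<beta>'\<in>stairs n k. x \<beta>' * vandermonde_shift n \<beta>' \<beta>) = x \<beta> * vandermonde_shift n \<beta> \<beta>"
    proof -
      have "(\<Sum>\<beta>'\<in>stairs n k - {\<beta>}. x \<beta>' * vandermonde_shift n \<beta>' \<beta>) = 0"
        by (rule sum.neutral) (use z in blast)
      then show ?thesis using \<beta> by (subst sum.remove[OF finite_stairs, of \<beta>]) auto
    qed
    then have "x \<beta> = 0" using x \<beta> vandermonde_shift_self[of \<beta> n k, where ?'k = 'k] by simp
    then show False using \<beta> by simp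
  qed
qed

section \<open>The dimension of the space of bracket monomials\<close>

lemma sum_fun_apply: "(\<Sum>i\<in>I. f i) x = (\<Sum>i\<in>I. f i x)"
  by (induction I rule: infinite_finite_induct) auto

lemma independent_trivial_kernel:
  assumes "finite I" "inj_on f I" "fs.independent (f ` I)"
  shows "trivial_kernel I UNIV (\<lambda>x i. f i x)"
  unfolding trivial_kernel_def
proof (intro allI impI ballI)
  fix c i assume c: "\<forall>x\<in>UNIV. (\<Sum>i\<in>I. c i * f i x) = 0" and i: "i \<in> I"
  define u where "u v = c (the_inv_into I f v)" for v
  have u: "u (f i) = c i" if "i \<in> I" for i
    using the_inv_into_f_f[OF assms(2) that] by (simp add: u_def)
  have "(\<Sum>v\<in>f ` I. fscale (u v) v) = (\<Sum>i\<in>I. fscale (c i) (f i))"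
    by (simp add: sum.reindex[OF assms(2)] u)
  also have "\<dots> = 0"
    by (rule ext, unfold sum_fun_apply fscale_def) (use c in simp)
  finally have "u (f i) = 0"
    using fs.independentD[OF assms(3), of "f ` I" u "f i"] assms(1) i by simp
  then show "c i = 0" using u[OF i] by simp
qed

lemma trivial_kernel_independent:
  fixes f :: "'i \<Rightarrow> 'a \<Rightarrow> 'k::field"
  assumes "finite I" "trivial_kernel I UNIV (\<lambda>x i. f i x)"
  shows "inj_on f I" "fs.independent (f ` I)"
proof -
  show inj: "inj_on f I"
  proof (rule inj_onI, rule ccontr)
    fix i j assume ij: "i \<in> I" "j \<in> I" "f i = f j" "i \<noteq> j"
    define c :: "'i \<Rightarrow> 'k" where "c l = of_bool (l = i) - of_bool (l = j)" for l
    have "(\<Sum>l\<in>I. of_bool (l = h) * f l x) = f h x" if "h \<in> I" for h x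
    proof -
      have "(\<Sum>l\<in>I. of_bool (l = h) * f l x) = (\<Sum>l\<in>I. if l = h then f l x else 0)"
        by (rule sum.cong) auto
      then show ?thesis using assms(1) that by simp
    qed
    then have "(\<Sum>l\<in>I. c l * f l x) = f i x - f j x" for x
      unfolding c_def left_diff_distrib sum_subtractf using ij(1,2) by simp
    then have "(\<Sum>l\<in>I. c l * f l x) = 0" for x using ij(3) by simp
    then have "c i = 0" by (rule trivial_kernelD[OF assms(2) _ ij(1)])
    then show False using ij by (simp add: c_def)
  qed
  show "fs.independent (f ` I)"
  proof (rule fs.independent_if_scalars_zero)
    fix u v assume u: "(\<Sum>v\<in>f ` I. fscale (u v) v) = 0" and v: "v \<in> f ` I"
    then obtain i where i: "i \<in> I" "v = f i" by auto
    have "(\<Sum>i\<in>I. fscale (u (f i)) (f i)) = 0" using u unfolding sum.reindex[OF inj] o_def .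
    then have "(\<Sum>i\<in>I. fscale (u (f i)) (f i)) x = 0" for x by simp
    then have "(\<Sum>i\<in>I. u (f i) * f i x) = 0" for x by (simp only: sum_fun_apply) (simp add: fscale_def)
    then have "u (f i) = 0" by (rule trivial_kernelD[OF assms(2) _ i(1), where c = "\<lambda>i. u (f i)"])
    then show "u v = 0" using i by simp
  qed (use assms in simp)
qed

lemma weight_minus_1: "m \<ge> 1 \<Longrightarrow> weight (-1) m = (1 :: 'k::field)"
  by (cases m) (simp_all add: weight_def)

lemma nondeg_minus_1: "nondeg (-1 :: 'k::field_char_0)"
  by (simp add: nondeg_def weight_minus_1 del: One_nat_def)

lemma nondeg_0: "nondeg (0 :: 'k::field_char_0)"
  unfolding nondeg_def weight_def by (auto simp flip: of_nat_add)

lemma invariants_eq_span_trees: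
  fixes e :: "'k::field_char_0"
  assumes "nondeg e" "finite A" "A \<noteq> {}"
  shows "invariants e A (card A - 1) = fs.span (tree_symbol e ` trees A)"
proof
  have "card A = (card A - 1) + 1" using assms card_gt_0_iff[of A] by simp
  then show "invariants e A (card A - 1) \<subseteq> fs.span (tree_symbol e ` trees A)"
    using invariants_span_forests[OF assms(1,2), of "card A - 1" 1] unfolding forests_1 by simp
  show "fs.span (tree_symbol e ` trees A) \<subseteq> invariants e A (card A - 1)"
    using tree_symbol_span_invariants by blast
qed

text \<open>Choosing one tree for each symbol makes \<open>semicontinuity\<close> applicable to
  finite subsets of \<open>B\<close>, and a uniform bound on these forces \<open>B\<close> to be
  finite.\<close>

lemma independent_syms_card_le:
  fixes e1 e2 :: "'k::field_char_0"
  assumes A: "finite A" and B: "B \<subseteq> tree_symbol e1 ` trees A" "fs.independent B"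
    and Y: "finite Y" "Y \<subseteq> exponents A (card A - 1)"
    and inj: "\<And>c. c \<in> invariants e2 A (card A - 1) \<Longrightarrow> (\<And>y. y \<in> Y \<Longrightarrow> c y = 0) \<Longrightarrow> c = 0"
  shows "finite B \<and> card B \<le> card Y"
proof -
  have fin: "card B' \<le> card Y" if "B' \<subseteq> B" "finite B'" for B'
  proof -
    have "B' \<subseteq> tree_symbol e1 ` trees A" using that(1) B(1) by (rule subset_trans)
    then obtain Ts where Ts: "Ts \<subseteq> trees A" "inj_on (tree_symbol e1) Ts" "B' = tree_symbol e1 ` Ts"
      by (metis subset_image_inj)
    have "finite (tree_symbol e1 ` Ts)" using Ts(3) that(2) by simp
    then have "finite Ts" using Ts(2) by (rule finite_imageD)
    moreover have "fs.independent (tree_symbol e1 ` Ts)"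
      using B(2) that(1) Ts(3) fs.independent_mono by blast
    ultimately have "card Ts \<le> card Y"
      using semicontinuity[OF A _ Ts(1) independent_trivial_kernel Y inj, of e1] Ts(2) by blast
    then show ?thesis using Ts by (simp add: card_image)
  qed
  moreover have "finite B"
  proof (rule ccontr)
    assume "infinite B"
    then obtain B' where "finite B'" "card B' = Suc (card Y)" "B' \<subseteq> B"
      using infinite_arbitrarily_large by blast
    then show False using fin[of B'] by simp
  qed
  ultimately show ?thesis by blast
qed

text \<open>\<open>semicontinuity\<close> is used in both directions. From -1 to 0 it gives
  \<open>card B \<le> card (stairs n (n - 1))\<close>. From 0 to -1 it bounds a basis
  \<open>B0\<close> of the brackets at 0 by \<open>card Y \<le> card B\<close>, and
  \<open>B0\<close> has to span the derivatives of the Vandermonde determinant, one for each element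
  of the staircase.\<close>

lemma dim_span_trees:
  assumes n: "n \<ge> 1"
  shows "fs.dim (fs.span (tree_symbol (-1 :: 'k::field_char_0) ` trees {1..n})) = card (stairs n (n - 1))"
proof -
  let ?A = "{1..n}" and ?k = "n - 1"
  let ?S = "\<lambda>e :: 'k. tree_symbol e ` trees ?A"
  have nat: "invariants e ?A ?k = fs.span (?S e)" if "nondeg e" for e :: 'k
    using invariants_eq_span_trees[OF that, of ?A] n by simp
  obtain B where B: "B \<subseteq> ?S (-1)" "fs.independent B" "?S (-1) \<subseteq> fs.span B"
    by (rule fs.maximal_independent_subset)
  have "finite B \<and> card B \<le> card (stairs n ?k)"
  proof (rule independent_syms_card_le[OF _ B(1,2) finite_stairs])
    show "stairs n ?k \<subseteq> exponents ?A (card ?A - 1)" by (auto simp: stairs_def)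
    show "c = 0" if "c \<in> invariants 0 ?A (card ?A - 1)" "\<And>y. y \<in> stairs n ?k \<Longrightarrow> c y = 0" for c :: "'k cfun"
      using invariants_0_stairs[of c n ?k] that by simp
  qed simp
  then have Bfin: "finite B" "card B \<le> card (stairs n ?k)" by auto
  have spB: "fs.span B = invariants (-1) ?A ?k"
    unfolding nat[OF nondeg_minus_1] using B fs.span_mono[OF B(1)] fs.span_minimal[OF B(3) fs.subspace_span] by blast

  have tB: "trivial_kernel B UNIV (\<lambda>\<alpha> b. b \<alpha>)"
    using independent_trivial_kernel[OF Bfin(1), of "\<lambda>b. b"] B(2) by simp
  have Bs: "(\<Sum>b\<in>B. fscale (c b) b) \<in> invariants (-1) ?A ?k" for c
    unfolding spB[symmetric] by (intro fs.span_sum fs.span_scale fs.span_base)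
  have Bap: "(\<Sum>b\<in>B. fscale (c b) b) \<alpha> = (\<Sum>b\<in>B. c b * b \<alpha>)" for c \<alpha>
    unfolding sum_fun_apply fscale_def ..
  have "trivial_kernel B (exponents ?A ?k) (\<lambda>\<alpha> b. b \<alpha>)"
    unfolding trivial_kernel_def
  proof (intro allI impI ballI)
    fix c b assume c: "\<forall>\<alpha>\<in>exponents ?A ?k. (\<Sum>b\<in>B. c b * b \<alpha>) = 0" and b: "b \<in> B"
    have "(\<Sum>b\<in>B. fscale (c b) b) = 0"
      by (rule invariants_eq_0[of ?A _ ?k]) (use Bs[of c] c in \<open>auto simp: invariants_def Bap\<close>)
    then have "(\<Sum>b\<in>B. c b * b \<alpha>) = 0" for \<alpha> using Bap[of c \<alpha>] by simp
    then show "c b = 0" by (intro trivial_kernelD[OF tB _ b]) auto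
  qed
  \<comment> \<open>Constant polynomials: here elimination only serves to select at most
    \<open>card B\<close> coefficients that determine the natural operations for
    \<open>e = -1\<close>.\<close>
  then have "trivial_kernel B (exponents ?A ?k) (\<lambda>\<alpha> b. poly [:b \<alpha>:] 0)" by simp
  from trivial_kernel_generic[OF Bfin(1) this] obtain Y p where Y: "Y \<subseteq> exponents ?A ?k" "finite Y" "card Y \<le> card B"
    "p \<noteq> 0" "\<And>e. poly p e \<noteq> 0 \<Longrightarrow> trivial_kernel B Y (\<lambda>\<alpha> b. poly [:b \<alpha>:] e)" by blast
  obtain e where "poly p e \<noteq> 0" using Y(4) by (rule poly_nonroot)
  then have tY: "trivial_kernel B Y (\<lambda>\<alpha> b. b \<alpha>)" using Y(5)[of e] by simp
  have Yinj: "c = 0" if c: "c \<in> invariants (-1) ?A (card ?A - 1)" "\<And>y. y \<in> Y \<Longrightarrow> c y = 0" for c :: "'k cfun"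
  proof -
    have "c \<in> fs.span B" using c(1) spB by simp
    then obtain x where x: "c = (\<Sum>b\<in>B. fscale (x b) b)" using fs.span_finite[OF Bfin(1)] by auto
    have "x b = 0" if "b \<in> B" for b
      by (rule trivial_kernelD[OF tY _ that]) (use c(2) Bap[of x] x in auto)
    then show "c = 0" by (simp add: x)
  qed

  obtain B0 where B0: "B0 \<subseteq> ?S 0" "fs.independent B0" "?S 0 \<subseteq> fs.span B0"
    by (rule fs.maximal_independent_subset)
  have B0fin: "finite B0" "card B0 \<le> card Y"
    using independent_syms_card_le[OF _ B0(1,2) Y(2), of "-1"] Y(1) Yinj by auto
  \<comment> \<open>Here the criterion enters for \<open>e = 0\<close>: it makes harmonic
    polynomials combinations of bracket monomials.\<close>
  have "vandermonde_shift n ` stairs n ?k \<subseteq> invariants (0 :: 'k) ?A ?k" using vandermonde_shift_invariants by blast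
  also have "\<dots> = fs.span (?S 0)" by (rule nat[OF nondeg_0])
  also have "\<dots> \<subseteq> fs.span B0" by (rule fs.span_minimal[OF B0(3) fs.subspace_span])
  finally have "card ((vandermonde_shift n :: _ \<Rightarrow> 'k cfun) ` stairs n ?k) \<le> card B0"
    using fs.independent_span_bound[OF B0fin(1) trivial_kernel_independent(2)[OF finite_stairs trivial_kernel_vandermonde_shift]] by blast
  moreover have "card ((vandermonde_shift n :: _ \<Rightarrow> 'k cfun) ` stairs n ?k) = card (stairs n ?k)"
    by (rule card_image[OF trivial_kernel_independent(1)[OF finite_stairs trivial_kernel_vandermonde_shift]])
  ultimately have "card B = card (stairs n ?k)" using Bfin(2) B0fin(2) Y(3) by simp
  moreover have "fs.dim (fs.span (?S (-1))) = card B"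
    by (rule fs.dim_eq_card[OF _ B(2)]) (simp only: fs.span_span spB nat[OF nondeg_minus_1])
  ultimately show ?thesis by simp
qed

section \<open>Multilinear components of Lie elements\<close>

definition multi_monom :: "nat set \<Rightarrow> (nat \<Rightarrow> nat) \<Rightarrow> dmonom" where
  "multi_monom I \<alpha> = (\<Sum>i\<in>I. Poly_Mapping.single (i, \<alpha> i) 1)"

text \<open>The part of \<open>f\<close> multilinear in the \<open>x\<^sub>i\<close> with
  \<open>i \<in> I\<close>. All finite \<open>I\<close> are considered, since the part of a product
  for \<open>{1..n}\<close> is composed of the parts of its factors for complementary
  subsets.\<close>

definition multilinear_coeffs :: "nat set \<Rightarrow> 'k::field_char_0 dpoly \<Rightarrow> 'k cfun" where
  "multilinear_coeffs I f \<alpha> = (\<Prod>i\<in>I. fact (\<alpha> i)) * Poly_Mapping.lookup f (multi_monom I \<alpha>)"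

lemma lookup_multi_monom:
  assumes "finite I"
  shows "Poly_Mapping.lookup (multi_monom I \<alpha>) v = (if fst v \<in> I \<and> snd v = \<alpha> (fst v) then 1 else 0)"
proof -
  have "Poly_Mapping.lookup (multi_monom I \<alpha>) v = (\<Sum>i\<in>I. if i = fst v then (if snd v = \<alpha> i then 1 else 0) else 0)"
    unfolding multi_monom_def lookup_sum by (rule sum.cong) (auto simp: lookup_single when_def prod_eq_iff)
  also have "\<dots> = (if fst v \<in> I then (if snd v = \<alpha> (fst v) then 1 else 0) else 0)"
    using assms by (rule sum.delta)
  finally show ?thesis by simp
qed

lemma multi_monom_eq_iff:
  assumes "finite I" "finite J"
  shows "multi_monom I \<alpha> = multi_monom J \<beta> \<longleftrightarrow> I = J \<and> (\<forall>i\<in>I. \<alpha> i = \<beta> i)"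
proof
  assume eq: "multi_monom I \<alpha> = multi_monom J \<beta>"
  have l: "(if i \<in> I \<and> r = \<alpha> i then 1 else 0) = (if i \<in> J \<and> r = \<beta> i then 1 else (0::nat))" for i r
    using lookup_multi_monom[OF assms(1), of \<alpha> "(i, r)"] lookup_multi_monom[OF assms(2), of \<beta> "(i, r)"] by (simp add: eq)
  have "i \<in> J \<and> \<alpha> i = \<beta> i" if "i \<in> I" for i using l[of i "\<alpha> i"] that by (auto split: if_splits)
  moreover have "i \<in> I" if "i \<in> J" for i using l[of i "\<beta> i"] that by (auto split: if_splits)
  ultimately show "I = J \<and> (\<forall>i\<in>I. \<alpha> i = \<beta> i)" by blast
next
  assume "I = J \<and> (\<forall>i\<in>I. \<alpha> i = \<beta> i)"
  then show "multi_monom I \<alpha> = multi_monom J \<beta>" unfolding multi_monom_def by (auto intro: sum.cong)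
qed

lemma multi_monom_union:
  "finite I \<Longrightarrow> finite J \<Longrightarrow> I \<inter> J = {} \<Longrightarrow> multi_monom (I \<union> J) \<alpha> = multi_monom I \<alpha> + multi_monom J \<alpha>"
  by (simp add: multi_monom_def sum.union_disjoint)

lemma multilinear_coeffs_add: "multilinear_coeffs I (f + g) = multilinear_coeffs I f + multilinear_coeffs I g"
  by (simp add: fun_eq_iff multilinear_coeffs_def lookup_add distrib_left)

lemma multilinear_coeffs_scale: "multilinear_coeffs I (scale a f) = fscale a (multilinear_coeffs I f)"
  by (simp add: fun_eq_iff multilinear_coeffs_def lookup_scale fscale_def)

lemma multilinear_coeffs_0: "multilinear_coeffs I 0 = 0"
  by (simp add: fun_eq_iff multilinear_coeffs_def)

lemma add_eq_multi_monom:
  assumes I: "finite I" and eq: "\<mu> + \<nu> = multi_monom I \<alpha>"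
  shows "\<exists>J\<subseteq>I. \<mu> = multi_monom J \<alpha> \<and> \<nu> = multi_monom (I - J) \<alpha>"
proof (intro exI conjI)
  let ?J = "{i \<in> I. Poly_Mapping.lookup \<mu> (i, \<alpha> i) = 1}"
  have l: "Poly_Mapping.lookup \<mu> v + Poly_Mapping.lookup \<nu> v = (if fst v \<in> I \<and> snd v = \<alpha> (fst v) then 1 else 0)" for v
    unfolding lookup_add[symmetric] eq lookup_multi_monom[OF I] ..
  show "?J \<subseteq> I" by auto
  have J: "finite ?J" "finite (I - ?J)" using I by auto
  show "\<mu> = multi_monom ?J \<alpha>"
  proof (rule poly_mapping_eqI)
    fix v show "Poly_Mapping.lookup \<mu> v = Poly_Mapping.lookup (multi_monom ?J \<alpha>) v"
      unfolding lookup_multi_monom[OF J(1)] using l[of v] by (cases v) (auto split: if_splits)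
  qed
  show "\<nu> = multi_monom (I - ?J) \<alpha>"
  proof (rule poly_mapping_eqI)
    fix v show "Poly_Mapping.lookup \<nu> v = Poly_Mapping.lookup (multi_monom (I - ?J) \<alpha>) v"
      unfolding lookup_multi_monom[OF J(2)] using l[of v] by (cases v) (auto split: if_splits)
  qed
qed

lemma multilinear_coeffs_mult:
  fixes f g :: "'k::field_char_0 dpoly"
  assumes I: "finite I"
  shows "multilinear_coeffs I (f * g) \<alpha> = (\<Sum>J\<in>Pow I. multilinear_coeffs J f \<alpha> * multilinear_coeffs (I - J) g \<alpha>)"
proof (induction f rule: poly_mapping_linear_induct)
  case zero
  show ?case by (simp add: multilinear_coeffs_def)
next
  case (add p q)
  then show ?case by (simp add: distrib_right multilinear_coeffs_add sum.distrib)
next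
  case (single \<mu> a)
  show ?case
  proof (induction g rule: poly_mapping_linear_induct)
    case zero
    show ?case by (simp add: multilinear_coeffs_def)
  next
    case (add p q)
    then show ?case by (simp add: distrib_left multilinear_coeffs_add sum.distrib)
  next
    case (single \<nu> b)
    have *: "multilinear_coeffs J (Poly_Mapping.single \<mu> a) \<alpha> * multilinear_coeffs (I - J) (Poly_Mapping.single \<nu> b) \<alpha> =
       (if \<mu> = multi_monom J \<alpha> \<and> \<nu> = multi_monom (I - J) \<alpha> then (\<Prod>i\<in>I. fact (\<alpha> i)) * (a * b) else 0)" if "J \<in> Pow I" for J
    proof -
      have "(\<Prod>i\<in>I. fact (\<alpha> i) :: 'k) = (\<Prod>i\<in>I - J. fact (\<alpha> i)) * (\<Prod>i\<in>J. fact (\<alpha> i))"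
        using that I by (intro prod.subset_diff) auto
      then show ?thesis by (simp add: multilinear_coeffs_def lookup_single when_def)
    qed
    show ?case
    proof (cases "\<mu> + \<nu> = multi_monom I \<alpha>")
      case True
      then obtain J where J: "J \<subseteq> I" "\<mu> = multi_monom J \<alpha>" "\<nu> = multi_monom (I - J) \<alpha>" using add_eq_multi_monom[OF I] by blast
      have "\<mu> = multi_monom J' \<alpha> \<and> \<nu> = multi_monom (I - J') \<alpha> \<longleftrightarrow> J' = J" if "J' \<in> Pow I" for J'
        using J that multi_monom_eq_iff[of J J' \<alpha> \<alpha>] I by (auto dest: finite_subset)
      then have "(\<Sum>J'\<in>Pow I. multilinear_coeffs J' (Poly_Mapping.single \<mu> a) \<alpha> * multilinear_coeffs (I - J') (Poly_Mapping.single \<nu> b) \<alpha>) =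
        (\<Sum>J'\<in>Pow I. if J' = J then (\<Prod>i\<in>I. fact (\<alpha> i)) * (a * b) else 0)"
        using * by (intro sum.cong) auto
      also have "\<dots> = (\<Prod>i\<in>I. fact (\<alpha> i)) * (a * b)" using I J by simp
      finally show ?thesis using True by (simp add: multilinear_coeffs_def mult_single)
    next
      case False
      have "\<not> (\<mu> = multi_monom J \<alpha> \<and> \<nu> = multi_monom (I - J) \<alpha>)" if "J \<in> Pow I" for J
        using that False I multi_monom_union[of J "I - J" \<alpha>] by (auto simp: Un_absorb1 dest: finite_subset)
      then have "(\<Sum>J'\<in>Pow I. multilinear_coeffs J' (Poly_Mapping.single \<mu> a) \<alpha> * multilinear_coeffs (I - J') (Poly_Mapping.single \<nu> b) \<alpha>) = 0"
        using * by (intro sum.neutral) auto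
      then show ?thesis using False by (simp add: multilinear_coeffs_def mult_single lookup_single)
    qed
  qed
qed

lemma multi_monom_upd:
  assumes "finite I" "i \<in> I"
  shows "multi_monom I (\<alpha>(i := s)) = multi_monom (I - {i}) \<alpha> + Poly_Mapping.single (i, s) 1"
proof -
  have "multi_monom (I - {i}) (\<alpha>(i := s)) = multi_monom (I - {i}) \<alpha>" unfolding multi_monom_def by (rule sum.cong) auto
  then show ?thesis using assms by (simp add: multi_monom_def sum.remove[OF assms] add.commute)
qed

text \<open>A multilinear monomial arises by raising the order of a single \<open>x\<^sub>i\<close>
  from \<open>\<alpha> i - 1\<close> to \<open>\<alpha> i\<close>; the coefficient
  \<open>\<alpha> i\<close> in \<open>mult_t\<close> is the quotient of the two factorials.\<close>

lemma multilinear_coeffs_D: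
  fixes f :: "'k::field_char_0 dpoly"
  assumes I: "finite I"
  shows "multilinear_coeffs I (D f) = mult_t I (multilinear_coeffs I f)"
proof (rule ext, induction f rule: poly_mapping_linear_induct)
  case (zero \<alpha>)
  show ?case by (simp add: D_def multilinear_coeffs_def mult_t_def)
next
  case (add p q \<alpha>)
  then show ?case by (simp add: D_add multilinear_coeffs_add mult_t_def distrib_left sum.distrib)
next
  case (single \<mu> a \<alpha>)
  let ?e = "Poly_Mapping.lookup \<mu>" and ?s = "\<lambda>v. Poly_Mapping.single v (1::nat)"
  let ?F = "\<Prod>i\<in>I. fact (\<alpha> i) :: 'k"
  let ?v' = "\<lambda>v. (fst v, Suc (snd v))"
  let ?T = "\<lambda>v. if \<mu> - ?s v + ?s (?v' v) = multi_monom I \<alpha> then (of_nat (?e v) :: 'k) else 0"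
  \<comment> \<open>The only variables whose differentiation can lead to
    \<open>multi_monom I \<alpha>\<close>; they exist where \<open>\<alpha> i > 0\<close>.\<close>
  define V where "V = (\<lambda>i. (i, \<alpha> i - 1)) ` {i \<in> I. \<alpha> i > 0}"
  define U where "U = Poly_Mapping.keys \<mu> \<union> V"
  have fU: "finite U" "finite V" using I by (auto simp: U_def V_def)
  have key: "\<mu> = multi_monom I (\<alpha>(i := s))" "i \<in> I" "\<alpha> i = Suc s" if "\<mu> - ?s (i, s) + ?s (i, Suc s) = multi_monom I \<alpha>" "?e (i, s) \<noteq> 0" for i s
  proof -
    have "Poly_Mapping.lookup (multi_monom I \<alpha>) (i, Suc s) \<noteq> 0" unfolding that(1)[symmetric] by (simp add: lookup_add)
    then show i: "i \<in> I" "\<alpha> i = Suc s" unfolding lookup_multi_monom[OF I] by (auto split: if_splits)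
    have "\<mu> = \<mu> - ?s (i, s) + ?s (i, s)"
      using that(2) by (intro poly_mapping_eqI) (auto simp: lookup_add lookup_minus lookup_single when_def)
    moreover have "multi_monom I \<alpha> = multi_monom (I - {i}) \<alpha> + ?s (i, Suc s)"
      using multi_monom_upd[OF I i(1), of \<alpha> "Suc s"] i(2) by (simp add: fun_upd_idem)
    ultimately show "\<mu> = multi_monom I (\<alpha>(i := s))"
      using that(1) multi_monom_upd[OF I i(1), of \<alpha> s] by (metis add_right_cancel)
  qed
  have T: "?T (i, \<alpha> i - 1) = (if \<mu> = multi_monom I (\<alpha>(i := \<alpha> i - 1)) then 1 else 0)" if i: "i \<in> I" "\<alpha> i > 0" for i
  proof (cases "\<mu> = multi_monom I (\<alpha>(i := \<alpha> i - 1))")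
    case True
    have "?e (i, \<alpha> i - 1) = 1" using i by (simp add: True lookup_multi_monom[OF I])
    moreover have "\<mu> - ?s (i, \<alpha> i - 1) + ?s (i, \<alpha> i) = multi_monom I \<alpha>"
      using True multi_monom_upd[OF I i(1), of \<alpha> "\<alpha> i - 1"] multi_monom_upd[OF I i(1), of \<alpha> "\<alpha> i"] by simp
    ultimately show ?thesis using True i by simp
  next
    case False
    then show ?thesis using key[of i "\<alpha> i - 1"] i by auto
  qed
  have "D (Poly_Mapping.single \<mu> a) = scale a (D_monom \<mu>)" by (simp add: D_def lin_ext_single)
  then have "multilinear_coeffs I (D (Poly_Mapping.single \<mu> a)) \<alpha> = ?F * (a * (\<Sum>v\<in>U. ?T v))"
    by (simp add: multilinear_coeffs_def lookup_scale D_monom_superset[of U \<mu>] U_def fU[unfolded U_def] lookup_sum lookup_single when_def)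
  also have "(\<Sum>v\<in>U. ?T v) = (\<Sum>v\<in>V. ?T v)"
  proof (rule sum.mono_neutral_right)
    show "\<forall>v\<in>U - V. ?T v = 0"
    proof
      fix v assume v: "v \<in> U - V"
      show "?T v = 0"
      proof (rule ccontr)
        assume "?T v \<noteq> 0"
        then have "\<mu> - ?s (fst v, snd v) + ?s (fst v, Suc (snd v)) = multi_monom I \<alpha>" "?e (fst v, snd v) \<noteq> 0"
          by (auto split: if_splits)
        then have "fst v \<in> I" "\<alpha> (fst v) = Suc (snd v)" using key(2,3) by blast+
        then have "v \<in> V" by (auto simp: V_def image_iff prod_eq_iff intro!: bexI[of _ "fst v"])
        then show False using v by simp
      qed
    qed
  qed (use fU in \<open>auto simp: U_def\<close>)
  also have "\<dots> = (\<Sum>i\<in>{i \<in> I. \<alpha> i > 0}. if \<mu> = multi_monom I (\<alpha>(i := \<alpha> i - 1)) then 1 else 0)"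
  proof -
    have "inj_on (\<lambda>i. (i, \<alpha> i - 1)) {i \<in> I. \<alpha> i > 0}" by (auto simp: inj_on_def)
    then show ?thesis unfolding V_def by (subst sum.reindex) (auto simp only: o_def T mem_Collect_eq intro!: sum.cong)
  qed
  also have "?F * (a * \<dots>) = (\<Sum>i\<in>{i \<in> I. \<alpha> i > 0}. of_nat (\<alpha> i) * multilinear_coeffs I (Poly_Mapping.single \<mu> a) (\<alpha>(i := \<alpha> i - 1)))"
    unfolding sum_distrib_left
  proof (rule sum.cong[OF refl])
    fix i assume i: "i \<in> {i \<in> I. \<alpha> i > 0}"
    have "(\<Prod>l\<in>I - {i}. fact ((\<alpha>(i := \<alpha> i - 1)) l)) = (\<Prod>l\<in>I - {i}. fact (\<alpha> l) :: 'k)"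
      by (rule prod.cong) auto
    then have "?F = of_nat (\<alpha> i) * (\<Prod>l\<in>I. fact ((\<alpha>(i := \<alpha> i - 1)) l))"
      using i I fact_reduce[of "\<alpha> i", where ?'a = 'k] by (simp add: prod.remove[of I i])
    then show "?F * (a * (if \<mu> = multi_monom I (\<alpha>(i := \<alpha> i - 1)) then 1 else 0)) =
        of_nat (\<alpha> i) * multilinear_coeffs I (Poly_Mapping.single \<mu> a) (\<alpha>(i := \<alpha> i - 1))"
      by (simp add: multilinear_coeffs_def lookup_single when_def)
  qed
  also have "\<dots> = mult_t I (multilinear_coeffs I (Poly_Mapping.single \<mu> a)) \<alpha>"
    unfolding mult_t_def by (rule sum.mono_neutral_left) (use I in auto)
  finally show ?case .
qed

lemma bracket_lin_left: "bracket e I J (fscale a f + f') g = fscale a (bracket e I J f g) + bracket e I J f' g"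
  by (rule ext) (unfold bracket_def mult_t_lin fscale_add_apply, simp only: algebra_simps)

lemma bracket_lin_right: "bracket e I J f (fscale a g + g') = fscale a (bracket e I J f g) + bracket e I J f g'"
  by (rule ext) (unfold bracket_def mult_t_lin fscale_add_apply, simp only: algebra_simps)

lemma bracket_0: "bracket e I J 0 g = 0" "bracket e I J f 0 = 0"
  by (simp_all add: fun_eq_iff bracket_def mult_t_def)

lemma bracket_span:
  assumes f: "f \<in> fs.span (tree_symbol e ` trees I)" and g: "g \<in> fs.span (tree_symbol e ` trees J)" and IJ: "I \<inter> J = {}"
  shows "bracket e I J f g \<in> fs.span (tree_symbol e ` trees (I \<union> J))"
  using f
proof (induction rule: fs.span_induct_alt)
  case base
  show ?case unfolding bracket_0 by (rule fs.span_zero)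
next
  case (step a f f')
  then obtain T where T: "T \<in> trees I" "f = tree_symbol e T" by auto
  have "bracket e I J f g \<in> fs.span (tree_symbol e ` trees (I \<union> J))"
    using g
  proof (induction rule: fs.span_induct_alt)
    case base
    show ?case unfolding bracket_0 by (rule fs.span_zero)
  next
    case (step b g g')
    then obtain U where U: "U \<in> trees J" "g = tree_symbol e U" by auto
    have "bracket e I J f g = tree_symbol e (Br T U)" "Br T U \<in> trees (I \<union> J)"
      using T U IJ by (auto simp: trees_def)
    then have "bracket e I J f g \<in> fs.span (tree_symbol e ` trees (I \<union> J))" by (metis fs.span_base imageI)
    then show ?case unfolding bracket_lin_right by (intro fs.span_add fs.span_scale step)
  qed
  then show ?case unfolding bracket_lin_left by (intro fs.span_add fs.span_scale step)
qed

lemma multilinear_coeffs_bracket: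
  fixes f g :: "'k::field_char_0 dpoly"
  assumes I: "finite I"
  shows "multilinear_coeffs I (nov_bracket f g) \<alpha> =
    (\<Sum>J\<in>Pow I. multilinear_coeffs J f \<alpha> * mult_t (I - J) (multilinear_coeffs (I - J) g) \<alpha> - mult_t J (multilinear_coeffs J f) \<alpha> * multilinear_coeffs (I - J) g \<alpha>)"
proof -
  have D: "multilinear_coeffs J (D h) = mult_t J (multilinear_coeffs J h)" if "J \<in> Pow I" for J and h :: "'k dpoly"
    using that I by (intro multilinear_coeffs_D) (auto dest: finite_subset)
  have m: "multilinear_coeffs I (f' * D g') \<alpha> = (\<Sum>J\<in>Pow I. multilinear_coeffs J f' \<alpha> * mult_t (I - J) (multilinear_coeffs (I - J) g') \<alpha>)"
    for f' g' :: "'k dpoly"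
    unfolding multilinear_coeffs_mult[OF I] by (intro sum.cong refl) (simp add: D)
  have "nov_bracket f g = f * D g + scale (-1) (g * D f)" by (simp add: nov_bracket_def nov_mult_def)
  then have "multilinear_coeffs I (nov_bracket f g) = multilinear_coeffs I (f * D g) + fscale (-1) (multilinear_coeffs I (g * D f))"
    by (simp only: multilinear_coeffs_add multilinear_coeffs_scale)
  then have "multilinear_coeffs I (nov_bracket f g) \<alpha> = multilinear_coeffs I (f * D g) \<alpha> - multilinear_coeffs I (g * D f) \<alpha>"
    by (simp add: fscale_def)
  \<comment> \<open>Passing to complements exchanges the roles of \<open>f\<close> and
    \<open>g\<close>.\<close>
  also have "multilinear_coeffs I (g * D f) \<alpha> = (\<Sum>J\<in>Pow I. mult_t J (multilinear_coeffs J f) \<alpha> * multilinear_coeffs (I - J) g \<alpha>)"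
    unfolding m
    by (rule sum.reindex_bij_witness[where i = "\<lambda>J. I - J" and j = "\<lambda>J. I - J"])
       (auto simp: double_diff mult.commute)
  finally show ?thesis unfolding m by (simp add: sum_subtractf)
qed

lemma multilinear_coeffs_dvar:
  assumes I: "finite I"
  shows "multilinear_coeffs I (dvar i 0) = (if I = {i} then tree_symbol (-1) (Leaf i) else 0)"
proof (rule ext)
  fix \<alpha>
  have "Poly_Mapping.single (i, 0) 1 = multi_monom I \<alpha> \<longleftrightarrow> I = {i} \<and> \<alpha> i = 0"
    using multi_monom_eq_iff[OF I, of "{i}" \<alpha> "\<lambda>_. 0"] by (auto simp: multi_monom_def)
  then show "multilinear_coeffs I (dvar i 0) \<alpha> = (if I = {i} then tree_symbol (-1) (Leaf i) else 0) \<alpha>"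
    by (auto simp: multilinear_coeffs_def dvar_def lookup_single when_def)
qed

text \<open>Lie elements need not be homogeneous, so the induction treats all finite
  \<open>I\<close> at once: the part of a bracket is a sum of brackets of parts for complementary
  subsets. The constant term is included because no tree has an empty set of leaves.\<close>

lemma multilinear_coeffs_lie:
  fixes f :: "'k::field_char_0 dpoly"
  assumes "f \<in> lie_elements n" "finite I"
  shows "multilinear_coeffs I f \<in> fs.span (tree_symbol (-1) ` trees I)" "I = {} \<Longrightarrow> multilinear_coeffs I f = 0"
proof -
  let ?S = "\<lambda>I. fs.span (tree_symbol (-1 :: 'k) ` trees I)"
  have "\<forall>I. finite I \<longrightarrow> multilinear_coeffs I f \<in> ?S I \<and> (I = {} \<longrightarrow> multilinear_coeffs I f = 0)"
    using assms(1) unfolding lie_elements_def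
  proof induction
    case (gen f)
    then obtain i where i: "f = dvar i 0" by (auto simp: gens_def)
    have "multilinear_coeffs I f \<in> ?S I" if "finite I" for I
    proof (cases "I = {i}")
      case True
      then have "Leaf i \<in> trees I" by (simp add: trees_def)
      then show ?thesis unfolding i multilinear_coeffs_dvar[OF that] if_P[OF True] by (intro fs.span_base imageI)
    next
      case False
      show ?thesis unfolding i multilinear_coeffs_dvar[OF that] if_not_P[OF False] by (rule fs.span_zero)
    qed
    moreover have "multilinear_coeffs {} f = 0" by (simp add: i multilinear_coeffs_dvar)
    ultimately show ?case by blast
  next
    case zero
    show ?case unfolding multilinear_coeffs_0 using fs.span_zero by blast
  next
    case (add f g)
    have "multilinear_coeffs {} f = 0" "multilinear_coeffs {} g = 0" using add.IH by blast+
    then have "multilinear_coeffs {} (f + g) = 0" unfolding multilinear_coeffs_add by (simp only: add_0_left)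
    moreover have "multilinear_coeffs I (f + g) \<in> ?S I" if "finite I" for I
      unfolding multilinear_coeffs_add using add.IH that by (intro fs.span_add) blast+
    ultimately show ?case by blast
  next
    case (scale f c)
    have "fscale c 0 = (0 :: 'k cfun)" by (simp add: fun_eq_iff fscale_def)
    moreover have "multilinear_coeffs {} f = 0" using scale.IH by blast
    ultimately have "multilinear_coeffs {} (scale c f) = 0" unfolding multilinear_coeffs_scale by (simp only:)
    moreover have "multilinear_coeffs I (scale c f) \<in> ?S I" if "finite I" for I
      unfolding multilinear_coeffs_scale using scale.IH that by (intro fs.span_scale) blast
    ultimately show ?case by blast
  next
    case (mul f g)
    have "multilinear_coeffs I (nov_bracket f g) \<in> ?S I" if I: "finite I" for I
    proof -
      let ?t = "\<lambda>J \<alpha>. multilinear_coeffs J f \<alpha> * mult_t (I - J) (multilinear_coeffs (I - J) g) \<alpha> - mult_t J (multilinear_coeffs J f) \<alpha> * multilinear_coeffs (I - J) g \<alpha>"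
      have eq: "multilinear_coeffs I (nov_bracket f g) = (\<Sum>J\<in>Pow I. ?t J)"
        by (rule ext) (simp only: multilinear_coeffs_bracket[OF I] sum_fun_apply)
      have mem: "?t J \<in> ?S I" if J: "J \<in> Pow I" for J
      proof -
        have fin: "finite J" "finite (I - J)" using J I by (auto dest: finite_subset)
        show ?thesis
        \<comment> \<open>An empty index set has weight 0 instead of 1, so such a term is not a
          \<open>bracket\<close>; it vanishes because constant terms do.\<close>
        proof (cases "J = {} \<or> I - J = {}")
          case True
          have "multilinear_coeffs J f = 0" if "J = {}" using mul.IH(1) that fin(1) by blast
          moreover have "multilinear_coeffs (I - J) g = 0" if "I - J = {}" using mul.IH(2) that fin(2) by blast
          ultimately have "multilinear_coeffs J f = 0 \<or> multilinear_coeffs (I - J) g = 0" using True by blast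
          then have "?t J \<alpha> = 0" for \<alpha> by (auto simp: mult_t_def)
          then have "?t J = 0" by (intro ext) (simp only: zero_fun_apply)
          then show ?thesis by (simp only: fs.span_zero)
        next
          case False
          then have "card J \<ge> 1" "card (I - J) \<ge> 1" using fin by (simp_all add: Suc_le_eq card_gt_0_iff)
          then have "?t J = bracket (-1) J (I - J) (multilinear_coeffs J f) (multilinear_coeffs (I - J) g)"
            by (intro ext) (simp add: bracket_def weight_minus_1)
          moreover have "\<dots> \<in> ?S (J \<union> (I - J))"
            using mul.IH fin by (intro bracket_span) auto
          moreover have "J \<union> (I - J) = I" using J by auto
          ultimately show ?thesis by simp
        qed
      qed
      show ?thesis unfolding eq by (rule fs.span_sum) (rule mem)
    qed
    moreover have "multilinear_coeffs {} (nov_bracket f g) = 0"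
      by (rule ext) (simp add: multilinear_coeffs_bracket mult_t_def)
    ultimately show ?case by simp
  qed
  then show "multilinear_coeffs I f \<in> ?S I" "I = {} \<Longrightarrow> multilinear_coeffs I f = 0" using assms(2) by auto
qed

section \<open>Multilinear Lie elements from trees\<close>

primrec lie_tree :: "tree \<Rightarrow> 'k::field dpoly" where
  "lie_tree (Leaf i) = dvar i 0"
| "lie_tree (Br T U) = nov_bracket (lie_tree T) (lie_tree U)"

lemma lie_tree_lie: "set (leaves T) \<subseteq> {1..n} \<Longrightarrow> lie_tree T \<in> lie_elements n"
  unfolding lie_elements_def by (induction T) (auto simp: gens_def intro: gen_subalgebra.intros)

lemma multilinear_coeffs_lie_tree:
  assumes "distinct (leaves T)" "finite I"
  shows "multilinear_coeffs I (lie_tree T :: 'k::field_char_0 dpoly) = (if I = set (leaves T) then tree_symbol (-1) T else 0)"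
  using assms
proof (induction T arbitrary: I)
  case (Leaf i)
  then show ?case by (simp add: multilinear_coeffs_dvar del: tree_symbol.simps)
next
  case (Br T U)
  let ?J = "set (leaves T)" and ?K = "set (leaves U)"
  let ?f = "lie_tree T :: 'k dpoly" and ?g = "lie_tree U :: 'k dpoly"
  have d: "distinct (leaves T)" "distinct (leaves U)" "?J \<inter> ?K = {}" using Br.prems by auto
  let ?t = "\<lambda>J \<alpha>. multilinear_coeffs J ?f \<alpha> * mult_t (I - J) (multilinear_coeffs (I - J) ?g) \<alpha> - mult_t J (multilinear_coeffs J ?f) \<alpha> * multilinear_coeffs (I - J) ?g \<alpha>"
  have z: "?t J \<alpha> = 0" if J: "J \<in> Pow I" "\<not> (J = ?J \<and> I - J = ?K)" for J \<alpha>
  proof -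
    have fin: "finite J" "finite (I - J)" using J Br.prems(2) by (auto dest: finite_subset)
    have "multilinear_coeffs J ?f = 0 \<or> multilinear_coeffs (I - J) ?g = 0"
      using Br.IH(1)[OF d(1) fin(1)] Br.IH(2)[OF d(2) fin(2)] J(2) by presburger
    then show ?thesis by (auto simp: mult_t_def)
  qed
  show ?case
  proof (rule ext)
    fix \<alpha>
    have th: "multilinear_coeffs I (lie_tree (Br T U) :: 'k dpoly) \<alpha> = (\<Sum>J\<in>Pow I. ?t J \<alpha>)"
      unfolding lie_tree.simps by (rule multilinear_coeffs_bracket[OF Br.prems(2)])
    show "multilinear_coeffs I (lie_tree (Br T U) :: 'k dpoly) \<alpha> = (if I = set (leaves (Br T U)) then tree_symbol (-1) (Br T U) else 0) \<alpha>"
    proof (cases "I = ?J \<union> ?K")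
      case True
      have IJ: "I - ?J = ?K" using True d by auto
      have "(\<Sum>J\<in>Pow I. ?t J \<alpha>) = (\<Sum>J\<in>{?J}. ?t J \<alpha>)"
        by (rule sum.mono_neutral_right) (use Br.prems(2) True z in auto)
      moreover have "card ?J \<ge> 1" "card ?K \<ge> 1" by (simp_all add: Suc_le_eq card_gt_0_iff)
      moreover have "multilinear_coeffs ?J ?f = tree_symbol (-1) T" "multilinear_coeffs ?K ?g = tree_symbol (-1) U"
        using Br.IH(1)[OF d(1), of ?J] Br.IH(2)[OF d(2), of ?K] by simp_all
      ultimately have "multilinear_coeffs I (lie_tree (Br T U) :: 'k dpoly) \<alpha> = tree_symbol (-1) (Br T U) \<alpha>"
        unfolding th by (simp add: IJ bracket_def weight_minus_1)
      then show ?thesis using True by (simp only: leaves.simps set_append if_True simp_thms)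
    next
      case False
      have "(\<Sum>J\<in>Pow I. ?t J \<alpha>) = 0"
        by (rule sum.neutral) (use z False in blast)
      then show ?thesis unfolding th using False by simp
    qed
  qed
qed

text \<open>\<open>multilinear_coeffs\<close> only sees monomials of this form; membership in
  \<open>Nov n\<close> requires that there are no others.\<close>

lemma keys_lie_tree:
  "distinct (leaves T) \<Longrightarrow> Poly_Mapping.keys (lie_tree T :: 'k::field_char_0 dpoly) \<subseteq> range (multi_monom (set (leaves T)))"
proof (induction T)
  case (Leaf i)
  have "Poly_Mapping.single (i, 0) 1 = multi_monom {i} (\<lambda>_. 0)" by (simp add: multi_monom_def)
  then show ?case by (auto simp: dvar_def)
next
  case (Br T U)
  have D: "Poly_Mapping.keys (D f) \<subseteq> range (multi_monom I)"
    if fin: "finite I" and kf: "Poly_Mapping.keys f \<subseteq> range (multi_monom I)" for I and f :: "'k dpoly"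
  proof
    fix m assume "m \<in> Poly_Mapping.keys (D f)"
    then have "(\<Sum>\<mu>\<in>Poly_Mapping.keys f. Poly_Mapping.lookup f \<mu> * Poly_Mapping.lookup (D_monom \<mu>) m) \<noteq> 0"
      by (simp add: in_keys_iff D_def lin_ext_def lookup_sum lookup_scale)
    then obtain \<mu> where \<mu>: "\<mu> \<in> Poly_Mapping.keys f" "Poly_Mapping.lookup (D_monom \<mu> :: 'k dpoly) m \<noteq> 0"
      by (metis (no_types, lifting) mult_zero_right sum.neutral)
    then obtain \<alpha> where \<alpha>: "\<mu> = multi_monom I \<alpha>" using kf by blast
    from \<mu>(2) obtain v where v: "v \<in> Poly_Mapping.keys \<mu>"
      "m = \<mu> - Poly_Mapping.single v 1 + Poly_Mapping.single (fst v, Suc (snd v)) 1"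
      unfolding D_monom_def lookup_sum
      by (metis (no_types, lifting) sum.neutral lookup_single_not_eq)
    have "fst v \<in> I" "snd v = \<alpha> (fst v)"
      using v(1) by (auto simp: \<alpha> in_keys_iff lookup_multi_monom[OF fin] split: if_splits)
    then have i: "fst v \<in> I" "v = (fst v, \<alpha> (fst v))" by (auto simp: prod_eq_iff)
    have "\<mu> = multi_monom (I - {fst v}) \<alpha> + Poly_Mapping.single v 1"
      using multi_monom_upd[OF fin i(1), of \<alpha> "\<alpha> (fst v)"] i(2) by (simp add: \<alpha>)
    then have "m = multi_monom I (\<alpha>(fst v := Suc (snd v)))"
      using v(2) multi_monom_upd[OF fin i(1), of \<alpha> "Suc (snd v)"] by simp
    then show "m \<in> range (multi_monom I)" by simp
  qed
  have M: "Poly_Mapping.keys (f * g) \<subseteq> range (multi_monom (I \<union> J))"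
    if fin: "finite I" "finite J" "I \<inter> J = {}" and kf: "Poly_Mapping.keys f \<subseteq> range (multi_monom I)" "Poly_Mapping.keys g \<subseteq> range (multi_monom J)"
    for I J and f g :: "'k dpoly"
  proof
    fix m assume "m \<in> Poly_Mapping.keys (f * g)"
    then obtain a b where "m = a + b" "a \<in> Poly_Mapping.keys f" "b \<in> Poly_Mapping.keys g"
      using keys_mult by blast
    then obtain \<alpha> \<beta> where m: "m = multi_monom I \<alpha> + multi_monom J \<beta>" using kf by blast
    \<comment> \<open>The orders in the two factors are unrelated; as the index sets are disjoint,
      they can be glued.\<close>
    let ?\<gamma> = "\<lambda>i. if i \<in> I then \<alpha> i else \<beta> i"
    have "multi_monom I \<alpha> = multi_monom I ?\<gamma>" "multi_monom J \<beta> = multi_monom J ?\<gamma>" using fin by (auto simp: multi_monom_eq_iff)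
    then have "m = multi_monom (I \<union> J) ?\<gamma>" using m by (simp only: multi_monom_union[OF fin])
    then show "m \<in> range (multi_monom (I \<union> J))" by simp
  qed
  let ?f = "lie_tree T :: 'k dpoly" and ?g = "lie_tree U :: 'k dpoly"
  have d: "distinct (leaves T)" "distinct (leaves U)" "set (leaves T) \<inter> set (leaves U) = {}" using Br.prems by auto
  have "Poly_Mapping.keys (?f * D ?g) \<subseteq> range (multi_monom (set (leaves T) \<union> set (leaves U)))"
    using d Br.IH by (intro M D) auto
  moreover have "Poly_Mapping.keys (?g * D ?f) \<subseteq> range (multi_monom (set (leaves U) \<union> set (leaves T)))"
    using d Br.IH by (intro M D) auto
  moreover have "Poly_Mapping.keys (p - q) \<subseteq> Poly_Mapping.keys p \<union> Poly_Mapping.keys q" for p q :: "'k dpoly"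
    by (auto simp: in_keys_iff lookup_minus)
  ultimately have "Poly_Mapping.keys (?f * D ?g - ?g * D ?f) \<subseteq> range (multi_monom (set (leaves T) \<union> set (leaves U)))"
    unfolding Un_commute[of "set (leaves U)"] by blast
  then show ?case by (simp add: nov_bracket_def nov_mult_def)
qed

lemma multilinear_iff: "multilinear n f \<longleftrightarrow> Poly_Mapping.keys f \<subseteq> range (multi_monom {1..n})"
proof -
  have "(\<forall>i. deg_in i m = (if i \<in> {1..n} then 1 else 0)) \<longleftrightarrow> m \<in> range (multi_monom {1..n})" for m
  proof
    assume "m \<in> range (multi_monom {1..n})"
    then obtain \<alpha> where m: "m = multi_monom {1..n} \<alpha>" by blast
    have "{v \<in> Poly_Mapping.keys m. fst v = i} = (if i \<in> {1..n} then {(i, \<alpha> i)} else {})" for i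
      by (auto simp: in_keys_iff m lookup_multi_monom split: if_splits)
    then show "\<forall>i. deg_in i m = (if i \<in> {1..n} then 1 else 0)"
      unfolding deg_in_def by (simp add: m lookup_multi_monom)
  next
    assume d: "\<forall>i. deg_in i m = (if i \<in> {1..n} then 1 else 0)"
    have z: "Poly_Mapping.lookup m v = 0" if "fst v \<notin> {1..n}" for v
    proof (rule ccontr)
      assume nz: "Poly_Mapping.lookup m v \<noteq> 0"
      have "(\<Sum>w\<in>{w \<in> Poly_Mapping.keys m. fst w = fst v}. Poly_Mapping.lookup m w) = 0"
        using d[rule_format, of "fst v"] that by (simp add: deg_in_def)
      then have "\<forall>w\<in>{w \<in> Poly_Mapping.keys m. fst w = fst v}. Poly_Mapping.lookup m w = 0"
        by (subst (asm) sum_eq_0_iff) auto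
      moreover have "v \<in> {w \<in> Poly_Mapping.keys m. fst w = fst v}" using nz by (simp add: in_keys_iff)
      ultimately show False using nz by blast
    qed
    have "\<exists>r. \<forall>s. Poly_Mapping.lookup m (i, s) = (if s = r then 1 else 0)" if "i \<in> {1..n}" for i
    proof -
      let ?K = "{w \<in> Poly_Mapping.keys m. fst w = i}"
      have "sum (Poly_Mapping.lookup m) ?K = 1"
        using d[rule_format, of i] that by (simp add: deg_in_def)
      then obtain a where a: "a \<in> ?K" "Poly_Mapping.lookup m a = 1"
        "\<And>b. b \<in> ?K \<Longrightarrow> a \<noteq> b \<Longrightarrow> Poly_Mapping.lookup m b = 0"
        using sum_eq_1_iff[of ?K "Poly_Mapping.lookup m"] by auto
      have "Poly_Mapping.lookup m (i, s) = (if s = snd a then 1 else 0)" for s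
      proof (cases "s = snd a")
        case True
        then show ?thesis using a(1,2) by auto
      next
        case False
        then have "a \<noteq> (i, s)" by auto
        then show ?thesis using a(3)[of "(i, s)"] False by (auto simp: in_keys_iff)
      qed
      then show ?thesis by blast
    qed
    then obtain \<alpha> where \<alpha>: "\<And>i s. i \<in> {1..n} \<Longrightarrow> Poly_Mapping.lookup m (i, s) = (if s = \<alpha> i then 1 else 0)"
      by metis
    have "m = multi_monom {1..n} \<alpha>"
    proof (rule poly_mapping_eqI)
      fix v show "Poly_Mapping.lookup m v = Poly_Mapping.lookup (multi_monom {1..n} \<alpha>) v"
      proof (cases "fst v \<in> {1..n}")
        case True
        then show ?thesis using \<alpha>[OF True, of "snd v"] unfolding lookup_multi_monom[OF finite_atLeastAtMost] by simp
      next
        case False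
        then show ?thesis using z[OF False] unfolding lookup_multi_monom[OF finite_atLeastAtMost] by auto
      qed
    qed
    then show "m \<in> range (multi_monom {1..n})" by simp
  qed
  then show ?thesis unfolding multilinear_def by blast
qed

section \<open>Passage to symbols\<close>

definition symbol_coeffs :: "nat \<Rightarrow> 'k::field_char_0 tpoly \<Rightarrow> 'k cfun" where
  "symbol_coeffs n P \<alpha> = (\<Prod>i\<in>{1..n}. fact (\<alpha> i)) * Poly_Mapping.lookup P (\<Sum>i\<in>{1..n}. Poly_Mapping.single i (\<alpha> i))"

lemma symbol_monom_dm: "symbol_monom (multi_monom {1..n} \<alpha>) = (\<Sum>i\<in>{1..n}. Poly_Mapping.single i (\<alpha> i))"
proof -
  have keys: "Poly_Mapping.keys (multi_monom {1..n} \<alpha>) = (\<lambda>i. (i, \<alpha> i)) ` {1..n}"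
    by (auto simp: in_keys_iff lookup_multi_monom split: if_splits)
  show ?thesis
    unfolding symbol_monom_def keys by (subst sum.reindex) (auto simp: inj_on_def lookup_multi_monom)
qed

lemma lookup_sum_single:
  "finite A \<Longrightarrow> Poly_Mapping.lookup (\<Sum>i\<in>A. Poly_Mapping.single i (\<alpha> i :: nat)) j = (if j \<in> A then \<alpha> j else 0)"
  by (simp add: lookup_sum lookup_single when_def sum.delta)

lemma symbol_coeffs_symbol:
  fixes f :: "'k::field_char_0 dpoly"
  assumes "multilinear n f"
  shows "symbol_coeffs n (symbol f) = multilinear_coeffs {1..n} f"
proof (rule ext)
  fix \<alpha>
  let ?A = "{1..n}"
  have "Poly_Mapping.lookup (symbol f) (\<Sum>i\<in>?A. Poly_Mapping.single i (\<alpha> i)) =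
      (\<Sum>m\<in>Poly_Mapping.keys f. if m = multi_monom ?A \<alpha> then Poly_Mapping.lookup f m else 0)"
    unfolding symbol_def lin_ext_def lookup_sum
  proof (rule sum.cong[OF refl])
    fix m assume "m \<in> Poly_Mapping.keys f"
    then obtain \<beta> where m: "m = multi_monom ?A \<beta>" using assms multilinear_iff by blast
    have "symbol_monom m = (\<Sum>i\<in>?A. Poly_Mapping.single i (\<alpha> i)) \<longleftrightarrow> m = multi_monom ?A \<alpha>"
    proof
      assume "symbol_monom m = (\<Sum>i\<in>?A. Poly_Mapping.single i (\<alpha> i))"
      then have "(\<Sum>i\<in>?A. Poly_Mapping.single i (\<beta> i)) = (\<Sum>i\<in>?A. Poly_Mapping.single i (\<alpha> i))"
        by (simp only: m symbol_monom_dm)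
      then have "\<beta> i = \<alpha> i" if "i \<in> ?A" for i
        using lookup_sum_single[of ?A \<alpha> i] lookup_sum_single[of ?A \<beta> i] that by simp
      then show "m = multi_monom ?A \<alpha>" by (simp add: m multi_monom_eq_iff)
    qed (simp only: symbol_monom_dm)
    then show "Poly_Mapping.lookup (scale (Poly_Mapping.lookup f m) (Poly_Mapping.single (symbol_monom m) 1))
        (\<Sum>i\<in>?A. Poly_Mapping.single i (\<alpha> i)) = (if m = multi_monom ?A \<alpha> then Poly_Mapping.lookup f m else 0)"
      by (simp add: lookup_scale lookup_single when_def)
  qed
  also have "\<dots> = Poly_Mapping.lookup f (multi_monom ?A \<alpha>)"
    by (simp add: sum.delta in_keys_iff)
  finally show "symbol_coeffs n (symbol f) \<alpha> = multilinear_coeffs ?A f \<alpha>" by (simp add: symbol_coeffs_def multilinear_coeffs_def)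
qed

interpretation sf: vector_space_pair scale fscale ..

lemma linear_symbol_coeffs: "Vector_Spaces.linear scale fscale (symbol_coeffs n)"
  by (unfold_locales) (simp_all add: fun_eq_iff symbol_coeffs_def lookup_add lookup_scale fscale_def algebra_simps)

lemma symbol_coeffs_lie_symbols:
  "symbol_coeffs n ` lie_symbols n = fs.span (tree_symbol (-1 :: 'k::field_char_0) ` trees {1..n})"
proof
  let ?S = "tree_symbol (-1 :: 'k) ` trees {1..n}"
  show "symbol_coeffs n ` lie_symbols n \<subseteq> fs.span ?S"
    using multilinear_coeffs_lie(1)[of _ n "{1..n}"] by (auto simp: lie_symbols_def Nov_def symbol_coeffs_symbol)
  have "?S \<subseteq> symbol_coeffs n ` lie_symbols n"
  proof
    fix c assume "c \<in> ?S"
    then obtain T where T: "distinct (leaves T)" "set (leaves T) = {1..n}" "c = tree_symbol (-1) T"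
      by (auto simp: trees_def)
    let ?f = "lie_tree T :: 'k dpoly"
    have lie: "?f \<in> lie_elements n" using T by (intro lie_tree_lie) simp
    moreover have ml: "multilinear n ?f"
      unfolding multilinear_iff using keys_lie_tree[OF T(1)] T(2) by metis
    ultimately have "?f \<in> Nov n \<inter> lie_elements n"
      using lie_elements_subset by (auto simp: Nov_def)
    moreover have "c = symbol_coeffs n (symbol ?f)"
      using multilinear_coeffs_lie_tree[OF T(1), of "{1..n}", where ?'k = 'k] T(2,3) by (simp add: symbol_coeffs_symbol[OF ml])
    ultimately show "c \<in> symbol_coeffs n ` lie_symbols n" by (auto simp: lie_symbols_def)
  qed
  then show "fs.span ?S \<subseteq> symbol_coeffs n ` lie_symbols n"
    by (rule fs.span_minimal) (rule sf.linear_subspace_image[OF linear_symbol_coeffs subspace_lie_symbols])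
qed

text \<open>In general \<open>symbol_coeffs n\<close> forgets monomials with a variable outside
  \<open>t\<^sub>1, ..., t\<^sub>n\<close>. A multilinear \<open>f\<close>, however, is recovered
  from its coefficients, since factorials are nonzero in characteristic 0.\<close>

lemma inj_symbol_coeffs: "inj_on (symbol_coeffs n) (lie_symbols n :: 'k::field_char_0 tpoly set)"
proof (rule inj_onI)
  fix P Q :: "'k tpoly" assume "P \<in> lie_symbols n" "Q \<in> lie_symbols n" "symbol_coeffs n P = symbol_coeffs n Q"
  then obtain f g :: "'k dpoly" where fg: "P = symbol f" "Q = symbol g" "multilinear n f" "multilinear n g"
    "multilinear_coeffs {1..n} f = multilinear_coeffs {1..n} g"
    by (auto simp: lie_symbols_def Nov_def symbol_coeffs_symbol)
  have "f = g"
  proof (rule poly_mapping_eqI)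
    fix m
    show "Poly_Mapping.lookup f m = Poly_Mapping.lookup g m"
    proof (cases "m \<in> range (multi_monom {1..n})")
      case True
      then obtain \<alpha> where m: "m = multi_monom {1..n} \<alpha>" by blast
      have "multilinear_coeffs {1..n} f \<alpha> = multilinear_coeffs {1..n} g \<alpha>" using fg(5) by simp
      then show ?thesis by (simp add: m multilinear_coeffs_def)
    next
      case False
      then show ?thesis using fg(3,4) unfolding multilinear_iff by (metis in_keys_iff subsetD)
    qed
  qed
  then show "P = Q" using fg by simp
qed

lemma dim_lie_symbols:
  assumes "n \<ge> 1"
  shows "scale.dim (lie_symbols n :: 'k::field_char_0 tpoly set) = card (stairs n (n - 1))"
proof -
  let ?V = "lie_symbols n :: 'k tpoly set"
  obtain B where B: "B \<subseteq> ?V" "scale.independent B" "?V \<subseteq> scale.span B" "card B = scale.dim ?V"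
    by (rule scale.basis_exists)
  have sp: "scale.span B = ?V"
    using B scale.span_minimal[OF B(1) subspace_lie_symbols] by blast
  have "fs.independent (symbol_coeffs n ` B)"
    by (rule sf.linear_independent_injective_image[OF linear_symbol_coeffs B(2)]) (simp add: sp inj_symbol_coeffs)
  moreover have "fs.span (symbol_coeffs n ` B) = fs.span (tree_symbol (-1) ` trees {1..n})"
    using sf.linear_span_image[OF linear_symbol_coeffs, of n B] sp symbol_coeffs_lie_symbols by metis
  ultimately have "fs.dim (fs.span (tree_symbol (-1 :: 'k) ` trees {1..n})) = card (symbol_coeffs n ` B)"
    using fs.dim_eq_card[of "symbol_coeffs n ` B" "fs.span (tree_symbol (-1) ` trees {1..n})"] by (simp add: fs.span_span)
  moreover have "card (symbol_coeffs n ` B) = card B"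
    by (rule card_image) (rule inj_on_subset[OF inj_symbol_coeffs B(1)])
  ultimately show ?thesis using B(4) dim_span_trees[OF assms, where ?'k = 'k] by simp
qed

section \<open>Permutations with a given number of inversions\<close>

text \<open>Only the default value outside \<open>{1..n}\<close> differs: \<open>undefined\<close>
  in \<open>PiE\<close>, 0 in \<open>stairs\<close>.\<close>

lemma card_stairs_PiE:
  "card {g \<in> PiE {1..n} (\<lambda>j. {..<j}). (\<Sum>j=1..n. g j) = k} = card (stairs n k)"
  (is "card {g \<in> ?P. _} = _")
proof (rule bij_betw_same_card[of "restrict0 {1..n}"], rule bij_betw_imageI)
  show "inj_on (restrict0 {1..n}) {g \<in> ?P. (\<Sum>j=1..n. g j) = k}"
  proof (rule inj_onI)
    fix g h assume gh: "g \<in> {g \<in> ?P. (\<Sum>j=1..n. g j) = k}" "h \<in> {g \<in> ?P. (\<Sum>j=1..n. g j) = k}" "restrict0 {1..n} g = restrict0 {1..n} h"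
    have "g i = h i" if "i \<in> {1..n}" for i
      using fun_cong[OF gh(3), of i] unfolding restrict0_def if_P[OF that] .
    then show "g = h" using gh(1,2) by (intro PiE_ext[of g "{1..n}" "\<lambda>j. {..<j}" h]) blast+
  qed
  show "restrict0 {1..n} ` {g \<in> ?P. (\<Sum>j=1..n. g j) = k} = stairs n k"
  proof
    show "restrict0 {1..n} ` {g \<in> ?P. (\<Sum>j=1..n. g j) = k} \<subseteq> stairs n k"
      by (auto simp: stairs_def exponents_def restrict0_def PiE_iff)
    show "stairs n k \<subseteq> restrict0 {1..n} ` {g \<in> ?P. (\<Sum>j=1..n. g j) = k}"
    proof
      fix \<beta> assume \<beta>: "\<beta> \<in> stairs n k"
      then have "\<beta> = restrict0 {1..n} (restrict \<beta> {1..n})"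
        by (auto simp: fun_eq_iff restrict0_def stairs_def exponents_def)
      moreover have "restrict \<beta> {1..n} \<in> {g \<in> ?P. (\<Sum>j=1..n. g j) = k}"
        using \<beta> by (auto simp: stairs_def exponents_def)
      ultimately show "\<beta> \<in> restrict0 {1..n} ` {g \<in> ?P. (\<Sum>j=1..n. g j) = k}" by (rule image_eqI)
    qed
  qed
qed

lemma card_stairs: "card (stairs n k) = coeff (\<Prod>j=1..n. \<Sum>i<j. monom (1::nat) i) k"
proof -
  let ?P = "PiE {1..n} (\<lambda>j. {..<j})"
  have "(\<Prod>j=1..n. \<Sum>i<j. monom (1::nat) i) = (\<Sum>g\<in>?P. \<Prod>j=1..n. monom 1 (g j))"
    by (rule prod_sum_PiE) auto
  also have "\<dots> = (\<Sum>g\<in>?P. monom 1 (\<Sum>j=1..n. g j))"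
  proof (rule sum.cong[OF refl])
    fix g
    have "(\<Prod>j\<in>A. monom (1::nat) (g j)) = monom 1 (\<Sum>j\<in>A. g j)" if "finite A" for A :: "nat set"
      using that by (induction A) (simp_all add: mult_monom monom_0 one_pCons del: One_nat_def)
    then show "(\<Prod>j=1..n. monom (1::nat) (g j)) = monom 1 (\<Sum>j=1..n. g j)" by simp
  qed
  finally have "coeff (\<Prod>j=1..n. \<Sum>i<j. monom (1::nat) i) k = (\<Sum>g\<in>?P. if (\<Sum>j=1..n. g j) = k then 1 else 0)"
    by (simp add: coeff_sum del: One_nat_def)
  also have "\<dots> = card {g \<in> ?P. (\<Sum>j=1..n. g j) = k}"
    by (simp add: sum.If_cases finite_PiE Int_def)
  also have "\<dots> = card (stairs n k)" by (rule card_stairs_PiE)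
  finally show ?thesis by simp
qed

text \<open>The inversion table, or Lehmer code: position \<open>j\<close> records the number of
  larger values to its left, which is at most \<open>j - 1\<close>. The default
  \<open>undefined\<close> places it in \<open>PiE\<close>.\<close>

definition inv_code :: "nat \<Rightarrow> (nat \<Rightarrow> nat) \<Rightarrow> nat \<Rightarrow> nat" where
  "inv_code n \<sigma> j = (if j \<in> {1..n} then card {i. 1 \<le> i \<and> i < j \<and> \<sigma> i > \<sigma> j} else undefined)"

lemma inv_code_PiE: "inv_code n \<sigma> \<in> PiE {1..n} (\<lambda>j. {..<j})"
proof (rule PiE_I)
  fix j assume j: "j \<in> {1..n}"
  have "card {i. 1 \<le> i \<and> i < j \<and> \<sigma> i > \<sigma> j} \<le> card {1..<j}" by (rule card_mono) auto
  then show "inv_code n \<sigma> j \<in> {..<j}" using j by (auto simp: inv_code_def)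
qed (auto simp: inv_code_def)

lemma sum_inv_code: "(\<Sum>j=1..n. inv_code n \<sigma> j) = card (inversions n \<sigma>)"
proof -
  have "inversions n \<sigma> = (\<lambda>(j, i). (i, j)) ` (SIGMA j:{1..n}. {i. 1 \<le> i \<and> i < j \<and> \<sigma> i > \<sigma> j})"
    by (auto simp: inversions_def image_iff)
  then have "card (inversions n \<sigma>) = card (SIGMA j:{1..n}. {i. 1 \<le> i \<and> i < j \<and> \<sigma> i > \<sigma> j})"
    by (simp add: card_image inj_on_def)
  also have "\<dots> = (\<Sum>j\<in>{1..n}. card {i. 1 \<le> i \<and> i < j \<and> \<sigma> i > \<sigma> j})" by simp
  also have "\<dots> = (\<Sum>j=1..n. inv_code n \<sigma> j)" by (rule sum.cong) (auto simp: inv_code_def)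
  finally show ?thesis by simp
qed

lemma inj_inv_code: "inj_on (inv_code n) {\<sigma>. \<sigma> permutes {1..n}}"
proof (rule inj_onI)
  fix \<sigma> \<tau> assume st: "\<sigma> \<in> {\<sigma>. \<sigma> permutes {1..n}}" "\<tau> \<in> {\<sigma>. \<sigma> permutes {1..n}}" "inv_code n \<sigma> = inv_code n \<tau>"
  have inj: "inj \<sigma>" "inj \<tau>" using st permutes_inj by auto
  text \<open>The set of \<open>i < j\<close> with \<open>\<sigma> i > \<sigma> j\<close> is an upper set for the order induced by \<open>\<sigma>\<close> on
    \<open>{1..<j}\<close>, so this order and the size of the set determine it.\<close>
  have same: "\<forall>i\<in>{1..m}. \<forall>j\<in>{1..m}. \<sigma> i < \<sigma> j \<longleftrightarrow> \<tau> i < \<tau> j" if "m \<le> n" for m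
    using that
  proof (induction m)
    case (Suc m)
    let ?x = "Suc m"
    let ?U = "\<lambda>\<rho>. {i. 1 \<le> i \<and> i < ?x \<and> \<rho> i > \<rho> ?x}"
    have IH: "\<sigma> i < \<sigma> j \<longleftrightarrow> \<tau> i < \<tau> j" if "i \<in> {1..m}" "j \<in> {1..m}" for i j
      using Suc that by auto
    have fin: "finite (?U \<rho>)" for \<rho> :: "nat \<Rightarrow> nat" by (rule finite_subset[of _ "{1..m}"]) auto
    have card: "card (?U \<sigma>) = card (?U \<tau>)"
      using fun_cong[OF st(3), of ?x] Suc.prems by (simp add: inv_code_def)
    have chain: "?U \<sigma> \<subseteq> ?U \<tau> \<or> ?U \<tau> \<subseteq> ?U \<sigma>"
    proof (rule ccontr)
      assume "\<not> ?thesis"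
      then obtain a b where ab: "a \<in> ?U \<sigma>" "a \<notin> ?U \<tau>" "b \<in> ?U \<tau>" "b \<notin> ?U \<sigma>" by blast
      then have "a \<in> {1..m}" "b \<in> {1..m}" "\<sigma> b < \<sigma> a" "\<tau> a < \<tau> b" by auto
      then show False using IH[of b a] by simp
    qed
    have U: "?U \<sigma> = ?U \<tau>"
      using chain card_subset_eq[OF fin, of "?U \<sigma>" \<tau>] card_subset_eq[OF fin, of "?U \<tau>" \<sigma>] card by auto
    have gt: "\<sigma> ?x < \<sigma> i \<longleftrightarrow> \<tau> ?x < \<tau> i" if "i \<in> {1..m}" for i
    proof -
      have "i \<in> ?U \<sigma> \<longleftrightarrow> i \<in> ?U \<tau>" by (simp only: U)
      then show ?thesis using that by simp
    qed
    have ne: "\<sigma> i \<noteq> \<sigma> ?x" "\<tau> i \<noteq> \<tau> ?x" if "i \<in> {1..m}" for i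
      using that inj by (auto simp: inj_eq)
    have lt: "\<sigma> i < \<sigma> ?x \<longleftrightarrow> \<tau> i < \<tau> ?x" if "i \<in> {1..m}" for i
      using gt[OF that] ne[OF that] by (meson linorder_neqE_nat order_less_asym)
    show ?case
    proof (intro ballI)
      fix i j assume "i \<in> {1..?x}" "j \<in> {1..?x}"
      then consider "i \<in> {1..m}" "j \<in> {1..m}" | "i = ?x" "j \<in> {1..m}" | "i \<in> {1..m}" "j = ?x" | "i = ?x" "j = ?x"
        by force
      then show "\<sigma> i < \<sigma> j \<longleftrightarrow> \<tau> i < \<tau> j" by cases (use IH gt lt in auto)
    qed
  qed simp
  \<comment> \<open>The values of a permutation are their own ranks, so the order of the values
    determines it.\<close>
  have rank: "card {j \<in> {1..n}. \<rho> j \<le> \<rho> i} = \<rho> i" if "\<rho> permutes {1..n}" "i \<in> {1..n}" for \<rho> i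
  proof -
    have "\<rho> ` {j \<in> {1..n}. \<rho> j \<le> \<rho> i} = {1..\<rho> i}"
    proof
      show "\<rho> ` {j \<in> {1..n}. \<rho> j \<le> \<rho> i} \<subseteq> {1..\<rho> i}"
        using permutes_in_image[OF that(1)] by fastforce
      have "\<rho> i \<le> n" using permutes_in_image[OF that(1), of i] that(2) by simp
      show "{1..\<rho> i} \<subseteq> \<rho> ` {j \<in> {1..n}. \<rho> j \<le> \<rho> i}"
      proof (intro subsetI)
        fix x assume x: "x \<in> {1..\<rho> i}"
        then have "x \<in> \<rho> ` {1..n}" using \<open>\<rho> i \<le> n\<close> permutes_image[OF that(1)] by simp
        then show "x \<in> \<rho> ` {j \<in> {1..n}. \<rho> j \<le> \<rho> i}" using x by auto
      qed
    qed
    moreover have "inj_on \<rho> {j \<in> {1..n}. \<rho> j \<le> \<rho> i}"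
      using permutes_inj[OF that(1)] inj_on_subset by blast
    ultimately show ?thesis using card_image[of \<rho> "{j \<in> {1..n}. \<rho> j \<le> \<rho> i}"] by simp
  qed
  show "\<sigma> = \<tau>"
  proof
    fix i
    show "\<sigma> i = \<tau> i"
    proof (cases "i \<in> {1..n}")
      case True
      have "{j \<in> {1..n}. \<sigma> j \<le> \<sigma> i} = {j \<in> {1..n}. \<tau> j \<le> \<tau> i}"
        using same[of n] True by (auto simp: not_less[symmetric])
      then show ?thesis using rank[of \<sigma> i] rank[of \<tau> i] st(1,2) True by simp
    next
      case False
      then show ?thesis using st(1,2) by (simp add: permutes_def)
    qed
  qed
qed

text \<open>Injectivity suffices, as both sets have \<open>fact n\<close> elements.\<close>

lemma bij_inv_code: "bij_betw (inv_code n) {\<sigma>. \<sigma> permutes {1..n}} (PiE {1..n} (\<lambda>j. {..<j}))"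
proof -
  have "card (PiE {1..n} (\<lambda>j. {..<j})) = fact n"
    by (simp add: card_PiE fact_prod)
  then have "card (inv_code n ` {\<sigma>. \<sigma> permutes {1..n}}) = card (PiE {1..n} (\<lambda>j. {..<j}))"
    using card_image[OF inj_inv_code, of n] card_permutations[of "{1..n}" n] by simp
  then have "inv_code n ` {\<sigma>. \<sigma> permutes {1..n}} = PiE {1..n} (\<lambda>j. {..<j})"
    using inv_code_PiE by (intro card_subset_eq finite_PiE) auto
  then show ?thesis using inj_inv_code by (simp add: bij_betw_def)
qed

lemma card_PiE_sum_inversions:
  "card {g \<in> PiE {1..n} (\<lambda>j. {..<j}). (\<Sum>j=1..n. g j) = k} =
   card {\<sigma>. \<sigma> permutes {1..n} \<and> card (inversions n \<sigma>) = k}"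
proof -
  let ?P = "{\<sigma>. \<sigma> permutes {1..n}}" and ?Q = "\<lambda>g. (\<Sum>j=1..n. g j) = k"
  have "inv_code n ` {\<sigma> \<in> ?P. ?Q (inv_code n \<sigma>)} = {g \<in> inv_code n ` ?P. ?Q g}" by blast
  moreover have "inv_code n ` ?P = PiE {1..n} (\<lambda>j. {..<j})" using bij_inv_code by (rule bij_betw_imp_surj_on)
  moreover have "{\<sigma> \<in> ?P. ?Q (inv_code n \<sigma>)} = {\<sigma>. \<sigma> permutes {1..n} \<and> card (inversions n \<sigma>) = k}"
    by (simp only: sum_inv_code mem_Collect_eq)
  moreover have "card (inv_code n ` {\<sigma> \<in> ?P. ?Q (inv_code n \<sigma>)}) = card {\<sigma> \<in> ?P. ?Q (inv_code n \<sigma>)}"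
    by (rule card_image, rule inj_on_subset[OF inj_inv_code]) blast
  ultimately show ?thesis by simp
qed

theorem corollary7p4:
  fixes n :: nat
  assumes "n \<ge> 1"
  shows "vector_space.dim scale (lie_symbols n :: 'k::field_char_0 tpoly set) =
           coeff (\<Prod>j=1..n. \<Sum>i<j. monom (1::nat) i) (n - 1)
       \<and> vector_space.dim scale (lie_symbols n :: 'k tpoly set) =
           card {\<sigma>. \<sigma> permutes {1..n} \<and> card (inversions n \<sigma>) = n - 1}"
  using dim_lie_symbols[OF assms, where ?'k = 'k] card_stairs[of n "n - 1"]
    card_stairs_PiE[of n "n - 1"] card_PiE_sum_inversions[of n "n - 1"] by metis

end
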